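(* Let $M$ be an orientable manifold. If $\Pi$ and $\widetilde{\Pi}$ are gauge equivalent Poisson structures on $M$, then $$\operatorname{Mod}(M,\Pi)=0\iff\operatorname{Mod}(M,\widetilde{\Pi})=0.$$
   Context: Everything is smooth. For a Poisson bivector field $\Pi$ on $M$, $\Pi^\sharp:T^*M\to TM$ is given by $\langle\beta,\Pi^\sharp\alpha\rangle=\Pi(\alpha,\beta)$. $H^1_\Pi(M)=\{X: L_X\Pi=0\}/\{\Pi^\sharp df: f\in C^\infty(M)\}$. If $M$ is orientable with volume form $\Omega$, the modular vector field $Z_\Pi^\Omega$ is defined by $Z_\Pi^\Omega(f)=\operatorname{div}^\Omega(\Pi^\sharp df)$; its class $\operatorname{Mod}(M,\Pi)=[Z_\Pi^\Omega]\in H^1_\Pi(M)$ does not depend on $\Omega$ and is the modular class. Gauge equivalence: let $B$ be a closed 2-form on $M$, $B^\flat(X)=\mathbf{i}_XB$, such that the endomorphism $\operatorname{Id}-B^\flat\circ\Pi^\sharp:T^*M\to T^*M$ is invertible. Then $\widetilde{\Pi}^\sharp=\Pi^\sharp\circ(\operatorname{Id}-B^\flat\circ\Pi^\sharp)^{-1}$ defines a Poisson bivector field $\widetilde{\Pi}$ on $M$, and $\widetilde{\Pi}$ is said to be gauge equivalent to $\Pi$. *)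

theory Defs
  imports "HOL-Analysis.Analysis"
begin

section \<open>Smooth manifolds\<close>

fun Ck_on :: "nat \<Rightarrow> 'a::real_normed_vector set \<Rightarrow> ('a \<Rightarrow> 'b::real_normed_vector) \<Rightarrow> bool" where
  "Ck_on 0 S f \<longleftrightarrow> continuous_on S f"
| "Ck_on (Suc k) S f \<longleftrightarrow>
     (\<forall>x\<in>S. f differentiable (at x)) \<and> (\<forall>v. Ck_on k S (\<lambda>x. frechet_derivative f (at x) v))"

text \<open>Only meant for open \<open>S\<close> in a finite-dimensional space.\<close>

definition smooth_on :: "'a::real_normed_vector set \<Rightarrow> ('a \<Rightarrow> 'b::real_normed_vector) \<Rightarrow> bool" where
  "smooth_on S f \<longleftrightarrow> (\<forall>k. Ck_on k S f)"

text \<open>A chart is a domain \<open>U\<close> with a coordinate map; values of the map outside \<open>U\<close> are irrelevant.\<close>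

type_synonym ('m, 'n) chart = "'m set \<times> ('m \<Rightarrow> real ^ 'n)"

abbreviation dom_of :: "('m, 'n) chart \<Rightarrow> 'm set" where "dom_of c \<equiv> fst c"
abbreviation coord :: "('m, 'n) chart \<Rightarrow> 'm \<Rightarrow> real ^ 'n" where "coord c \<equiv> snd c"

definition cinv :: "('m, 'n) chart \<Rightarrow> real ^ 'n \<Rightarrow> 'm" where
  "cinv c = inv_into (dom_of c) (coord c)"

definition is_chart :: "('m::topological_space, 'n::finite) chart \<Rightarrow> bool" where
  "is_chart c \<longleftrightarrow> open (dom_of c) \<and> open (coord c ` dom_of c) \<and>
     (\<exists>g. homeomorphism (dom_of c) (coord c ` dom_of c) (coord c) g)"

text \<open>The manifold \<open>M\<close> is the whole type \<open>'m\<close> (Hausdorff and second countable by its sort), with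
  smooth structure given by an atlas of charts with values in \<open>real ^ 'n\<close>; its dimension is
  \<open>CARD('n)\<close>. All notions below only refer to the charts of the given atlas.\<close>

definition smooth_atlas ::
  "('m::{t2_space, second_countable_topology}, 'n::finite) chart set \<Rightarrow> bool" where
  "smooth_atlas A \<longleftrightarrow>
     (\<forall>c\<in>A. is_chart c) \<and> (\<Union>c\<in>A. dom_of c) = UNIV \<and>
     (\<forall>c\<in>A. \<forall>d\<in>A. smooth_on (coord c ` (dom_of c \<inter> dom_of d)) (coord d \<circ> cinv c))"

definition smooth_fun :: "('m, 'n::finite) chart set \<Rightarrow> ('m \<Rightarrow> 'b::real_normed_vector) \<Rightarrow> bool" where
  "smooth_fun A f \<longleftrightarrow> (\<forall>c\<in>A. smooth_on (coord c ` dom_of c) (f \<circ> cinv c))"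

text \<open>Derivative at \<open>p\<close> of the coordinate expression of \<open>F\<close> in the chart \<open>c\<close>, in direction \<open>v\<close>.\<close>

definition chart_deriv ::
  "('m, 'n::finite) chart \<Rightarrow> ('m \<Rightarrow> 'b::real_normed_vector) \<Rightarrow> 'm \<Rightarrow> real ^ 'n \<Rightarrow> 'b" where
  "chart_deriv c F p v = frechet_derivative (F \<circ> cinv c) (at (coord c p)) v"

definition transition_jac ::
  "('m, 'n::finite) chart \<Rightarrow> ('m, 'n) chart \<Rightarrow> 'm \<Rightarrow> real ^ 'n ^ 'n" where
  "transition_jac c d p = matrix (chart_deriv c (coord d) p)"


section \<open>Tensor fields\<close>

text \<open>A tensor field \<open>T\<close> is the family of its coordinate expressions: \<open>T c p\<close> is the component
  array at \<open>p\<close> in the chart \<open>c\<close>, subject to the transformation law of the tensor type.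
  Only the values with \<open>c \<in> A\<close> and \<open>p \<in> dom_of c\<close> matter; for vector fields the others are
  set to \<open>0\<close>, so that equality of vector fields is equality in HOL.\<close>

type_synonym ('m, 'n, 'b) field = "('m, 'n) chart \<Rightarrow> 'm \<Rightarrow> 'b"

definition smooth_field ::
  "('m, 'n::finite) chart set \<Rightarrow> ('m, 'n, 'b::real_normed_vector) field \<Rightarrow> bool" where
  "smooth_field A T \<longleftrightarrow> (\<forall>c\<in>A. smooth_on (coord c ` dom_of c) (T c \<circ> cinv c))"

definition vector_field :: "('m, 'n::finite) chart set \<Rightarrow> ('m, 'n, real ^ 'n) field \<Rightarrow> bool" where
  "vector_field A X \<longleftrightarrow>
     smooth_field A X \<and>
     (\<forall>c\<in>A. \<forall>d\<in>A. \<forall>p\<in>dom_of c \<inter> dom_of d. X d p = transition_jac c d p *v X c p) \<and>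
     (\<forall>c p. \<not> (c \<in> A \<and> p \<in> dom_of c) \<longrightarrow> X c p = 0)"

text \<open>A bivector field has components \<open>\<Pi> c p $ i $ j = \<Pi>(dx\<^sub>i, dx\<^sub>j)\<close>,
  so that \<open>\<Pi>(\<alpha>, \<beta>) = \<alpha> \<bullet> (\<Pi> c p *v \<beta>)\<close>.\<close>

definition bivector_field ::
  "('m, 'n::finite) chart set \<Rightarrow> ('m, 'n, real ^ 'n ^ 'n) field \<Rightarrow> bool" where
  "bivector_field A P \<longleftrightarrow>
     smooth_field A P \<and>
     (\<forall>c\<in>A. \<forall>p\<in>dom_of c. transpose (P c p) = - P c p) \<and>
     (\<forall>c\<in>A. \<forall>d\<in>A. \<forall>p\<in>dom_of c \<inter> dom_of d.
        P d p = transition_jac c d p ** P c p ** transpose (transition_jac c d p))"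

text \<open>A 2-form has components \<open>B c p $ i $ j = B(\<partial>\<^sub>i, \<partial>\<^sub>j)\<close>,
  so that \<open>B(X, Y) = X \<bullet> (B c p *v Y)\<close>.\<close>

definition two_form ::
  "('m, 'n::finite) chart set \<Rightarrow> ('m, 'n, real ^ 'n ^ 'n) field \<Rightarrow> bool" where
  "two_form A B \<longleftrightarrow>
     smooth_field A B \<and>
     (\<forall>c\<in>A. \<forall>p\<in>dom_of c. transpose (B c p) = - B c p) \<and>
     (\<forall>c\<in>A. \<forall>d\<in>A. \<forall>p\<in>dom_of c \<inter> dom_of d.
        B c p = transpose (transition_jac c d p) ** B d p ** transition_jac c d p)"

text \<open>The condition \<open>dB = 0\<close>.\<close>

definition closed_two_form ::
  "('m, 'n::finite) chart set \<Rightarrow> ('m, 'n, real ^ 'n ^ 'n) field \<Rightarrow> bool" where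
  "closed_two_form A B \<longleftrightarrow>
     two_form A B \<and>
     (\<forall>c\<in>A. \<forall>p\<in>dom_of c. \<forall>i j k.
        chart_deriv c (B c) p (axis i 1) $ j $ k
      + chart_deriv c (B c) p (axis j 1) $ k $ i
      + chart_deriv c (B c) p (axis k 1) $ i $ j = 0)"

text \<open>Forms of top degree: \<open>\<Omega> c p V\<close> is the value on the tuple \<open>(V $ i)\<close> of \<open>CARD('n)\<close> vectors.\<close>

definition alternating_multilinear :: "(real ^ 'n ^ 'n::finite \<Rightarrow> real) \<Rightarrow> bool" where
  "alternating_multilinear w \<longleftrightarrow>
     (\<forall>V i. linear (\<lambda>v. w (\<chi> j. if j = i then v else V $ j))) \<and>
     (\<forall>V i j. i \<noteq> j \<and> V $ i = V $ j \<longrightarrow> w V = 0)"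

definition volume_form ::
  "('m, 'n::finite) chart set \<Rightarrow> ('m, 'n, real ^ 'n ^ 'n \<Rightarrow> real) field \<Rightarrow> bool" where
  "volume_form A \<Omega> \<longleftrightarrow>
     (\<forall>V. smooth_field A (\<lambda>c p. \<Omega> c p V)) \<and>
     (\<forall>c\<in>A. \<forall>p\<in>dom_of c. alternating_multilinear (\<Omega> c p)) \<and>
     (\<forall>c\<in>A. \<forall>d\<in>A. \<forall>p\<in>dom_of c \<inter> dom_of d. \<forall>V.
        \<Omega> c p V = \<Omega> d p (\<chi> i. transition_jac c d p *v V $ i)) \<and>
     (\<forall>c\<in>A. \<forall>p\<in>dom_of c. \<exists>V. \<Omega> c p V \<noteq> 0)"

definition orientable :: "('m, 'n::finite) chart set \<Rightarrow> bool" where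
  "orientable A \<longleftrightarrow> (\<exists>\<Omega>. volume_form A \<Omega>)"


section \<open>Vector fields acting on functions, Lie derivatives, divergence\<close>

text \<open>The function \<open>X(f)\<close>; the value does not depend on the chart chosen around \<open>p\<close>.\<close>

definition vf_app ::
  "('m, 'n::finite) chart set \<Rightarrow> ('m, 'n, real ^ 'n) field \<Rightarrow> ('m \<Rightarrow> real) \<Rightarrow> 'm \<Rightarrow> real" where
  "vf_app A X f p = (let c = (SOME c. c \<in> A \<and> p \<in> dom_of c) in chart_deriv c f p (X c p))"

definition differential :: "('m \<Rightarrow> real) \<Rightarrow> ('m, 'n::finite, real ^ 'n) field" where
  "differential f c p = (\<chi> i. chart_deriv c f p (axis i 1))"

text \<open>\<open>(L\<^sub>X \<Pi>)\<^sub>i\<^sub>j = \<Sum>\<^sub>k. X\<^sub>k \<partial>\<^sub>k\<Pi>\<^sub>i\<^sub>j - \<Pi>\<^sub>k\<^sub>j \<partial>\<^sub>kX\<^sub>i - \<Pi>\<^sub>i\<^sub>k \<partial>\<^sub>kX\<^sub>j\<close>\<close>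

definition lie_bivector ::
  "('m, 'n::finite, real ^ 'n) field \<Rightarrow> ('m, 'n, real ^ 'n ^ 'n) field
   \<Rightarrow> ('m, 'n, real ^ 'n ^ 'n) field" where
  "lie_bivector X P c p =
     (let DX = matrix (chart_deriv c (X c) p)
      in chart_deriv c (P c) p (X c p) - DX ** P c p - P c p ** transpose DX)"

text \<open>\<open>(L\<^sub>X \<Omega>)(V\<^sub>1, \<dots>, V\<^sub>n) = X(\<Omega>(V\<^sub>1, \<dots>, V\<^sub>n)) - \<Sum>\<^sub>i. \<Omega>(\<dots>, [X, V\<^sub>i], \<dots>)\<close>, where the \<open>V\<^sub>i\<close> are constant
  in the chart, so that \<open>[X, V\<^sub>i]\<close> is minus the derivative of \<open>X\<close> in direction \<open>V\<^sub>i\<close>.\<close>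

definition lie_top_form ::
  "('m, 'n::finite, real ^ 'n) field \<Rightarrow> ('m, 'n, real ^ 'n ^ 'n \<Rightarrow> real) field
   \<Rightarrow> ('m, 'n, real ^ 'n ^ 'n \<Rightarrow> real) field" where
  "lie_top_form X \<Omega> c p V =
     chart_deriv c (\<lambda>q. \<Omega> c q V) p (X c p)
     + (\<Sum>i\<in>UNIV. \<Omega> c p (\<chi> j. if j = i then chart_deriv c (X c) p (V $ i) else V $ j))"

definition divergence ::
  "('m, 'n::finite) chart set \<Rightarrow> ('m, 'n, real ^ 'n ^ 'n \<Rightarrow> real) field
   \<Rightarrow> ('m, 'n, real ^ 'n) field \<Rightarrow> 'm \<Rightarrow> real" where
  "divergence A \<Omega> X =
     (THE u. \<forall>c\<in>A. \<forall>p\<in>dom_of c. \<forall>V. lie_top_form X \<Omega> c p V = u p * \<Omega> c p V)"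


section \<open>Poisson structures and the modular class\<close>

text \<open>The condition \<open>[\<Pi>, \<Pi>] = 0\<close> in components.\<close>

definition poisson_bivector ::
  "('m, 'n::finite) chart set \<Rightarrow> ('m, 'n, real ^ 'n ^ 'n) field \<Rightarrow> bool" where
  "poisson_bivector A P \<longleftrightarrow>
     bivector_field A P \<and>
     (\<forall>c\<in>A. \<forall>p\<in>dom_of c. \<forall>i j k.
        (\<Sum>l\<in>UNIV. P c p $ l $ i * chart_deriv c (P c) p (axis l 1) $ j $ k
                 + P c p $ l $ j * chart_deriv c (P c) p (axis l 1) $ k $ i
                 + P c p $ l $ k * chart_deriv c (P c) p (axis l 1) $ i $ j) = 0)"

definition sharp :: "real ^ 'n ^ 'n::finite \<Rightarrow> real ^ 'n ^ 'n" where
  "sharp P = transpose P"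

lemma sharp_pairing: "\<beta> \<bullet> (sharp P *v \<alpha>) = \<alpha> \<bullet> (P *v \<beta>)"
  by (simp add: sharp_def dot_lmul_matrix inner_commute[of \<beta>])

definition flat :: "real ^ 'n ^ 'n::finite \<Rightarrow> real ^ 'n ^ 'n" where
  "flat B = transpose B"

lemma flat_pairing: "(flat B *v X) \<bullet> Y = X \<bullet> (B *v Y)"
  by (simp add: flat_def dot_lmul_matrix)

text \<open>The vector field \<open>\<Pi>\<^sup>\<sharp> df\<close>.\<close>

definition hamiltonian ::
  "('m, 'n::finite) chart set \<Rightarrow> ('m, 'n, real ^ 'n ^ 'n) field \<Rightarrow> ('m \<Rightarrow> real)
   \<Rightarrow> ('m, 'n, real ^ 'n) field" where
  "hamiltonian A P f c p =
     (if c \<in> A \<and> p \<in> dom_of c then sharp (P c p) *v differential f c p else 0)"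

definition poisson_vector_fields ::
  "('m, 'n::finite) chart set \<Rightarrow> ('m, 'n, real ^ 'n ^ 'n) field
   \<Rightarrow> ('m, 'n, real ^ 'n) field set" where
  "poisson_vector_fields A P =
     {X. vector_field A X \<and> (\<forall>c\<in>A. \<forall>p\<in>dom_of c. lie_bivector X P c p = 0)}"

definition cohomologous ::
  "('m, 'n::finite) chart set \<Rightarrow> ('m, 'n, real ^ 'n ^ 'n) field
   \<Rightarrow> (('m, 'n, real ^ 'n) field \<times> ('m, 'n, real ^ 'n) field) set" where
  "cohomologous A P =
     {(X, Y). X \<in> poisson_vector_fields A P \<and> Y \<in> poisson_vector_fields A P \<and>
        (\<exists>f. smooth_fun A f \<and> (\<forall>c p. X c p - Y c p = hamiltonian A P f c p))}"

definition H1 ::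
  "('m, 'n::finite) chart set \<Rightarrow> ('m, 'n, real ^ 'n ^ 'n) field
   \<Rightarrow> ('m, 'n, real ^ 'n) field set set" where
  "H1 A P = poisson_vector_fields A P // cohomologous A P"

definition H1_class ::
  "('m, 'n::finite) chart set \<Rightarrow> ('m, 'n, real ^ 'n ^ 'n) field
   \<Rightarrow> ('m, 'n, real ^ 'n) field \<Rightarrow> ('m, 'n, real ^ 'n) field set" where
  "H1_class A P X = cohomologous A P `` {X}"

definition H1_zero ::
  "('m, 'n::finite) chart set \<Rightarrow> ('m, 'n, real ^ 'n ^ 'n) field
   \<Rightarrow> ('m, 'n, real ^ 'n) field set" where
  "H1_zero A P = H1_class A P (\<lambda>c p. 0)"

definition modular_vector_field ::
  "('m, 'n::finite) chart set \<Rightarrow> ('m, 'n, real ^ 'n ^ 'n) field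
   \<Rightarrow> ('m, 'n, real ^ 'n ^ 'n \<Rightarrow> real) field \<Rightarrow> ('m, 'n, real ^ 'n) field" where
  "modular_vector_field A P \<Omega> =
     (THE Z. vector_field A Z \<and>
        (\<forall>f. smooth_fun A f \<longrightarrow> vf_app A Z f = divergence A \<Omega> (hamiltonian A P f)))"

text \<open>The class of the modular vector field of any volume form.\<close>

definition modular_class ::
  "('m, 'n::finite) chart set \<Rightarrow> ('m, 'n, real ^ 'n ^ 'n) field
   \<Rightarrow> ('m, 'n, real ^ 'n) field set" where
  "modular_class A P =
     (THE \<gamma>. \<gamma> \<in> H1 A P \<and>
        (\<exists>\<Omega>. volume_form A \<Omega> \<and> \<gamma> = H1_class A P (modular_vector_field A P \<Omega>)))"

definition gauge_equivalent ::
  "('m, 'n::finite) chart set \<Rightarrow> ('m, 'n, real ^ 'n ^ 'n) field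
   \<Rightarrow> ('m, 'n, real ^ 'n ^ 'n) field \<Rightarrow> bool" where
  "gauge_equivalent A P Q \<longleftrightarrow>
     (\<exists>B. closed_two_form A B \<and>
        (\<forall>c\<in>A. \<forall>p\<in>dom_of c.
           invertible (mat 1 - flat (B c p) ** sharp (P c p)) \<and>
           sharp (Q c p) = sharp (P c p) ** matrix_inv (mat 1 - flat (B c p) ** sharp (P c p))))"

end

(* In a chart with density e^phi, the modular vector field of P has components
   Z_i = sum_j (d_j P_ij + P_ij d_j phi).  It transforms as a vector field because it represents the
   globally defined operator f |-> div (P# df) and because bump functions realise every covector as a
   differential; it is a Poisson field by contracting the derivative of the Jacobi identity.  Replacing
   phi by phi + f subtracts the Hamiltonian field of f, so the modular class vanishes iff some global f
   makes Z vanish for phi + f.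

   Let Q = P N with N = (1 - B P)^(-1), K = (1 - P B)^(-1) and D = 1/2 ln |det (1 - B P)|.  Then
   dQ = K dP N + Q dB Q and dD = - 1/2 tr (dB Q) - 1/2 tr (N B dP).  In the modular field of Q with
   respect to phi + D the terms containing dB cancel since B is closed, and those quadratic in P cancel
   by the Jacobi identity contracted with the antisymmetric matrix N B; what remains is K Z.  Hence
   vanishing passes from P to Q, and conversely since P is obtained from Q by the gauge transformation
   with -B. *)

theory Submission
  imports Defs
begin

section \<open>Calculus of smooth functions\<close>

text \<open>The modular classes of P and Q lie in different cohomology groups, so they are never
  compared with each other; what is transported is a global function for which the modular field
  vanishes. The correction D is dictated by the symplectic case: Hamiltonian fields preserve the
  Liouville density |det P|^(-1/2), and Q^(-1) = P^(-1) - B gives |det Q|^(-1/2) = |det (1 - B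
  P)|^(1/2) |det P|^(-1/2). The extra factor still makes sense where P degenerates, which is the
  general case. Since 1 - B P is the matrix of an endomorphism of the cotangent bundle, its
  determinant is the same in all charts, so D is a global function and phi + D again a logarithmic
  density. Logarithms of absolute values make the change of charts additive and leave no signs to
  follow. Divergence, modular field and modular class are definite descriptions, so each formula for
  them takes an existence and a uniqueness argument; for the modular field, uniqueness again rests
  on functions with prescribed differential at a point.\<close>

abbreviation fderiv :: "('a::real_normed_vector \<Rightarrow> 'b::real_normed_vector) \<Rightarrow> 'a \<Rightarrow> 'a \<Rightarrow> 'b" where
  "fderiv f x \<equiv> frechet_derivative f (at x)"

lemma fderiv_eqI: "(f has_derivative f') (at x) \<Longrightarrow> fderiv f x = f'"
  by (metis frechet_derivative_at)

lemma has_fderiv: "f differentiable (at x) \<Longrightarrow> (f has_derivative fderiv f x) (at x)"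
  by (simp add: frechet_derivative_works)

lemma has_derivative_cong_open:
  assumes "open S" "x \<in> S" "\<And>y. y \<in> S \<Longrightarrow> f y = g y"
  shows "(f has_derivative f') (at x) \<longleftrightarrow> (g has_derivative f') (at x)"
  using assms by (metis has_derivative_transform_within_open)

lemma fderiv_cong_open:
  assumes "open S" "x \<in> S" "\<And>y. y \<in> S \<Longrightarrow> f y = g y"
  shows "fderiv f x = fderiv g x"
  unfolding frechet_derivative_def using has_derivative_cong_open[OF assms] by simp

lemma differentiable_cong_open:
  assumes "open S" "x \<in> S" "\<And>y. y \<in> S \<Longrightarrow> f y = g y" "f differentiable (at x)"
  shows "g differentiable (at x)"
  using assms(4) has_derivative_cong_open[OF assms(1,2), of f g] assms(3) unfolding differentiable_def by blast

section \<open>Closure properties of the classes C^k\<close>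

lemma Ck_on_cong:
  assumes "open S" "\<And>x. x \<in> S \<Longrightarrow> f x = g x" "Ck_on k S f"
  shows "Ck_on k S g"
  using assms(2,3)
proof (induction k arbitrary: f g)
  case 0
  then show ?case using continuous_on_cong[of S S f g] by simp
next
  case (Suc k)
  have "g differentiable (at x)" if "x \<in> S" for x
    using Suc.prems(2) that by (intro differentiable_cong_open[OF assms(1) that, of f g] Suc.prems(1)) auto
  moreover have "Ck_on k S (\<lambda>x. fderiv g x v)" for v
  proof (rule Suc.IH)
    show "fderiv f x v = fderiv g x v" if "x \<in> S" for x
      using fderiv_cong_open[OF assms(1) that, of f g] Suc.prems(1) by simp
    show "Ck_on k S (\<lambda>x. fderiv f x v)" using Suc.prems(2) by simp
  qed
  ultimately show ?case by simp
qed

lemma Ck_on_Suc_D: "Ck_on (Suc k) S f \<Longrightarrow> Ck_on k S f"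
proof (induction k arbitrary: f)
  case 0
  then show ?case
    by (auto intro!: continuous_at_imp_continuous_on simp: differentiable_imp_continuous_within)
next
  case (Suc k)
  then show ?case by (metis Ck_on.simps(2))
qed

lemma Ck_on_subset: "Ck_on k S f \<Longrightarrow> T \<subseteq> S \<Longrightarrow> Ck_on k T f"
proof (induction k arbitrary: f)
  case 0
  then show ?case by (auto intro: continuous_on_subset)
qed auto

text \<open>Continuity and derivatives at a point only see a neighbourhood of it. This allows a
  function extended by zero to be examined separately near its support and away from it.\<close>

lemma Ck_on_local:
  assumes "\<And>x. x \<in> S \<Longrightarrow> \<exists>T. open T \<and> x \<in> T \<and> Ck_on k T f"
  shows "Ck_on k S f"
  using assms
proof (induction k arbitrary: f)
  case 0
  show ?case unfolding Ck_on.simps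
  proof (intro continuous_at_imp_continuous_on ballI)
    fix x assume "x \<in> S"
    then obtain T where "open T" "x \<in> T" "continuous_on T f" using 0 by force
    then show "isCont f x" using continuous_on_eq_continuous_at by blast
  qed
next
  case (Suc k)
  have "f differentiable at x" if "x \<in> S" for x using Suc.prems[OF that] by auto
  moreover have "Ck_on k S (\<lambda>x. fderiv f x v)" for v
    by (rule Suc.IH) (use Suc.prems in force)
  ultimately show ?case by simp
qed

lemma Ck_on_const: "Ck_on k S (\<lambda>x. c)"
proof (induction k arbitrary: c)
  case (Suc k)
  have "fderiv (\<lambda>x::'a. c) x v = 0" for x v
    by (simp add: fderiv_eqI[OF has_derivative_const])
  then show ?case using Suc by simp
qed auto

lemma Ck_on_bounded_linear: "bounded_linear f \<Longrightarrow> Ck_on k S f"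
proof (cases k)
  case 0
  then show "bounded_linear f \<Longrightarrow> ?thesis" by (simp add: linear_continuous_on)
next
  case (Suc m)
  assume "bounded_linear f"
  then have d: "(f has_derivative f) (at x)" for x by (rule bounded_linear_imp_has_derivative)
  then show ?thesis
    using Suc by (simp add: differentiableI[OF d] fderiv_eqI[OF d] Ck_on_const)
qed

lemma Ck_on_compose_bounded_linear:
  assumes "open S" "bounded_linear L"
  shows "Ck_on k S f \<Longrightarrow> Ck_on k S (\<lambda>x. L (f x))"
proof (induction k arbitrary: f)
  case 0
  then show ?case using bounded_linear.continuous_on[OF assms(2), of S f] by simp
next
  case (Suc k)
  have d: "((\<lambda>x. L (f x)) has_derivative (\<lambda>v. L (fderiv f x v))) (at x)" if "x \<in> S" for x
    using Suc.prems that by (intro bounded_linear.has_derivative[OF assms(2)] has_fderiv) auto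
  have "Ck_on k S (\<lambda>x. fderiv (\<lambda>x. L (f x)) x v)" for v
    by (rule Ck_on_cong[OF assms(1) _ Suc.IH[of "\<lambda>x. fderiv f x v"]])
      (use Suc.prems in \<open>simp_all add: fderiv_eqI[OF d]\<close>)
  then show ?case using differentiableI[OF d] by simp
qed

lemma Ck_on_add:
  assumes "open S"
  shows "Ck_on k S f \<Longrightarrow> Ck_on k S g \<Longrightarrow> Ck_on k S (\<lambda>x. f x + g x)"
proof (induction k arbitrary: f g)
  case 0
  then show ?case by (simp add: continuous_on_add)
next
  case (Suc k)
  have d: "((\<lambda>x. f x + g x) has_derivative (\<lambda>v. fderiv f x v + fderiv g x v)) (at x)" if "x \<in> S" for x
    using Suc.prems that by (intro has_derivative_add has_fderiv) auto
  have "Ck_on k S (\<lambda>x. fderiv (\<lambda>x. f x + g x) x v)" for v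
    by (rule Ck_on_cong[OF assms(1) _ Suc.IH[of "\<lambda>x. fderiv f x v" "\<lambda>x. fderiv g x v"]])
      (use Suc.prems in \<open>simp_all add: fderiv_eqI[OF d]\<close>)
  then show ?case using differentiableI[OF d] by simp
qed

text \<open>The product rule yields two terms of the same bilinear shape, so the induction closes.
  One lemma thus serves products of reals, scaling, inner products, and products of matrices with
  matrices and vectors.\<close>

lemma Ck_on_bilinear:
  assumes "open S" "bounded_bilinear b"
  shows "Ck_on k S f \<Longrightarrow> Ck_on k S g \<Longrightarrow> Ck_on k S (\<lambda>x. b (f x) (g x))"
proof (induction k arbitrary: f g)
  case 0
  then show ?case using bounded_bilinear.continuous_on[OF assms(2), of S f g] by simp
next
  case (Suc k)
  have d: "((\<lambda>x. b (f x) (g x)) has_derivative (\<lambda>v. b (f x) (fderiv g x v) + b (fderiv f x v) (g x))) (at x)"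
    if "x \<in> S" for x
    using Suc.prems that by (intro bounded_bilinear.FDERIV[OF assms(2)] has_fderiv) auto
  have "Ck_on k S (\<lambda>x. b (f x) (fderiv g x v) + b (fderiv f x v) (g x))" for v
    by (intro Ck_on_add assms(1) Suc.IH Ck_on_Suc_D[OF Suc.prems(1)] Ck_on_Suc_D[OF Suc.prems(2)])
      (use Suc.prems in simp_all)
  then have "Ck_on k S (\<lambda>x. fderiv (\<lambda>x. b (f x) (g x)) x v)" for v
    by (rule Ck_on_cong[OF assms(1), rotated]) (simp add: fderiv_eqI[OF d])
  then show ?case using differentiableI[OF d] by simp
qed

lemma Ck_on_sum:
  assumes "open S" "\<And>i. i \<in> I \<Longrightarrow> Ck_on k S (f i)"
  shows "Ck_on k S (\<lambda>x. \<Sum>i\<in>I. f i x)"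
proof (cases "finite I")
  case True
  then show ?thesis using assms(2)
    by (induction I rule: finite_induct) (simp_all add: Ck_on_add[OF assms(1)] Ck_on_const)
qed (simp add: Ck_on_const)

text \<open>In the chain rule the direction \<open>fderiv f x v\<close> moves with \<open>x\<close>,
  whereas \<open>Ck_on\<close> controls derivatives in fixed directions only. Expanding that
  direction over \<open>Basis\<close> leaves fixed directions with coefficients of class C^k; this
  is why the middle space is Euclidean.\<close>

lemma Ck_on_compose:
  fixes f :: "'a::real_normed_vector \<Rightarrow> 'b::euclidean_space" and g :: "'b \<Rightarrow> 'c::real_normed_vector"
  assumes S: "open S" "open T" and fST: "f ` S \<subseteq> T"
  shows "Ck_on k S f \<Longrightarrow> Ck_on k T g \<Longrightarrow> Ck_on k S (\<lambda>x. g (f x))"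
proof (induction k arbitrary: g)
  case 0
  show ?case unfolding Ck_on.simps
    by (rule continuous_on_compose2[of T g S f]) (use 0 fST in simp_all)
next
  case (Suc k)
  have df: "f differentiable (at x)" and dg: "g differentiable (at (f x))" if "x \<in> S" for x
    using Suc.prems that fST by auto
  have d: "((\<lambda>x. g (f x)) has_derivative (\<lambda>v. fderiv g (f x) (fderiv f x v))) (at x)" if "x \<in> S" for x
    by (rule has_derivative_compose[OF has_fderiv[OF df[OF that]] has_fderiv[OF dg[OF that]]])
  have expand: "fderiv g (f x) w = (\<Sum>i\<in>Basis. (w \<bullet> i) *\<^sub>R fderiv g (f x) i)" if "x \<in> S" for x w
  proof -
    have l: "linear (fderiv g (f x))" by (rule linear_frechet_derivative[OF dg[OF that]])
    have "fderiv g (f x) w = fderiv g (f x) (\<Sum>i\<in>Basis. (w \<bullet> i) *\<^sub>R i)"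
      by (simp add: euclidean_representation)
    also have "\<dots> = (\<Sum>i\<in>Basis. (w \<bullet> i) *\<^sub>R fderiv g (f x) i)"
      by (simp only: linear_sum[OF l] linear_cmul[OF l])
    finally show ?thesis .
  qed
  have eq: "(\<Sum>i\<in>Basis. (fderiv f x v \<bullet> i) *\<^sub>R fderiv g (f x) i) = fderiv (\<lambda>x. g (f x)) x v"
    if "x \<in> S" for x v
    unfolding fderiv_eqI[OF d[OF that]] by (rule expand[OF that, symmetric])
  have fk: "Ck_on k S f" by (rule Ck_on_Suc_D[OF Suc.prems(1)])
  have comp: "Ck_on k S (\<lambda>x. fderiv g (f x) i)" for i
    by (rule Suc.IH[OF fk]) (use Suc.prems(2) in simp)
  have coef: "Ck_on k S (\<lambda>x. fderiv f x v \<bullet> i)" for v i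
    by (rule Ck_on_compose_bounded_linear[OF S(1) bounded_linear_inner_left]) (use Suc.prems(1) in simp)
  have "Ck_on k S (\<lambda>x. \<Sum>i\<in>Basis. (fderiv f x v \<bullet> i) *\<^sub>R fderiv g (f x) i)" for v
    by (rule Ck_on_sum[OF S(1)], rule Ck_on_bilinear[OF S(1) bounded_bilinear_scaleR coef comp])
  then have "Ck_on k S (\<lambda>x. fderiv (\<lambda>x. g (f x)) x v)" for v
    by (rule Ck_on_cong[OF S(1), rotated]) (rule eq)
  then show ?case using differentiableI[OF d] by simp
qed

section \<open>Calculus rules for smooth functions\<close>

lemma smooth_on_cong: "open S \<Longrightarrow> (\<And>x. x \<in> S \<Longrightarrow> f x = g x) \<Longrightarrow> smooth_on S f \<Longrightarrow> smooth_on S g"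
  unfolding smooth_on_def using Ck_on_cong by blast

lemma smooth_on_local:
  assumes "\<And>x. x \<in> S \<Longrightarrow> \<exists>T. open T \<and> x \<in> T \<and> smooth_on T f"
  shows "smooth_on S f"
  unfolding smooth_on_def by (intro allI Ck_on_local) (use assms smooth_on_def in blast)

lemma smooth_on_differentiable: "smooth_on S f \<Longrightarrow> x \<in> S \<Longrightarrow> f differentiable (at x)"
  unfolding smooth_on_def using Ck_on.simps(2) by blast

lemma smooth_on_has_fderiv: "smooth_on S f \<Longrightarrow> x \<in> S \<Longrightarrow> (f has_derivative fderiv f x) (at x)"
  using smooth_on_differentiable has_fderiv by blast

lemma smooth_on_fderiv: "smooth_on S f \<Longrightarrow> smooth_on S (\<lambda>x. fderiv f x v)"
  unfolding smooth_on_def using Ck_on.simps(2) by blast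

lemma smooth_on_const [simp]: "smooth_on S (\<lambda>x. c)"
  by (simp add: smooth_on_def Ck_on_const)

lemma smooth_on_bounded_linear: "bounded_linear f \<Longrightarrow> smooth_on S f"
  by (simp add: smooth_on_def Ck_on_bounded_linear)

lemma smooth_on_compose_bounded_linear:
  "open S \<Longrightarrow> bounded_linear L \<Longrightarrow> smooth_on S f \<Longrightarrow> smooth_on S (\<lambda>x. L (f x))"
  by (simp add: smooth_on_def Ck_on_compose_bounded_linear)

lemma smooth_on_add: "open S \<Longrightarrow> smooth_on S f \<Longrightarrow> smooth_on S g \<Longrightarrow> smooth_on S (\<lambda>x. f x + g x)"
  by (simp add: smooth_on_def Ck_on_add)

lemma smooth_on_bilinear:
  "open S \<Longrightarrow> bounded_bilinear b \<Longrightarrow> smooth_on S f \<Longrightarrow> smooth_on S g \<Longrightarrow> smooth_on S (\<lambda>x. b (f x) (g x))"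
  by (simp add: smooth_on_def Ck_on_bilinear)

lemma smooth_on_mult:
  fixes f g :: "'a::real_normed_vector \<Rightarrow> real"
  shows "open S \<Longrightarrow> smooth_on S f \<Longrightarrow> smooth_on S g \<Longrightarrow> smooth_on S (\<lambda>x. f x * g x)"
  by (rule smooth_on_bilinear[OF _ bounded_bilinear_mult])

lemma smooth_on_cmult:
  fixes f :: "'a::real_normed_vector \<Rightarrow> real"
  shows "open S \<Longrightarrow> smooth_on S f \<Longrightarrow> smooth_on S (\<lambda>x. c * f x)"
  by (rule smooth_on_mult) auto

lemma smooth_on_minus: "open S \<Longrightarrow> smooth_on S f \<Longrightarrow> smooth_on S (\<lambda>x. - f x)"
  by (rule smooth_on_compose_bounded_linear[OF _ bounded_linear_minus[OF bounded_linear_ident]])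

lemma smooth_on_diff: "open S \<Longrightarrow> smooth_on S f \<Longrightarrow> smooth_on S g \<Longrightarrow> smooth_on S (\<lambda>x. f x - g x)"
  using smooth_on_add[of S f "\<lambda>x. - g x"] smooth_on_minus[of S g] by simp

lemma smooth_on_sum:
  "open S \<Longrightarrow> (\<And>i. i \<in> I \<Longrightarrow> smooth_on S (f i)) \<Longrightarrow> smooth_on S (\<lambda>x. \<Sum>i\<in>I. f i x)"
  by (simp add: smooth_on_def Ck_on_sum)

lemma smooth_on_prod:
  fixes f :: "'i \<Rightarrow> 'a::real_normed_vector \<Rightarrow> real"
  assumes "open S" "\<And>i. i \<in> I \<Longrightarrow> smooth_on S (f i)"
  shows "smooth_on S (\<lambda>x. \<Prod>i\<in>I. f i x)"
proof (cases "finite I")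
  case True
  then show ?thesis using assms(2)
  proof (induction I rule: finite_induct)
    case (insert i I)
    have "smooth_on S (\<lambda>x. f i x * (\<Prod>i\<in>I. f i x))"
      by (rule smooth_on_mult[OF assms(1)]) (use insert in simp_all)
    then show ?case using insert.hyps by simp
  qed simp
qed simp

lemma smooth_on_compose:
  fixes f :: "'a::real_normed_vector \<Rightarrow> 'b::euclidean_space" and g :: "'b \<Rightarrow> 'c::real_normed_vector"
  assumes "open S" "open T" "f ` S \<subseteq> T" "smooth_on S f" "smooth_on T g"
  shows "smooth_on S (\<lambda>x. g (f x))"
  unfolding smooth_on_def
proof
  show "Ck_on k S (\<lambda>x. g (f x))" for k
    by (rule Ck_on_compose[OF assms(1-3)]) (use assms(4,5) in \<open>simp_all add: smooth_on_def\<close>)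
qed

lemma smooth_on_nth: "open S \<Longrightarrow> smooth_on S f \<Longrightarrow> smooth_on S (\<lambda>x. f x $ i)"
  by (rule smooth_on_compose_bounded_linear[OF _ bounded_linear_vec_nth])

lemma smooth_on_vecI:
  fixes f :: "'a::real_normed_vector \<Rightarrow> 'b::euclidean_space ^ 'n::finite"
  assumes "open S" "\<And>i. smooth_on S (\<lambda>x. f x $ i)"
  shows "smooth_on S f"
proof -
  have bl: "bounded_linear (axis i :: 'b \<Rightarrow> 'b ^ 'n)" for i
    unfolding linear_conv_bounded_linear[symmetric] by (rule linearI) (auto simp: vec_eq_iff axis_def)
  have "smooth_on S (\<lambda>x. \<Sum>i\<in>UNIV. axis i (f x $ i))"
    by (intro smooth_on_sum assms(1) smooth_on_compose_bounded_linear[OF _ bl] assms(2))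
  moreover have "(\<Sum>i\<in>UNIV. axis i (f x $ i)) = f x" for x
    by (simp add: vec_eq_iff axis_def sum.delta)
  ultimately show ?thesis by simp
qed

lemma smooth_on_det:
  fixes M :: "'a::real_normed_vector \<Rightarrow> real ^ 'n ^ 'n::finite"
  assumes "open S" "smooth_on S M"
  shows "smooth_on S (\<lambda>x. det (M x))"
  unfolding det_def
  by (intro smooth_on_sum assms(1) smooth_on_cmult smooth_on_prod smooth_on_nth assms)

section \<open>Inverse and logarithm\<close>

lemma Ck_on_inverse: "Ck_on k (-{0}) (inverse :: real \<Rightarrow> real)"
proof (induction k)
  case 0
  then show ?case by (auto intro: continuous_intros)
next
  case (Suc k)
  have o: "open (-{0::real})" by auto
  have d: "(inverse has_derivative (\<lambda>v. - (v * (inverse x * inverse x)))) (at x)" if "x \<in> -{0::real}" for x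
    using that by (auto intro!: derivative_eq_intros simp: mult.commute)
  \<comment> \<open>The derivative is a polynomial in \<open>inverse\<close> itself, so the
    induction hypothesis applies to it.\<close>
  have "Ck_on k (-{0}) (\<lambda>x::real. (- v) * (inverse x * inverse x))" for v
    by (intro Ck_on_bilinear[OF o bounded_bilinear_mult] Suc Ck_on_const)
  then have "Ck_on k (-{0}) (\<lambda>x. fderiv inverse x v)" for v :: real
    by (rule Ck_on_cong[OF o, rotated]) (simp add: fderiv_eqI[OF d])
  then show ?case using differentiableI[OF d] by simp
qed

lemma has_derivative_ln_abs:
  "x \<noteq> 0 \<Longrightarrow> ((\<lambda>x. ln \<bar>x\<bar>) has_derivative (\<lambda>v. v * inverse x)) (at (x::real))"
proof -
  assume x: "x \<noteq> 0"
  \<comment> \<open>Writing the absolute value with \<open>sgn\<close>, which is constant on each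
    half line, reduces both cases to the logarithm of a linear function.\<close>
  have "((\<lambda>x. ln (sgn x * x)) has_derivative (\<lambda>v. v * inverse x)) (at x)"
  proof (cases "x > 0")
    case True
    have "(ln has_derivative (\<lambda>v. v * inverse x)) (at x)"
      using True by (auto intro!: derivative_eq_intros simp: field_simps)
    then show ?thesis
      by (rule has_derivative_transform_within_open[of _ _ _ _ "{0<..}"]) (use True in auto)
  next
    case False
    have "((\<lambda>x. ln (- x)) has_derivative (\<lambda>v. v * inverse x)) (at x)"
      using False x by (auto intro!: derivative_eq_intros simp: field_simps)
    then show ?thesis
      by (rule has_derivative_transform_within_open[of _ _ _ _ "{..<0}"]) (use False x in auto)
  qed
  then show ?thesis by (simp add: abs_sgn mult.commute)
qed

lemma smooth_on_ln_abs:
  fixes f :: "'a::real_normed_vector \<Rightarrow> real"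
  assumes S: "open S" and f: "smooth_on S f" "\<And>x. x \<in> S \<Longrightarrow> f x \<noteq> 0"
  shows "smooth_on S (\<lambda>x. ln \<bar>f x\<bar>)"
proof -
  have o: "open (-{0::real})" by auto
  have "Ck_on k (-{0}) (\<lambda>x::real. ln \<bar>x\<bar>)" for k
  proof (cases k)
    case 0
    then show ?thesis by (auto intro!: continuous_intros)
  next
    case (Suc m)
    \<comment> \<open>No induction: the first derivative is a multiple of \<open>inverse\<close>,
      whose smoothness is known.\<close>
    have "Ck_on m (-{0}) (\<lambda>x::real. v * inverse x)" for v
      by (intro Ck_on_bilinear[OF o bounded_bilinear_mult] Ck_on_inverse Ck_on_const)
    then have "Ck_on m (-{0}) (\<lambda>x. fderiv (\<lambda>x. ln \<bar>x\<bar>) x v)" for v :: real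
      by (rule Ck_on_cong[OF o, rotated]) (simp add: fderiv_eqI[OF has_derivative_ln_abs])
    then show ?thesis using Suc differentiableI[OF has_derivative_ln_abs] by simp
  qed
  then have "smooth_on (-{0}) (\<lambda>x::real. ln \<bar>x\<bar>)" by (simp add: smooth_on_def)
  then show ?thesis by (intro smooth_on_compose[OF S o _ f(1)]) (use f(2) in auto)
qed

subsection \<open>Bump functions\<close>

text \<open>The index makes the family closed under differentiation: the derivative of member
  \<open>n\<close> is a combination of members \<open>n + 1\<close> and \<open>n + 2\<close>. Member
  \<open>0\<close> is the classical smooth function that is flat at the origin.\<close>

definition flat_exp :: "nat \<Rightarrow> real \<Rightarrow> real" where
  "flat_exp n t = (if t > 0 then inverse t ^ n * exp (- inverse t) else 0)"

text \<open>On the right the substitution of 1/t for t turns this into the limit of x^n / exp x at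
  infinity; on the left the function is zero.\<close>

lemma tendsto_flat_exp: "(flat_exp n \<longlongrightarrow> 0) (at 0)"
proof -
  have "((\<lambda>x::real. x ^ n / exp x) \<longlongrightarrow> 0) at_top" by (rule tendsto_power_div_exp_0)
  then have "((\<lambda>t::real. inverse t ^ n / exp (inverse t)) \<longlongrightarrow> 0) (at_right 0)"
    by (rule filterlim_compose) (rule filterlim_inverse_at_top_right)
  then have "(flat_exp n \<longlongrightarrow> 0) (at_right 0)"
    by (rule Lim_transform_eventually)
      (auto simp: flat_exp_def exp_minus field_simps eventually_at_right_less
        intro!: eventually_at_right_less[THEN eventually_mono])
  moreover have "(flat_exp n \<longlongrightarrow> 0) (at_left 0)"
    by (rule Lim_transform_eventually[OF tendsto_const])
      (auto simp: flat_exp_def eventually_at_filter)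
  ultimately show ?thesis by (simp add: filterlim_at_split)
qed

lemma has_derivative_flat_exp:
  "(flat_exp n has_derivative (\<lambda>v. v * (flat_exp (n + 2) t - n * flat_exp (n + 1) t))) (at t)"
proof -
  consider "t > 0" | "t < 0" | "t = 0" by linarith
  then show ?thesis
  proof cases
    case 1
    have "((\<lambda>t. inverse t ^ n * exp (- inverse t)) has_derivative
       (\<lambda>v. v * (flat_exp (n + 2) t - n * flat_exp (n + 1) t))) (at t)"
    proof -
      have i: "(inverse has_derivative (\<lambda>v. - (inverse t * v * inverse t))) (at t)"
        using 1 by (intro has_derivative_inverse') simp
      have e: "((\<lambda>t. exp (- inverse t)) has_derivative
          (\<lambda>v. exp (- inverse t) * - (- (inverse t * v * inverse t)))) (at t)"
        by (rule has_derivative_eq_rhs[OF has_derivative_exp[OF has_derivative_minus[OF i]]])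
          (simp add: fun_eq_iff)
      show ?thesis
        using has_derivative_mult[OF has_derivative_power[OF i, of n] e]
      proof (rule has_derivative_eq_rhs)
        show "(\<lambda>v. inverse t ^ n * (exp (- inverse t) * - (- (inverse t * v * inverse t)))
            + of_nat n * - (inverse t * v * inverse t) * inverse t ^ (n - 1) * exp (- inverse t))
          = (\<lambda>v. v * (flat_exp (n + 2) t - real n * flat_exp (n + 1) t))"
          using 1 by (cases n) (simp_all add: flat_exp_def fun_eq_iff algebra_simps)
      qed
    qed
    then show ?thesis
      by (rule has_derivative_transform_within_open[of _ _ _ _ "{0<..}"]) (use 1 in \<open>auto simp: flat_exp_def\<close>)
  next
    case 2
    have "((\<lambda>t. 0) has_derivative
       (\<lambda>v. v * (flat_exp (n + 2) t - n * flat_exp (n + 1) t))) (at t)"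
      using 2 by (auto intro!: derivative_eq_intros simp: flat_exp_def)
    then show ?thesis
      by (rule has_derivative_transform_within_open[of _ _ _ _ "{..<0}"]) (use 2 in \<open>auto simp: flat_exp_def\<close>)
  next
    case 3
    \<comment> \<open>The difference quotient of member \<open>n\<close> at the origin is member
      \<open>Suc n\<close>, which tends to \<open>0\<close>.\<close>
    have "(flat_exp n has_field_derivative 0) (at 0)"
      unfolding has_field_derivative_iff
      by (rule Lim_transform_eventually[OF tendsto_flat_exp[of "Suc n"]])
        (auto simp: flat_exp_def eventually_at_filter field_simps)
    then show ?thesis using 3 by (simp add: has_field_derivative_def flat_exp_def lambda_zero)
  qed
qed

lemma smooth_flat_exp: "smooth_on S (flat_exp n)"
proof -
  have "Ck_on k UNIV (flat_exp n)" for k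
  proof (induction k arbitrary: n)
    case 0
    then show ?case using has_derivative_flat_exp
      by (auto intro!: continuous_at_imp_continuous_on has_derivative_continuous)
  next
    case (Suc k)
    have "Ck_on k UNIV (\<lambda>t. v * (flat_exp (n + 2) t + - real n * flat_exp (n + 1) t))" for v
      by (intro Ck_on_bilinear[OF _ bounded_bilinear_mult] Ck_on_add Suc Ck_on_const) auto
    then show ?case using differentiableI[OF has_derivative_flat_exp]
      by (simp add: fderiv_eqI[OF has_derivative_flat_exp])
  qed
  then show ?thesis unfolding smooth_on_def using Ck_on_subset by blast
qed

text \<open>A linear function times a radial cutoff. Since the linear factor vanishes at
  \<open>y\<close>, only the value of the cutoff at \<open>y\<close> enters the derivative there,
  and dividing by that value normalises it; the cutoff may therefore vary near
  \<open>y\<close>.\<close>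

lemma bump_with_derivative:
  fixes y :: "'a::euclidean_space"
  assumes "r > 0"
  obtains h :: "'a \<Rightarrow> real" where "smooth_on UNIV h" "\<And>x. x \<notin> ball y r \<Longrightarrow> h x = 0"
    "(h has_derivative (\<lambda>v. u \<bullet> v)) (at y)"
proof -
  define q where "q x = (r\<^sup>2 - (x - y) \<bullet> (x - y)) " for x
  define h where "h x = inverse (flat_exp 0 (r\<^sup>2)) * (flat_exp 0 (q x) * (u \<bullet> (x - y)))" for x
  have ne: "flat_exp 0 (r\<^sup>2) \<noteq> 0" using assms by (simp add: flat_exp_def)
  have id: "smooth_on UNIV (\<lambda>x::'a. x - y)"
    by (intro smooth_on_diff smooth_on_const smooth_on_bounded_linear bounded_linear_ident) auto
  have q: "smooth_on UNIV q" unfolding q_def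
    by (intro smooth_on_diff smooth_on_const smooth_on_bilinear[OF _ bounded_bilinear_inner] id) auto
  have "smooth_on UNIV h" unfolding h_def
    by (intro smooth_on_mult smooth_on_compose[OF _ open_UNIV _ q] smooth_flat_exp smooth_on_const
        smooth_on_bilinear[OF _ bounded_bilinear_inner] id) auto
  moreover have "h x = 0" if "x \<notin> ball y r" for x
  proof -
    have "r \<le> norm (x - y)" using that by (simp add: dist_norm norm_minus_commute)
    then have "q x \<le> 0" using assms power_mono[of r "norm (x - y)" 2]
      by (simp add: q_def flip: power2_norm_eq_inner)
    then show ?thesis by (simp add: h_def flat_exp_def)
  qed
  moreover have "(h has_derivative (\<lambda>v. u \<bullet> v)) (at y)"
  proof -
    have "((\<lambda>x. flat_exp 0 (q x)) has_derivative fderiv (\<lambda>x. flat_exp 0 (q x)) y) (at y)"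
      by (intro smooth_on_has_fderiv[of UNIV] smooth_on_compose[OF _ open_UNIV _ q] smooth_flat_exp) auto
    note has_derivative_mult[OF this has_derivative_inner_right[OF has_derivative_diff[OF has_derivative_ident has_derivative_const]],
        of u y]
    from has_derivative_mult_right[OF this, of "inverse (flat_exp 0 (r\<^sup>2))"]
    have "(h has_derivative (\<lambda>v. inverse (flat_exp 0 (r\<^sup>2)) * (flat_exp 0 (q y) * (u \<bullet> v)))) (at y)"
      unfolding h_def by simp
    then show ?thesis using ne by (simp add: q_def flip: mult.assoc)
  qed
  ultimately show ?thesis using that by blast
qed

subsection \<open>Symmetry of second derivatives\<close>

text \<open>The mean value theorem is applied along \<open>u\<close> and then along
  \<open>v\<close>. The second difference on the left is symmetric in \<open>u\<close> and
  \<open>v\<close>, so exchanging them expresses the same number by the other mixed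
  derivative.\<close>

lemma mvt_second_difference:
  fixes f :: "'a::euclidean_space \<Rightarrow> real"
  assumes f: "smooth_on S f" and "h > 0"
    and S: "\<And>s t. 0 \<le> s \<Longrightarrow> s \<le> h \<Longrightarrow> 0 \<le> t \<Longrightarrow> t \<le> h \<Longrightarrow> x + s *\<^sub>R u + t *\<^sub>R v \<in> S"
  shows "\<exists>s t. 0 < s \<and> s < h \<and> 0 < t \<and> t < h \<and>
    f (x + h *\<^sub>R u + h *\<^sub>R v) - f (x + h *\<^sub>R u) - f (x + h *\<^sub>R v) + f x
     = h * h * fderiv (\<lambda>y. fderiv f y u) (x + s *\<^sub>R u + t *\<^sub>R v) v"
proof -
  have lin: "fderiv g y (a *\<^sub>R w) = a * fderiv g y w" if "smooth_on S g" "y \<in> S" for g y w and a :: real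
    using linear_cmul[OF linear_frechet_derivative[OF smooth_on_differentiable[OF that]]] by simp
  define G where "G s = f (x + s *\<^sub>R u + h *\<^sub>R v) - f (x + s *\<^sub>R u)" for s
  have dG: "(G has_derivative (\<lambda>a. a * (fderiv f (x + s *\<^sub>R u + h *\<^sub>R v) u - fderiv f (x + s *\<^sub>R u) u))) (at s)"
    if "0 \<le> s" "s \<le> h" for s
  proof -
    have a: "((\<lambda>s. x + s *\<^sub>R u + h *\<^sub>R v) has_derivative (\<lambda>a. a *\<^sub>R u)) (at s)"
      by (auto intro!: derivative_eq_intros)
    have b: "((\<lambda>s. x + s *\<^sub>R u) has_derivative (\<lambda>a. a *\<^sub>R u)) (at s)"
      by (auto intro!: derivative_eq_intros)
    have m: "x + s *\<^sub>R u + h *\<^sub>R v \<in> S" "x + s *\<^sub>R u \<in> S" using S[of s h] S[of s 0] that \<open>h > 0\<close> by auto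
    show ?thesis unfolding G_def
      using has_derivative_diff[OF has_derivative_compose[OF a smooth_on_has_fderiv[OF f m(1)]]
          has_derivative_compose[OF b smooth_on_has_fderiv[OF f m(2)]]]
      by (simp add: lin[OF f] m right_diff_distrib)
  qed
  have "\<exists>s\<in>{0<..<h}. G h - G 0 = (h - 0) * (fderiv f (x + s *\<^sub>R u + h *\<^sub>R v) u - fderiv f (x + s *\<^sub>R u) u)"
    by (rule mvt_simple[OF \<open>h > 0\<close> has_derivative_at_withinI[OF dG]])
  then obtain s where s: "0 < s" "s < h"
      "G h - G 0 = h * (fderiv f (x + s *\<^sub>R u + h *\<^sub>R v) u - fderiv f (x + s *\<^sub>R u) u)"
    by auto
  define f' where "f' = (\<lambda>y. fderiv f y u)"
  have f': "smooth_on S f'" unfolding f'_def by (rule smooth_on_fderiv[OF f])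
  have d: "((\<lambda>t. f' (x + s *\<^sub>R u + t *\<^sub>R v)) has_derivative (\<lambda>a. a * fderiv f' (x + s *\<^sub>R u + t *\<^sub>R v) v)) (at t)"
    if "0 \<le> t" "t \<le> h" for t
  proof -
    have a: "((\<lambda>t. x + s *\<^sub>R u + t *\<^sub>R v) has_derivative (\<lambda>a. a *\<^sub>R v)) (at t)"
      by (auto intro!: derivative_eq_intros)
    have m: "x + s *\<^sub>R u + t *\<^sub>R v \<in> S" using S[of s t] that s by auto
    show ?thesis
      using has_derivative_compose[OF a smooth_on_has_fderiv[OF f' m]] by (simp add: lin[OF f'] m)
  qed
  have "\<exists>t\<in>{0<..<h}. f' (x + s *\<^sub>R u + h *\<^sub>R v) - f' (x + s *\<^sub>R u + 0 *\<^sub>R v)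
      = (h - 0) * fderiv f' (x + s *\<^sub>R u + t *\<^sub>R v) v"
    by (rule mvt_simple[OF \<open>h > 0\<close> has_derivative_at_withinI[OF d]])
  then obtain t where t: "0 < t" "t < h"
     "f' (x + s *\<^sub>R u + h *\<^sub>R v) - f' (x + s *\<^sub>R u + 0 *\<^sub>R v) = h * fderiv f' (x + s *\<^sub>R u + t *\<^sub>R v) v"
    by auto
  have "G h - G 0 = h * (f' (x + s *\<^sub>R u + h *\<^sub>R v) - f' (x + s *\<^sub>R u))" using s(3) by (simp add: f'_def)
  also have "\<dots> = h * (h * fderiv f' (x + s *\<^sub>R u + t *\<^sub>R v) v)" using t(3) by simp
  finally have "f (x + h *\<^sub>R u + h *\<^sub>R v) - f (x + h *\<^sub>R u) - f (x + h *\<^sub>R v) + f x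
     = h * h * fderiv f' (x + s *\<^sub>R u + t *\<^sub>R v) v" by (simp add: G_def mult.assoc)
  then show ?thesis using s(1,2) t(1,2) unfolding f'_def by blast
qed

text \<open>On every small parallelogram at \<open>x\<close> the two mixed derivatives take a common
  value, though at different points. Both are continuous at \<open>x\<close>, which excludes a gap
  between their values there.\<close>

lemma second_derivative_symmetric_real:
  fixes f :: "'a::euclidean_space \<Rightarrow> real"
  assumes S: "open S" "x \<in> S" and f: "smooth_on S f"
  shows "fderiv (\<lambda>y. fderiv f y u) x v = fderiv (\<lambda>y. fderiv f y v) x u"
proof (rule ccontr)
  define a where "a u v y = fderiv (\<lambda>y. fderiv f y u) y v" for u v y
  assume ne: "\<not> ?thesis"
  define e where "e = \<bar>a u v x - a v u x\<bar> / 2"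
  have e: "e > 0" using ne by (simp add: e_def a_def)
  have c: "isCont (a u v) x" for u v
    unfolding a_def using smooth_on_differentiable[OF smooth_on_fderiv[OF smooth_on_fderiv[OF f]] S(2)]
    by (rule differentiable_imp_continuous_within)
  obtain r1 where r1: "r1 > 0" "\<And>y. dist y x < r1 \<Longrightarrow> dist (a u v y) (a u v x) < e"
    using c[of u v] e unfolding continuous_at_eps_delta by blast
  obtain r2 where r2: "r2 > 0" "\<And>y. dist y x < r2 \<Longrightarrow> dist (a v u y) (a v u x) < e"
    using c[of v u] e unfolding continuous_at_eps_delta by blast
  obtain r3 where r3: "r3 > 0" "\<And>y. dist y x < r3 \<Longrightarrow> y \<in> S"
    using S unfolding open_dist by blast
  define r where "r = min r1 (min r2 r3)"
  \<comment> \<open>The summand \<open>1\<close> keeps \<open>N\<close> positive when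
    \<open>u\<close> and \<open>v\<close> both vanish. With side length \<open>h\<close> the
    parallelogram stays within \<open>r / 2\<close> of \<open>x\<close>.\<close>
  define N where "N = norm u + norm v + 1"
  define h where "h = r / (2 * N)"
  have r: "r > 0" using r1 r2 r3 by (simp add: r_def)
  have n: "N > 0" by (simp add: N_def add_nonneg_pos)
  have h: "h > 0" using r n by (simp add: h_def)
  have close: "dist (x + s *\<^sub>R u + t *\<^sub>R v) x < r" if "0 \<le> s" "s \<le> h" "0 \<le> t" "t \<le> h" for s t
  proof -
    have "dist (x + s *\<^sub>R u + t *\<^sub>R v) x = norm (s *\<^sub>R u + t *\<^sub>R v)" by (simp add: dist_norm add.assoc)
    also have "\<dots> \<le> s * norm u + t * norm v" using norm_triangle_ineq[of "s *\<^sub>R u" "t *\<^sub>R v"] that by simp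
    also have "\<dots> \<le> h * norm u + h * norm v" using that by (intro add_mono mult_right_mono) auto
    also have "\<dots> \<le> h * N" using h by (simp add: N_def algebra_simps)
    also have "\<dots> = r / 2" using n by (simp add: h_def)
    finally show ?thesis using r by simp
  qed
  have inS: "x + s *\<^sub>R u + t *\<^sub>R v \<in> S" "x + s *\<^sub>R v + t *\<^sub>R u \<in> S"
    if "0 \<le> s" "s \<le> h" "0 \<le> t" "t \<le> h" for s t
    using close[OF that] close[of t s] that r3(2) by (auto simp: r_def algebra_simps)
  obtain s t where 1: "0 < s" "s < h" "0 < t" "t < h"
    "f (x + h *\<^sub>R u + h *\<^sub>R v) - f (x + h *\<^sub>R u) - f (x + h *\<^sub>R v) + f x
     = h * h * a u v (x + s *\<^sub>R u + t *\<^sub>R v)"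
    using mvt_second_difference[OF f h, of x u v] inS(1) unfolding a_def by blast
  obtain s' t' where 2: "0 < s'" "s' < h" "0 < t'" "t' < h"
    "f (x + h *\<^sub>R v + h *\<^sub>R u) - f (x + h *\<^sub>R v) - f (x + h *\<^sub>R u) + f x
     = h * h * a v u (x + s' *\<^sub>R v + t' *\<^sub>R u)"
    using mvt_second_difference[OF f h, of x v u] inS(2) unfolding a_def by blast
  have "h * h * a u v (x + s *\<^sub>R u + t *\<^sub>R v) = h * h * a v u (x + s' *\<^sub>R v + t' *\<^sub>R u)"
    using 1(5) 2(5) by (simp add: algebra_simps)
  then have "a u v (x + s *\<^sub>R u + t *\<^sub>R v) = a v u (x + s' *\<^sub>R v + t' *\<^sub>R u)" using h by simp
  moreover have "dist (a u v (x + s *\<^sub>R u + t *\<^sub>R v)) (a u v x) < e"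
    using close[of s t] 1 by (intro r1(2)) (auto simp: r_def)
  moreover have "dist (a v u (x + s' *\<^sub>R v + t' *\<^sub>R u)) (a v u x) < e"
    using close[of t' s'] 2 by (intro r2(2)) (auto simp: r_def algebra_simps)
  moreover have "2 * e \<le> \<bar>p - a u v x\<bar> + \<bar>p - a v u x\<bar>" for p unfolding e_def by simp
  ultimately show False unfolding dist_real_def by (metis add_strict_mono mult_2 not_less)
qed

lemma fderiv_nth:
  assumes "f differentiable (at x)"
  shows "fderiv (\<lambda>y. f y $ i) x v = fderiv f x v $ i"
  using fderiv_eqI[OF bounded_linear.has_derivative[OF bounded_linear_vec_nth has_fderiv[OF assms]]] by simp

lemma second_derivative_symmetric:
  fixes f :: "'a::euclidean_space \<Rightarrow> real ^ 'n::finite"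
  assumes S: "open S" "x \<in> S" and f: "smooth_on S f"
  shows "fderiv (\<lambda>y. fderiv f y u) x v = fderiv (\<lambda>y. fderiv f y v) x u"
proof -
  have "fderiv (\<lambda>y. fderiv f y u) x v $ i = fderiv (\<lambda>y. fderiv (\<lambda>y. f y $ i) y u) x v" for u v i
  proof -
    have "fderiv (\<lambda>y. fderiv f y u) x v $ i = fderiv (\<lambda>y. fderiv f y u $ i) x v"
      by (rule fderiv_nth[symmetric]) (rule smooth_on_differentiable[OF smooth_on_fderiv[OF f] S(2)])
    also have "\<dots> = fderiv (\<lambda>y. fderiv (\<lambda>y. f y $ i) y u) x v"
      by (rule arg_cong[where f="\<lambda>g. g v"], rule fderiv_cong_open[OF S])
        (simp add: fderiv_nth smooth_on_differentiable[OF f])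
    finally show ?thesis .
  qed
  then show ?thesis
    using second_derivative_symmetric_real[OF S smooth_on_nth[OF S(1) f]] by (simp add: vec_eq_iff)
qed

section \<open>Matrices, determinants and alternating forms\<close>

lemma matrix_add_rdistrib: "(A + B) ** C = A ** C + B ** (C :: real ^ 'n ^ 'k::finite)"
  by (simp add: vec_eq_iff matrix_matrix_mult_def distrib_right sum.distrib)

lemma matrix_minus_left: "(- A) ** B = - (A ** (B :: real ^ 'n ^ 'k::finite))"
  by (simp add: vec_eq_iff matrix_matrix_mult_def sum_negf)

lemma matrix_minus_right: "A ** (- B) = - (A ** (B :: real ^ 'n ^ 'k::finite))"
  by (simp add: vec_eq_iff matrix_matrix_mult_def sum_negf)

lemma matrix_sub_ldistrib: "A ** (B - C) = A ** B - A ** (C :: real ^ 'n ^ 'k::finite)"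
  by (simp add: vec_eq_iff matrix_matrix_mult_def right_diff_distrib sum_subtractf)

lemma matrix_sub_rdistrib: "(A - B) ** C = A ** C - B ** (C :: real ^ 'n ^ 'k::finite)"
  by (simp add: vec_eq_iff matrix_matrix_mult_def left_diff_distrib sum_subtractf)

lemma bounded_bilinear_matrix_mult:
  "bounded_bilinear ((**) :: real ^ 'n::finite ^ 'n \<Rightarrow> real ^ 'n ^ 'n \<Rightarrow> real ^ 'n ^ 'n)"
  unfolding bilinear_conv_bounded_bilinear[symmetric] bilinear_def linear_iff
  by (simp add: matrix_add_ldistrib matrix_add_rdistrib)
    (simp add: vec_eq_iff matrix_matrix_mult_def sum_distrib_left mult_ac)

lemma bounded_bilinear_matrix_vector_mult:
  "bounded_bilinear ((*v) :: real ^ 'n::finite ^ 'n \<Rightarrow> real ^ 'n \<Rightarrow> real ^ 'n)"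
  unfolding bilinear_conv_bounded_bilinear[symmetric] bilinear_def linear_iff
  by (simp add: matrix_vector_right_distrib matrix_vector_mult_add_rdistrib)
    (simp add: vec_eq_iff matrix_vector_mult_def sum_distrib_left mult_ac)

lemma bounded_linear_transpose:
  "bounded_linear (transpose :: real ^ 'n::finite ^ 'n \<Rightarrow> real ^ 'n ^ 'n)"
  unfolding linear_conv_bounded_linear[symmetric] linear_iff
  by (simp add: vec_eq_iff Finite_Cartesian_Product.transpose_def)

section \<open>Alternating forms of top degree\<close>

lemma alternating_swap:
  assumes "alternating_multilinear w" "a \<noteq> b"
  shows "w (\<chi> j. V $ Transposition.transpose a b j) = - w V"
proof -
  define W where "W u v = w (\<chi> j. if j = a then u else if j = b then v else V $ j)" for u v
  have "linear (\<lambda>u. w (\<chi> j. if j = a then u else (\<chi> j. if j = a then 0 else if j = b then v else V $ j) $ j))" for v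
    using assms(1) unfolding alternating_multilinear_def by blast
  moreover have "(\<lambda>u. w (\<chi> j. if j = a then u else (\<chi> j. if j = a then 0 else if j = b then v else V $ j) $ j))
     = (\<lambda>u. W u v)" for v
    unfolding W_def by (intro ext arg_cong[where f=w]) (simp add: vec_eq_iff)
  ultimately have l1: "linear (\<lambda>u. W u v)" for v by simp
  have "linear (\<lambda>v. w (\<chi> j. if j = b then v else (\<chi> j. if j = a then u else V $ j) $ j))" for u
    using assms(1) unfolding alternating_multilinear_def by blast
  moreover have "(\<lambda>v. w (\<chi> j. if j = b then v else (\<chi> j. if j = a then u else V $ j) $ j)) = W u" for u
    unfolding W_def by (intro ext arg_cong[where f=w]) (use assms(2) in \<open>simp add: vec_eq_iff\<close>)
  ultimately have l2: "linear (W u)" for u by simp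
  have z: "W u u = 0" for u
  proof -
    have alt: "i \<noteq> j \<Longrightarrow> V $ i = V $ j \<Longrightarrow> w V = 0" for V i j
      using assms(1) unfolding alternating_multilinear_def by blast
    show ?thesis unfolding W_def by (rule alt[OF assms(2)]) simp
  qed
  \<comment> \<open>Polarisation: the diagonal values of \<open>W\<close> are zero, so the two mixed
    terms are opposite.\<close>
  have ex: "W (u + v) (u + v) = W u u + W u v + (W v u + W v v)" for u v
    by (simp add: linear_add[OF l1] linear_add[OF l2])
  have "W (V $ b) (V $ a) = - W (V $ a) (V $ b)"
    using ex[of "V $ a" "V $ b"] unfolding z by linarith
  moreover have "w V = W (V $ a) (V $ b)" "w (\<chi> j. V $ Transposition.transpose a b j) = W (V $ b) (V $ a)"
    unfolding W_def
    by (intro arg_cong[where f=w]; simp add: vec_eq_iff Transposition.transpose_def)+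
  ultimately show ?thesis by simp
qed

text \<open>By multilinearity it suffices to treat tuples of standard basis vectors. Such a tuple
  either repeats a vector, or is a permutation of the standard basis and differs from
  \<open>mat 1\<close> by transpositions, each of which only changes the sign.\<close>

lemma alternating_zero:
  fixes w :: "real ^ 'n ^ 'n::finite \<Rightarrow> real"
  assumes w: "alternating_multilinear w" and "w (mat 1) = 0"
  shows "w V = 0"
proof -
  have perm: "w (\<chi> i. axis (p i) 1) = 0" if "p permutes UNIV" for p :: "'n \<Rightarrow> 'n"
    using finite[of "UNIV :: 'n set"] that
  proof (induction rule: permutes_rev_induct)
    case id
    have "(\<chi> i. axis (id i) 1) = (mat 1 :: real ^ 'n ^ 'n)"
      by (auto simp: vec_eq_iff mat_def axis_def)
    then show ?case using assms(2) by simp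
  next
    case (swap a b p)
    show ?case
    proof (cases "a = b")
      case False
      then show ?thesis using alternating_swap[OF w False, of "\<chi> i. axis (p i) 1"] swap by simp
    qed (use swap in simp)
  qed
  \<comment> \<open>\<open>T\<close> collects the rows that are still arbitrary; the others are
    basis vectors. For \<open>T = UNIV\<close> no restriction on \<open>V\<close> remains.\<close>
  have "finite T \<Longrightarrow> \<forall>V. (\<forall>i. i \<notin> T \<longrightarrow> (\<exists>j. V $ i = axis j 1)) \<longrightarrow> w V = 0" for T :: "'n set"
  proof (induction T rule: finite_induct)
    case empty
    show ?case
    proof (intro allI impI)
      fix V :: "real ^ 'n ^ 'n" assume "\<forall>i. i \<notin> {} \<longrightarrow> (\<exists>j. V $ i = axis j 1)"
      then obtain s where s: "V $ i = axis (s i) 1" for i by (metis empty_iff)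
      show "w V = 0"
      proof (cases "inj s")
        case True
        then have "s permutes UNIV" by (intro bij_imp_permutes) (simp_all add: bij_betw_def finite_UNIV_inj_surj)
        moreover have "V = (\<chi> i. axis (s i) 1)" by (simp add: vec_eq_iff s)
        ultimately show ?thesis using perm by simp
      next
        case False
        then obtain i j where "i \<noteq> j" "V $ i = V $ j" unfolding inj_def s by metis
        then show ?thesis using w unfolding alternating_multilinear_def by blast
      qed
    qed
  next
    case (insert i T)
    show ?case
    proof (intro allI impI)
      fix V :: "real ^ 'n ^ 'n" assume V: "\<forall>k. k \<notin> insert i T \<longrightarrow> (\<exists>j. V $ k = axis j 1)"
      define L where "L v = w (\<chi> j. if j = i then v else V $ j)" for v
      have L: "linear L" using w unfolding alternating_multilinear_def L_def by blast
      have "L (axis j 1) = 0" for j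
        unfolding L_def by (rule insert.IH[rule_format]) (use V in auto)
      then have "L (\<Sum>j\<in>UNIV. (V $ i $ j) *\<^sub>R axis j 1) = 0"
        by (simp add: linear_sum[OF L] linear_cmul[OF L])
      moreover have "(\<Sum>j\<in>UNIV. (V $ i $ j) *\<^sub>R axis j 1) = V $ i"
        using basis_expansion[of "V $ i"] by (simp add: scalar_mult_eq_scaleR)
      moreover have "(\<chi> j. if j = i then V $ i else V $ j) = V" by (simp add: vec_eq_iff)
      ultimately show "w V = 0" by (simp add: L_def)
    qed
  qed
  from this[of UNIV] show ?thesis by simp
qed

lemma linear_det_row: "linear (\<lambda>v. det (\<chi> j. if j = i then v else V $ j) :: real)"
proof (rule linearI)
  show "det (\<chi> j. if j = i then u + v else V $ j)
      = det (\<chi> j. if j = i then u else V $ j) + det (\<chi> j. if j = i then v else V $ j)" for u v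
    by (rule det_row_add)
  show "det (\<chi> j. if j = i then c *\<^sub>R v else V $ j) = c *\<^sub>R det (\<chi> j. if j = i then v else V $ j)" for c v
    using det_row_mul[of i c "\<lambda>_. v" "\<lambda>j. V $ j"] unfolding scalar_mult_eq_scaleR by simp
qed

text \<open>Subtracting the multiple of \<open>det\<close> with the same value at
  \<open>mat 1\<close> leaves an alternating form that vanishes at \<open>mat 1\<close>, hence
  everywhere.\<close>

lemma alternating_eq_det:
  assumes w: "alternating_multilinear w"
  shows "w V = det V * w (mat 1)"
proof -
  define w' where "w' V = w V - det V * w (mat 1)" for V
  have "alternating_multilinear w'" unfolding alternating_multilinear_def
  proof (intro conjI allI impI)
    show "linear (\<lambda>v. w' (\<chi> j. if j = i then v else V $ j))" for V i
    proof -
      have "linear (\<lambda>v. w (\<chi> j. if j = i then v else V $ j))"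
        using w unfolding alternating_multilinear_def by blast
      then show ?thesis using linear_det_row[of i V]
        by (auto simp: w'_def linear_iff algebra_simps)
    qed
    show "w' V = 0" if "i \<noteq> j \<and> V $ i = V $ j" for V i j
    proof -
      have "w V = 0" using w that unfolding alternating_multilinear_def by blast
      moreover have "det V = 0" using that by (intro det_identical_rows[of i j]) (auto simp: row_def)
      ultimately show ?thesis by (simp add: w'_def)
    qed
  qed
  from alternating_zero[OF this, of V] show ?thesis by (simp add: w'_def)
qed

section \<open>The derivative of the determinant\<close>

lemma has_derivative_det:
  fixes V :: "real ^ 'n ^ 'n::finite"
  shows "(det has_derivative (\<lambda>H. \<Sum>i\<in>UNIV. det (\<chi> j. if j = i then H $ i else V $ j))) (at V)"
proof -
  have e: "((\<lambda>V::real^'n^'n. V $ i $ k) has_derivative (\<lambda>H. H $ i $ k)) (at V)" for i k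
    by (intro bounded_linear.has_derivative[OF bounded_linear_vec_nth] has_derivative_ident)
  have "(det has_derivative (\<lambda>H. \<Sum>p | p permutes UNIV. of_int (sign p) *
      (\<Sum>i\<in>UNIV. H $ i $ p i * (\<Prod>j\<in>UNIV-{i}. V $ j $ p j)))) (at V)"
    unfolding det_def by (intro has_derivative_sum has_derivative_mult_right has_derivative_prod e)
  moreover have "(\<Sum>p | p permutes UNIV. of_int (sign p) * (\<Sum>i\<in>UNIV. H $ i $ p i * (\<Prod>j\<in>UNIV-{i}. V $ j $ p j)))
     = (\<Sum>i\<in>UNIV. det (\<chi> j. if j = i then H $ i else V $ j))" for H :: "real ^ 'n ^ 'n"
  proof -
    \<comment> \<open>Differentiating one factor of a product in the Leibniz formula is the same as
      replacing the corresponding row.\<close>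
    have "(\<Prod>j\<in>UNIV. (\<chi> j. if j = i then H $ i else V $ j) $ j $ p j) = H $ i $ p i * (\<Prod>j\<in>UNIV-{i}. V $ j $ p j)"
      for i and p :: "'n \<Rightarrow> 'n"
      by (subst prod.remove[of _ i]) (auto intro!: prod.cong)
    then show ?thesis
      unfolding det_def sum_distrib_left by (subst sum.swap) simp
  qed
  ultimately show ?thesis by simp
qed

text \<open>Both sides are the derivative at t = 0 of det (V (1 + t M^T)), once by differentiating
  the rows and once after splitting off det V by multiplicativity. Only the derivative at the
  identity has to be computed, by Cramer's rule, and singular \<open>V\<close> are covered
  too.\<close>

lemma sum_det_row_eq_trace:
  fixes V M :: "real ^ 'n ^ 'n::finite"
  shows "(\<Sum>i\<in>UNIV. det (\<chi> j. if j = i then M *v V $ i else V $ j)) = trace M * det V"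
proof -
  have one: "(\<Sum>i\<in>UNIV. det (\<chi> j. if j = i then H $ i else mat 1 $ j)) = trace H" for H :: "real ^ 'n ^ 'n"
  proof -
    have "row j (mat 1 :: real^'n^'n) = axis j 1" "(mat 1 :: real^'n^'n) $ j = axis j 1" for j
      by (auto simp: row_def mat_def axis_def vec_eq_iff)
    note rows = this
    have "det (\<chi> j. if j = i then H $ i else mat 1 $ j) = H $ i $ i" for i
      using cramer_lemma_transpose[of i "H $ i" "mat 1 :: real^'n^'n"] unfolding rows basis_expansion by simp
    then show ?thesis by (simp add: trace_def)
  qed
  \<comment> \<open>The transpose appears because \<open>M\<close> acts on the rows of
    \<open>V\<close>, which is multiplication by its transpose from the right.\<close>
  define A where "A t = mat 1 + t *\<^sub>R transpose M" for t :: real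
  have A: "(A has_derivative (\<lambda>s. s *\<^sub>R transpose M)) (at t)" for t
    unfolding A_def by (auto intro!: derivative_eq_intros)
  have VA: "((\<lambda>t. V + t *\<^sub>R (V ** transpose M)) has_derivative
      (\<lambda>s. s *\<^sub>R (V ** transpose M))) (at t)" for t
    by (auto intro!: derivative_eq_intros)
  have eq: "V + t *\<^sub>R (V ** transpose M) = V ** A t" for t
    by (simp add: A_def matrix_add_ldistrib)
      (simp add: vec_eq_iff matrix_matrix_mult_def sum_distrib_left mult_ac)
  have row: "(V ** transpose M) $ i = M *v V $ i" for i
    by (simp add: vec_eq_iff matrix_matrix_mult_def matrix_vector_mult_def Finite_Cartesian_Product.transpose_def mult.commute)
  have "((\<lambda>t. det (V ** A t)) has_derivative (\<lambda>s. \<Sum>i\<in>UNIV. det (\<chi> j. if j = i then s *\<^sub>R (M *v V $ i) else V $ j))) (at 0)"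
    using has_derivative_compose[OF VA[of 0] has_derivative_det] by (simp add: eq row cong: if_cong)
  moreover have "((\<lambda>t. det V * det (A t)) has_derivative (\<lambda>s. det V * trace (s *\<^sub>R transpose M))) (at 0)"
  proof -
    have "A 0 = mat 1" by (simp add: A_def)
    then show ?thesis
      using has_derivative_mult_right[OF has_derivative_compose[OF A[of 0] has_derivative_det], of "det V"]
      unfolding \<open>A 0 = mat 1\<close> one by simp
  qed
  ultimately have "(\<lambda>s. \<Sum>i\<in>UNIV. det (\<chi> j. if j = i then s *\<^sub>R (M *v V $ i) else V $ j))
     = (\<lambda>s. det V * trace (s *\<^sub>R transpose M))"
    by (simp add: det_mul has_derivative_unique)
  from fun_cong[OF this, of 1] show ?thesis
    unfolding scaleR_one by (simp add: trace_def Finite_Cartesian_Product.transpose_def mult.commute)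
qed

text \<open>Turns the sum over the slots in \<open>lie_top_form\<close> into the trace of the
  derivative of the vector field.\<close>

lemma alternating_sum_row_eq_trace:
  assumes "alternating_multilinear w"
  shows "(\<Sum>i\<in>UNIV. w (\<chi> j. if j = i then M *v V $ i else V $ j)) = trace M * w V"
  using sum_det_row_eq_trace[of M V]
  by (simp add: alternating_eq_det[OF assms, of V] alternating_eq_det[OF assms, of "\<chi> j. _ j"]
      flip: sum_distrib_right)

text \<open>Jacobi's formula. It serves twice: for the Jacobian determinant in a change of charts
  and for det (1 - B P).\<close>

lemma has_derivative_ln_abs_det:
  fixes M :: "'a::real_normed_vector \<Rightarrow> real ^ 'n ^ 'n::finite"
  assumes M: "(M has_derivative M') (at x)" and N: "N ** M x = mat 1"
  shows "((\<lambda>x. ln \<bar>det (M x)\<bar>) has_derivative (\<lambda>v. trace (N ** M' v))) (at x)"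
proof -
  have N': "M x ** N = mat 1" using N matrix_left_right_inverse by blast
  have ne: "det (M x) \<noteq> 0" using N by (metis det_I det_mul mult_zero_right zero_neq_one)
  have "(\<Sum>i\<in>UNIV. det (\<chi> j. if j = i then H $ i else M x $ j)) = trace (N ** H) * det (M x)" for H
  proof -
    \<comment> \<open>Factoring \<open>H\<close> through \<open>M x\<close> exhibits the rows of
      \<open>H\<close> as the image of the rows of \<open>M x\<close> under
      \<open>transpose K\<close>, the shape required by \<open>sum_det_row_eq_trace\<close>.\<close>
    define K where "K = N ** H"
    have "H = M x ** K" by (simp add: K_def matrix_mul_assoc N')
    then have H: "H $ i = transpose K *v M x $ i" for i
      by (simp add: vec_eq_iff matrix_matrix_mult_def matrix_vector_mult_def Finite_Cartesian_Product.transpose_def mult.commute)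
    then have "(\<Sum>i\<in>UNIV. det (\<chi> j. if j = i then H $ i else M x $ j))
        = trace (transpose K) * det (M x)"
      using sum_det_row_eq_trace[of "transpose K" "M x"] by (simp only: H)
    then show ?thesis by (simp add: K_def trace_def Finite_Cartesian_Product.transpose_def)
  qed
  then have "((\<lambda>x. det (M x)) has_derivative (\<lambda>v. trace (N ** M' v) * det (M x))) (at x)"
    using has_derivative_compose[OF M has_derivative_det] by simp
  from has_derivative_compose[OF this has_derivative_ln_abs[OF ne]] ne show ?thesis by (simp add: mult.assoc)
qed

section \<open>Index computations\<close>

text \<open>Throughout, \<open>dP l i j\<close> stands for \<open>\<partial>\<^sub>l P\<^sub>i\<^sub>j\<close>, and \<open>r\<close> for the gradient of the logarithmic density.\<close>

lemma sum_antisym_sym_zero: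
  fixes a s :: "'n::finite \<Rightarrow> 'n \<Rightarrow> real"
  assumes "\<And>i j. a j i = - a i j" "\<And>i j. s j i = s i j"
  shows "(\<Sum>i\<in>UNIV. \<Sum>j\<in>UNIV. a i j * s i j) = 0"
proof -
  have "(\<Sum>i\<in>UNIV. \<Sum>j\<in>UNIV. a i j * s i j) = (\<Sum>i\<in>UNIV. \<Sum>j\<in>UNIV. a j i * s j i)" by (rule sum.swap)
  also have "\<dots> = - (\<Sum>i\<in>UNIV. \<Sum>j\<in>UNIV. a i j * s i j)"
    unfolding sum_negf[symmetric] by (intro sum.cong refl) (subst assms(1), subst assms(2), simp)
  finally show ?thesis by simp
qed

text \<open>Contracting the Jacobi identity with \<open>C\<close> in two of its three free indices
  makes two of its three terms coincide, as \<open>C\<close> and \<open>dP\<close> are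
  antisymmetric: X + 2 W = 0. Hence the factor 1/2, which later meets the 1/2 in the logarithmic
  density. The application is to C = N B.\<close>

lemma jacobi_contracted:
  fixes P C :: "'n::finite \<Rightarrow> 'n \<Rightarrow> real" and dP :: "'n \<Rightarrow> 'n \<Rightarrow> 'n \<Rightarrow> real"
  assumes P: "\<And>i j. P j i = - P i j" and dP: "\<And>l i j. dP l j i = - dP l i j"
    and C: "\<And>i j. C j i = - C i j"
    and jac: "\<And>i j k. (\<Sum>l\<in>UNIV. P l i * dP l j k + P l j * dP l k i + P l k * dP l i j) = 0"
  shows "(\<Sum>j\<in>UNIV. \<Sum>k\<in>UNIV. \<Sum>b\<in>UNIV. dP j a b * C b k * P k j)
       = (\<Sum>j\<in>UNIV. P a j * (\<Sum>k\<in>UNIV. \<Sum>b\<in>UNIV. C k b * dP j b k)) / 2"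
proof -
  define W where "W = (\<Sum>b\<in>UNIV. \<Sum>k\<in>UNIV. \<Sum>l\<in>UNIV. C b k * P l k * dP l a b)"
  define X where "X = (\<Sum>b\<in>UNIV. \<Sum>k\<in>UNIV. \<Sum>l\<in>UNIV. C b k * P l a * dP l b k)"
  define Y where "Y = (\<Sum>b\<in>UNIV. \<Sum>k\<in>UNIV. \<Sum>l\<in>UNIV. C b k * P l b * dP l k a)"
  have "(\<Sum>b\<in>UNIV. \<Sum>k\<in>UNIV. C b k * (\<Sum>l\<in>UNIV. P l a * dP l b k + P l b * dP l k a + P l k * dP l a b)) = X + Y + W"
    unfolding W_def X_def Y_def by (simp add: sum_distrib_left sum.distrib algebra_simps)
  then have "X + Y + W = 0" by (simp add: jac)
  moreover have "Y = W"
  proof -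
    have "Y = (\<Sum>k\<in>UNIV. \<Sum>b\<in>UNIV. \<Sum>l\<in>UNIV. C b k * P l b * dP l k a)" unfolding Y_def by (rule sum.swap)
    also have "\<dots> = W" unfolding W_def
      by (intro sum.cong refl) (subst C, subst dP, simp)
    finally show ?thesis .
  qed
  moreover have "(\<Sum>j\<in>UNIV. \<Sum>k\<in>UNIV. \<Sum>b\<in>UNIV. dP j a b * C b k * P k j) = - W"
  proof -
    have "(\<Sum>j\<in>UNIV. \<Sum>k\<in>UNIV. \<Sum>b\<in>UNIV. dP j a b * C b k * P k j)
       = (\<Sum>j\<in>UNIV. \<Sum>b\<in>UNIV. \<Sum>k\<in>UNIV. dP j a b * C b k * P k j)"
      by (rule sum.cong[OF refl], rule sum.swap)
    also have "\<dots> = (\<Sum>b\<in>UNIV. \<Sum>j\<in>UNIV. \<Sum>k\<in>UNIV. dP j a b * C b k * P k j)" by (rule sum.swap)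
    also have "\<dots> = (\<Sum>b\<in>UNIV. \<Sum>k\<in>UNIV. \<Sum>j\<in>UNIV. dP j a b * C b k * P k j)"
      by (rule sum.cong[OF refl], rule sum.swap)
    also have "\<dots> = - W" unfolding W_def sum_negf[symmetric]
      by (intro sum.cong refl) (subst P, simp)
    finally show ?thesis .
  qed
  moreover have "(\<Sum>j\<in>UNIV. P a j * (\<Sum>k\<in>UNIV. \<Sum>b\<in>UNIV. C k b * dP j b k)) = X"
  proof -
    have "(\<Sum>j\<in>UNIV. P a j * (\<Sum>k\<in>UNIV. \<Sum>b\<in>UNIV. C k b * dP j b k))
       = (\<Sum>j\<in>UNIV. \<Sum>k\<in>UNIV. \<Sum>b\<in>UNIV. P a j * (C k b * dP j b k))" by (simp add: sum_distrib_left)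
    also have "\<dots> = (\<Sum>k\<in>UNIV. \<Sum>j\<in>UNIV. \<Sum>b\<in>UNIV. P a j * (C k b * dP j b k))" by (rule sum.swap)
    also have "\<dots> = (\<Sum>k\<in>UNIV. \<Sum>b\<in>UNIV. \<Sum>j\<in>UNIV. P a j * (C k b * dP j b k))"
      by (rule sum.cong[OF refl], rule sum.swap)
    also have "\<dots> = X" unfolding X_def
      by (intro sum.cong refl) (subst P, subst dP, simp)
    finally show ?thesis .
  qed
  ultimately show ?thesis by simp
qed

text \<open>The counterpart of \<open>jacobi_contracted\<close> for dB = 0: contracted with an
  antisymmetric matrix, two of the three cyclic terms agree.\<close>

lemma closed_contracted:
  fixes Q :: "'n::finite \<Rightarrow> 'n \<Rightarrow> real" and dB :: "'n \<Rightarrow> 'n \<Rightarrow> 'n \<Rightarrow> real"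
  assumes Q: "\<And>i j. Q j i = - Q i j" and dB: "\<And>l i j. dB l j i = - dB l i j"
    and closed: "\<And>i j k. dB i j k + dB j k i + dB k i j = 0"
  shows "(\<Sum>j\<in>UNIV. \<Sum>b\<in>UNIV. dB j a b * Q b j) = (\<Sum>b\<in>UNIV. \<Sum>j\<in>UNIV. dB a b j * Q j b) / 2"
proof -
  define X where "X = (\<Sum>j\<in>UNIV. \<Sum>b\<in>UNIV. dB j a b * Q b j)"
  have "(\<Sum>j\<in>UNIV. \<Sum>b\<in>UNIV. Q b j * (dB a b j + dB b j a + dB j a b)) = 0" by (simp add: closed)
  then have "(\<Sum>j\<in>UNIV. \<Sum>b\<in>UNIV. Q b j * dB a b j) + (\<Sum>j\<in>UNIV. \<Sum>b\<in>UNIV. Q b j * dB b j a)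
      + (\<Sum>j\<in>UNIV. \<Sum>b\<in>UNIV. Q b j * dB j a b) = 0"
    by (simp add: distrib_left sum.distrib)
  moreover have "(\<Sum>j\<in>UNIV. \<Sum>b\<in>UNIV. Q b j * dB b j a) = X"
  proof -
    have "(\<Sum>j\<in>UNIV. \<Sum>b\<in>UNIV. Q b j * dB b j a) = (\<Sum>b\<in>UNIV. \<Sum>j\<in>UNIV. Q b j * dB b j a)" by (rule sum.swap)
    also have "\<dots> = X" unfolding X_def by (intro sum.cong refl) (subst Q, subst dB, simp)
    finally show ?thesis .
  qed
  moreover have "(\<Sum>j\<in>UNIV. \<Sum>b\<in>UNIV. Q b j * dB j a b) = X" unfolding X_def by (simp add: mult.commute)
  moreover have "(\<Sum>j\<in>UNIV. \<Sum>b\<in>UNIV. Q b j * dB a b j) = - (\<Sum>b\<in>UNIV. \<Sum>j\<in>UNIV. dB a b j * Q j b)"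
  proof -
    have "(\<Sum>j\<in>UNIV. \<Sum>b\<in>UNIV. Q b j * dB a b j) = (\<Sum>b\<in>UNIV. \<Sum>j\<in>UNIV. Q b j * dB a b j)" by (rule sum.swap)
    also have "\<dots> = - (\<Sum>b\<in>UNIV. \<Sum>j\<in>UNIV. dB a b j * Q j b)"
      unfolding sum_negf[symmetric] by (intro sum.cong refl) (subst Q, simp)
    finally show ?thesis .
  qed
  ultimately show ?thesis by (simp add: X_def)
qed

text \<open>Pure algebra on values and first derivatives at one point. The hypothesis on
  \<open>dQ\<close> is the derivative of Q (1 - B P) = P, so no inverse has to be differentiated;
  \<open>D\<close> is the gradient of half the logarithm of |det (1 - B P)|. Divergence of
  \<open>Q\<close> and density correction produce the same surplus terms with opposite
  signs.\<close>

lemma gauge_preserves_unimodularity: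
  fixes P B Q N :: "real ^ 'n ^ 'n::finite" and dP dB dQ :: "'n \<Rightarrow> real ^ 'n ^ 'n" and r D :: "'n \<Rightarrow> real"
  assumes P: "\<And>i j. P $ j $ i = - P $ i $ j" and dP: "\<And>l i j. dP l $ j $ i = - dP l $ i $ j"
    and B: "\<And>i j. B $ j $ i = - B $ i $ j" and dB: "\<And>l i j. dB l $ j $ i = - dB l $ i $ j"
    and Q: "\<And>i j. Q $ j $ i = - Q $ i $ j"
    and N: "(mat 1 - B ** P) ** N = mat 1" and QN: "Q = P ** N"
    and dQ: "\<And>l. dQ l ** (mat 1 - B ** P) - Q ** (dB l ** P + B ** dP l) = dP l"
    and D: "\<And>l. D l = - trace (N ** (dB l ** P + B ** dP l)) / 2"
    and jac: "\<And>i j k. (\<Sum>l\<in>UNIV. P $ l $ i * dP l $ j $ k + P $ l $ j * dP l $ k $ i + P $ l $ k * dP l $ i $ j) = 0"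
    and closed: "\<And>i j k. dB i $ j $ k + dB j $ k $ i + dB k $ i $ j = 0"
    and Z: "\<And>i. (\<Sum>j\<in>UNIV. dP j $ i $ j) + (\<Sum>j\<in>UNIV. P $ i $ j * r j) = 0"
  shows "(\<Sum>j\<in>UNIV. dQ j $ i $ j) + (\<Sum>j\<in>UNIV. Q $ i $ j * (r j + D j)) = 0"
proof -
  \<comment> \<open>This is the inverse of 1 - P B written without an inverse. Likewise N = 1 + B Q,
    which is the transpose of \<open>K\<close>.\<close>
  define K where "K = mat 1 + Q ** B"
  define C where "C = N ** B"
  have N': "N ** (mat 1 - B ** P) = mat 1" using N matrix_left_right_inverse by blast
  have "Q ** (mat 1 - B ** P) = P" by (simp add: QN N' flip: matrix_mul_assoc)
  then have "Q - Q ** B ** P = P" by (simp add: matrix_sub_ldistrib matrix_mul_assoc)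
  then have QK: "Q = K ** P" by (simp add: K_def matrix_add_rdistrib) (metis diff_add_cancel)
  have "N - B ** Q = mat 1" using N by (simp add: QN matrix_sub_rdistrib matrix_mul_assoc)
  then have NB: "N = mat 1 + B ** Q" by (metis diff_add_cancel)
  have CK: "C = B ** K"
    unfolding C_def K_def by (subst NB) (simp add: matrix_add_rdistrib matrix_add_ldistrib matrix_mul_assoc)
  have NC: "N = mat 1 + C ** P" using NB unfolding QK CK by (simp add: matrix_mul_assoc)
  \<comment> \<open>The two descriptions C = N B = B K are exchanged by transposition up to the sign
    of \<open>B\<close>.\<close>
  have C: "C $ j $ i = - C $ i $ j" for i j
  proof -
    have t: "transpose Q = - Q" "transpose B = - B"
      unfolding vec_eq_iff Finite_Cartesian_Product.transpose_def uminus_vec_def vec_lambda_beta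
      by (intro allI Q, intro allI B)
    have "transpose K = N"
      unfolding K_def NB bounded_linear.linear[OF bounded_linear_transpose, THEN linear_add]
      by (simp add: matrix_transpose_mul t matrix_minus_left matrix_minus_right)
    then have "transpose C = - C"
      unfolding CK by (simp add: matrix_transpose_mul t matrix_minus_right) (metis C_def CK)
    from arg_cong[where f="\<lambda>X. X $ i $ j", OF this] show ?thesis
      by (simp add: Finite_Cartesian_Product.transpose_def)
  qed
  \<comment> \<open>Multiplying by \<open>N\<close> from the right solves for \<open>dQ\<close>. The
    two terms in \<open>dP\<close> combine through 1 + Q B = K, and P N = Q rewrites the term in
    \<open>dB\<close>.\<close>
  have dQ': "dQ l = K ** (dP l ** N) + Q ** (dB l ** Q)" for l
  proof -
    have "dQ l ** (mat 1 - B ** P) = dP l + Q ** (dB l ** P + B ** dP l)" using dQ[of l] by (metis diff_add_cancel add.commute)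
    then have "dQ l ** (mat 1 - B ** P) ** N = (dP l + Q ** (dB l ** P + B ** dP l)) ** N" by simp
    then have "dQ l = (dP l + Q ** (dB l ** P + B ** dP l)) ** N" by (simp add: N flip: matrix_mul_assoc)
    then show ?thesis
      by (simp add: K_def QN matrix_add_rdistrib matrix_add_ldistrib matrix_mul_assoc)
  qed
  \<comment> \<open>\<open>t\<close> and \<open>s\<close> are the contributions of dP and dB to the
    gradient of the logarithmic determinant; \<open>D\<close> is minus half their sum.\<close>
  define t where "t j = trace (C ** dP j)" for j
  define s where "s j = trace (dB j ** Q)" for j
  have D': "D j = - s j / 2 - t j / 2" for j
  proof -
    have "trace (N ** (dB j ** P)) = s j" unfolding s_def QN matrix_mul_assoc
      by (metis matrix_mul_assoc trace_mul_sym)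
    then show ?thesis
      by (simp add: D t_def C_def matrix_add_ldistrib trace_add matrix_mul_assoc diff_divide_distrib)
  qed
  have entry: "(\<Sum>j\<in>UNIV. (A ** M j) $ i $ j) = (\<Sum>a\<in>UNIV. A $ i $ a * (\<Sum>j\<in>UNIV. M j $ a $ j))"
    for A :: "real ^ 'n ^ 'n" and M
    unfolding matrix_matrix_mult_def by (simp add: sum_distrib_left) (rule sum.swap)
  have entryP: "(\<Sum>j\<in>UNIV. Q $ i $ j * x j) = (\<Sum>a\<in>UNIV. K $ i $ a * (\<Sum>j\<in>UNIV. P $ a $ j * x j))" for x
    unfolding QK matrix_matrix_mult_def
    by (simp add: sum_distrib_left sum_distrib_right mult.assoc) (rule sum.swap)
  \<comment> \<open>N = 1 + C P separates the divergence of \<open>P\<close> from a part quadratic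
    in \<open>P\<close> and its derivatives, and the contracted Jacobi identity evaluates the
    latter.\<close>
  have u: "(\<Sum>j\<in>UNIV. (dP j ** N) $ a $ j) = (\<Sum>j\<in>UNIV. dP j $ a $ j) + (\<Sum>j\<in>UNIV. P $ a $ j * t j) / 2" for a
  proof -
    have "(\<Sum>j\<in>UNIV. (dP j ** N) $ a $ j) = (\<Sum>j\<in>UNIV. dP j $ a $ j) + (\<Sum>j\<in>UNIV. (dP j ** C ** P) $ a $ j)"
      by (subst NC) (simp add: matrix_add_ldistrib matrix_mul_assoc sum.distrib)
    also have "(\<Sum>j\<in>UNIV. (dP j ** C ** P) $ a $ j) = (\<Sum>j\<in>UNIV. P $ a $ j * t j) / 2"
      using jacobi_contracted[of "\<lambda>i j. P $ i $ j" "\<lambda>l i j. dP l $ i $ j" "\<lambda>i j. C $ i $ j" a, OF P dP C jac]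
      by (simp add: t_def trace_def matrix_matrix_mult_def sum_distrib_right)
    finally show ?thesis .
  qed
  have v: "(\<Sum>j\<in>UNIV. (dB j ** Q) $ a $ j) = s a / 2" for a
    using closed_contracted[of "\<lambda>i j. Q $ i $ j" "\<lambda>l i j. dB l $ i $ j" a, OF Q dB closed]
    by (simp add: s_def trace_def matrix_matrix_mult_def)
  \<comment> \<open>The terms in \<open>s\<close> and \<open>t\<close> here are the negatives of
    those in the next sum; what survives is \<open>K\<close> applied to the modular field of
    \<open>P\<close>, zero by \<open>Z\<close>.\<close>
  have "(\<Sum>j\<in>UNIV. dQ j $ i $ j) = (\<Sum>a\<in>UNIV. K $ i $ a * (\<Sum>j\<in>UNIV. dP j $ a $ j))
      + (\<Sum>a\<in>UNIV. K $ i $ a * (\<Sum>j\<in>UNIV. P $ a $ j * t j)) / 2 + (\<Sum>a\<in>UNIV. Q $ i $ a * s a) / 2"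
    unfolding dQ' by (simp add: sum.distrib entry u v distrib_left flip: sum_divide_distrib)
  moreover have "(\<Sum>j\<in>UNIV. Q $ i $ j * (r j + D j)) = (\<Sum>a\<in>UNIV. K $ i $ a * (\<Sum>j\<in>UNIV. P $ a $ j * r j))
      - (\<Sum>a\<in>UNIV. Q $ i $ a * s a) / 2 - (\<Sum>a\<in>UNIV. K $ i $ a * (\<Sum>j\<in>UNIV. P $ a $ j * t j)) / 2"
    unfolding entryP[symmetric] D'
    by (simp add: algebra_simps sum.distrib sum_subtractf sum_negf flip: sum_divide_distrib)
  moreover have "(\<Sum>a\<in>UNIV. K $ i $ a * (\<Sum>j\<in>UNIV. dP j $ a $ j)) + (\<Sum>a\<in>UNIV. K $ i $ a * (\<Sum>j\<in>UNIV. P $ a $ j * r j)) = 0"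
    using Z by (simp add: flip: sum.distrib distrib_left)
  ultimately show ?thesis by linarith
qed

text \<open>Contracting the derivative of the Jacobi identity with respect to the direction of differentiation.\<close>

lemma modular_field_preserves_bivector:
  fixes P :: "'n::finite \<Rightarrow> 'n \<Rightarrow> real" and dP :: "'n \<Rightarrow> 'n \<Rightarrow> 'n \<Rightarrow> real"
    and ddP :: "'n \<Rightarrow> 'n \<Rightarrow> 'n \<Rightarrow> 'n \<Rightarrow> real" and r :: "'n \<Rightarrow> real" and dr :: "'n \<Rightarrow> 'n \<Rightarrow> real"
  defines "Z \<equiv> \<lambda>i. (\<Sum>j\<in>UNIV. dP j i j) + (\<Sum>j\<in>UNIV. P i j * r j)"
  defines "dZ \<equiv> \<lambda>k i. (\<Sum>j\<in>UNIV. ddP k j i j) + (\<Sum>j\<in>UNIV. dP k i j * r j + P i j * dr k j)"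
  assumes P: "\<And>i j. P j i = - P i j" and dP: "\<And>l i j. dP l j i = - dP l i j"
    and ddP: "\<And>k l i j. ddP k l j i = - ddP k l i j"
    and ddP_sym: "\<And>k l i j. ddP l k i j = ddP k l i j" and dr_sym: "\<And>k l. dr l k = dr k l"
    and jac: "\<And>i j k. (\<Sum>l\<in>UNIV. P l i * dP l j k + P l j * dP l k i + P l k * dP l i j) = 0"
    and djac: "\<And>m i j k. (\<Sum>l\<in>UNIV. dP m l i * dP l j k + P l i * ddP m l j k + (dP m l j * dP l k i + P l j * ddP m l k i)
         + (dP m l k * dP l i j + P l k * ddP m l i j)) = 0"
  shows "(\<Sum>k\<in>UNIV. Z k * dP k i j) - (\<Sum>k\<in>UNIV. dZ k i * P k j) - (\<Sum>k\<in>UNIV. P i k * dZ k j) = 0"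
proof -
  define A where "A k i = (\<Sum>j\<in>UNIV. ddP k j i j)" for k i
  \<comment> \<open>The differentiation index of \<open>djac\<close> is set equal to its third free
    index and summed. Of the six double sums, two cancel each other, one pairs an antisymmetric with
    a symmetric array, and three form the Lie derivative along the divergence part of
    \<open>Z\<close>.\<close>
  have "(\<Sum>k\<in>UNIV. \<Sum>l\<in>UNIV. dP k l i * dP l j k + P l i * ddP k l j k + (dP k l j * dP l k i + P l j * ddP k l k i)
         + (dP k l k * dP l i j + P l k * ddP k l i j)) = 0" by (simp add: djac)
  then have "(\<Sum>k\<in>UNIV. \<Sum>l\<in>UNIV. dP k l i * dP l j k) + (\<Sum>k\<in>UNIV. \<Sum>l\<in>UNIV. P l i * ddP k l j k)
     + ((\<Sum>k\<in>UNIV. \<Sum>l\<in>UNIV. dP k l j * dP l k i) + (\<Sum>k\<in>UNIV. \<Sum>l\<in>UNIV. P l j * ddP k l k i))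
     + ((\<Sum>k\<in>UNIV. \<Sum>l\<in>UNIV. dP k l k * dP l i j) + (\<Sum>k\<in>UNIV. \<Sum>l\<in>UNIV. P l k * ddP k l i j)) = 0"
    by (simp only: sum.distrib)
  moreover have "(\<Sum>k\<in>UNIV. \<Sum>l\<in>UNIV. dP k l j * dP l k i) = - (\<Sum>k\<in>UNIV. \<Sum>l\<in>UNIV. dP k l i * dP l j k)"
  proof -
    have "(\<Sum>k\<in>UNIV. \<Sum>l\<in>UNIV. dP k l j * dP l k i) = (\<Sum>l\<in>UNIV. \<Sum>k\<in>UNIV. dP k l j * dP l k i)" by (rule sum.swap)
    also have "\<dots> = - (\<Sum>k\<in>UNIV. \<Sum>l\<in>UNIV. dP k l i * dP l j k)"
      unfolding sum_negf[symmetric] by (intro sum.cong refl) (subst (1) dP, simp)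
    finally show ?thesis .
  qed
  moreover have "(\<Sum>k\<in>UNIV. \<Sum>l\<in>UNIV. P l k * ddP k l i j) = 0"
  proof -
    have "(\<Sum>k\<in>UNIV. \<Sum>l\<in>UNIV. P l k * ddP k l i j) = - (\<Sum>k\<in>UNIV. \<Sum>l\<in>UNIV. P k l * ddP k l i j)"
      unfolding sum_negf[symmetric] by (intro sum.cong refl) (subst P, simp)
    then show ?thesis using sum_antisym_sym_zero[of P "\<lambda>k l. ddP k l i j", OF P ddP_sym] by simp
  qed
  moreover have "(\<Sum>k\<in>UNIV. \<Sum>l\<in>UNIV. P l i * ddP k l j k) = - (\<Sum>k\<in>UNIV. P i k * A k j)"
  proof -
    have "(\<Sum>k\<in>UNIV. \<Sum>l\<in>UNIV. P l i * ddP k l j k) = (\<Sum>l\<in>UNIV. \<Sum>k\<in>UNIV. P l i * ddP k l j k)" by (rule sum.swap)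
    also have "\<dots> = - (\<Sum>k\<in>UNIV. P i k * A k j)"
      unfolding sum_negf[symmetric] A_def sum_distrib_left
      by (intro sum.cong refl) (subst P, subst ddP_sym, simp)
    finally show ?thesis .
  qed
  moreover have "(\<Sum>k\<in>UNIV. \<Sum>l\<in>UNIV. P l j * ddP k l k i) = - (\<Sum>k\<in>UNIV. A k i * P k j)"
  proof -
    have "(\<Sum>k\<in>UNIV. \<Sum>l\<in>UNIV. P l j * ddP k l k i) = (\<Sum>l\<in>UNIV. \<Sum>k\<in>UNIV. P l j * ddP k l k i)" by (rule sum.swap)
    also have "\<dots> = - (\<Sum>k\<in>UNIV. A k i * P k j)"
      unfolding sum_negf[symmetric] A_def sum_distrib_right
      by (intro sum.cong refl) (subst ddP, subst ddP_sym, simp)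
    finally show ?thesis .
  qed
  moreover have "(\<Sum>k\<in>UNIV. \<Sum>l\<in>UNIV. dP k l k * dP l i j) = (\<Sum>k\<in>UNIV. (\<Sum>j\<in>UNIV. dP j k j) * dP k i j)"
    by (subst sum.swap) (simp add: sum_distrib_right)
  ultimately have 1: "(\<Sum>k\<in>UNIV. (\<Sum>j\<in>UNIV. dP j k j) * dP k i j) - (\<Sum>k\<in>UNIV. A k i * P k j) - (\<Sum>k\<in>UNIV. P i k * A k j) = 0"
    by simp
  \<comment> \<open>The remaining part of \<open>Z\<close> is P applied to a closed covector, up to
    sign a locally Hamiltonian field. It preserves P by the undifferentiated Jacobi identity
    together with the symmetry of \<open>dr\<close>.\<close>
  have "(\<Sum>l\<in>UNIV. r l * (\<Sum>k\<in>UNIV. P k i * dP k j l + P k j * dP k l i + P k l * dP k i j)) = 0" by (simp add: jac)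
  then have 2: "(\<Sum>l\<in>UNIV. \<Sum>k\<in>UNIV. P k i * dP k j l * r l) + (\<Sum>l\<in>UNIV. \<Sum>k\<in>UNIV. P k j * dP k l i * r l)
      + (\<Sum>l\<in>UNIV. \<Sum>k\<in>UNIV. P k l * dP k i j * r l) = 0"
    by (simp add: sum_distrib_left sum.distrib algebra_simps)
  have 21: "(\<Sum>l\<in>UNIV. \<Sum>k\<in>UNIV. P k l * dP k i j * r l) = (\<Sum>k\<in>UNIV. (\<Sum>l\<in>UNIV. P k l * r l) * dP k i j)"
    by (subst sum.swap) (simp add: sum_distrib_left mult_ac)
  have 22: "(\<Sum>l\<in>UNIV. \<Sum>k\<in>UNIV. P k j * dP k l i * r l) = - (\<Sum>k\<in>UNIV. (\<Sum>l\<in>UNIV. dP k i l * r l) * P k j)"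
    unfolding sum_negf[symmetric] sum_distrib_right
    by (subst sum.swap) (intro sum.cong refl, subst dP, simp)
  have 23: "(\<Sum>l\<in>UNIV. \<Sum>k\<in>UNIV. P k i * dP k j l * r l) = - (\<Sum>k\<in>UNIV. P i k * (\<Sum>l\<in>UNIV. dP k j l * r l))"
    unfolding sum_negf[symmetric] sum_distrib_left
    by (subst sum.swap) (intro sum.cong refl, subst P, simp)
  have 3: "(\<Sum>k\<in>UNIV. (\<Sum>l\<in>UNIV. P i l * dr k l) * P k j) = - (\<Sum>k\<in>UNIV. P i k * (\<Sum>l\<in>UNIV. P j l * dr k l))"
  proof -
    have "(\<Sum>k\<in>UNIV. (\<Sum>l\<in>UNIV. P i l * dr k l) * P k j) = (\<Sum>l\<in>UNIV. \<Sum>k\<in>UNIV. P i l * dr k l * P k j)"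
      unfolding sum_distrib_right by (rule sum.swap)
    also have "\<dots> = - (\<Sum>k\<in>UNIV. P i k * (\<Sum>l\<in>UNIV. P j l * dr k l))"
      unfolding sum_negf[symmetric] sum_distrib_left
      by (intro sum.cong refl) (subst (2) P, subst dr_sym, simp)
    finally show ?thesis .
  qed
  show ?thesis
    using 1 2 3 unfolding Z_def dZ_def A_def[symmetric] 21 22 23
    by (simp add: sum.distrib distrib_left distrib_right)
qed

section \<open>Modular fields in a coordinate domain\<close>

lemma has_derivative_nth:
  "(f has_derivative f') F \<Longrightarrow> ((\<lambda>x. f x $ i) has_derivative (\<lambda>v. f' v $ i)) F"
  by (rule bounded_linear.has_derivative[OF bounded_linear_vec_nth])

lemma has_derivative_vecI:
  fixes f :: "'a::real_normed_vector \<Rightarrow> real ^ 'n::finite"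
  assumes "\<And>i. ((\<lambda>x. f x $ i) has_derivative (\<lambda>v. f' v $ i)) (at x)"
  shows "(f has_derivative f') (at x)"
  unfolding has_derivative_componentwise_within[of f]
  using assms by (auto simp: Basis_vec_def inner_axis)

lemma fderiv_antisym:
  fixes p :: "'a::real_normed_vector \<Rightarrow> real ^ 'n ^ 'n::finite"
  assumes S: "open S" "x \<in> S" and p: "p differentiable (at x)"
    and a: "\<And>x i j. x \<in> S \<Longrightarrow> p x $ j $ i = - p x $ i $ j"
  shows "fderiv p x v $ j $ i = - fderiv p x v $ i $ j"
proof -
  note d = has_derivative_nth[OF has_derivative_nth[OF has_fderiv[OF p]]]
  have "((\<lambda>x. p x $ j $ i) has_derivative (\<lambda>v. - fderiv p x v $ i $ j)) (at x)"
    by (rule has_derivative_transform_within_open[OF has_derivative_minus[OF d] S]) (rule a[symmetric])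
  from has_derivative_unique[OF d this] show ?thesis by (rule fun_cong)
qed

text \<open>Formulated on coordinate space, where ordinary calculus applies. Here \<open>r\<close>
  is the logarithmic density itself, not its gradient as in the index computations.\<close>

definition local_modular_field ::
  "(real ^ 'n \<Rightarrow> real ^ 'n ^ 'n) \<Rightarrow> (real ^ 'n \<Rightarrow> real) \<Rightarrow> real ^ 'n \<Rightarrow> real ^ 'n::finite" where
  "local_modular_field p r x =
     (\<chi> i. (\<Sum>j\<in>UNIV. fderiv p x (axis j 1) $ i $ j) + (\<Sum>j\<in>UNIV. p x $ i $ j * fderiv r x (axis j 1)))"

lemma smooth_on_local_modular_field:
  assumes S: "open S" and p: "smooth_on S p" and r: "smooth_on S r"
  shows "smooth_on S (local_modular_field p r)"
proof (rule smooth_on_vecI[OF S])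
  fix i
  have 1: "smooth_on S (\<lambda>x. fderiv p x (axis j 1) $ i $ j)" for j
    by (rule smooth_on_nth[OF S smooth_on_nth[OF S smooth_on_fderiv[OF p]]])
  have 2: "smooth_on S (\<lambda>x. p x $ i $ j * fderiv r x (axis j 1))" for j
    by (rule smooth_on_mult[OF S smooth_on_nth[OF S smooth_on_nth[OF S p]] smooth_on_fderiv[OF r]])
  show "smooth_on S (\<lambda>x. local_modular_field p r x $ i)"
    unfolding local_modular_field_def vec_lambda_beta
    by (rule smooth_on_add[OF S smooth_on_sum[OF S 1] smooth_on_sum[OF S 2]])
qed

lemma fderiv_expand:
  fixes f :: "real ^ 'n::finite \<Rightarrow> 'b::real_normed_vector"
  assumes "f differentiable (at x)"
  shows "fderiv f x v = (\<Sum>k\<in>UNIV. v $ k *\<^sub>R fderiv f x (axis k 1))"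
proof -
  have l: "linear (fderiv f x)" by (rule linear_frechet_derivative[OF assms])
  have "v = (\<Sum>k\<in>UNIV. v $ k *\<^sub>R axis k 1)"
    using basis_expansion[of v] by (simp add: scalar_mult_eq_scaleR)
  then have "fderiv f x v = fderiv f x (\<Sum>k\<in>UNIV. v $ k *\<^sub>R axis k 1)" by simp
  then show ?thesis by (simp only: linear_sum[OF l] linear_cmul[OF l])
qed

text \<open>Supplies the arrays of first and second derivatives to
  \<open>modular_field_preserves_bivector\<close>; their symmetries come from equality of mixed
  partial derivatives.\<close>

lemma local_modular_field_poisson:
  fixes p :: "real ^ 'n \<Rightarrow> real ^ 'n ^ 'n::finite" and r :: "real ^ 'n \<Rightarrow> real"
  assumes S: "open S" "x \<in> S" and p: "smooth_on S p" and r: "smooth_on S r"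
    and a: "\<And>x i j. x \<in> S \<Longrightarrow> p x $ j $ i = - p x $ i $ j"
    and jac: "\<And>x i j k. x \<in> S \<Longrightarrow>
      (\<Sum>l\<in>UNIV. p x $ l $ i * fderiv p x (axis l 1) $ j $ k
        + p x $ l $ j * fderiv p x (axis l 1) $ k $ i + p x $ l $ k * fderiv p x (axis l 1) $ i $ j) = 0"
  defines "z \<equiv> local_modular_field p r"
  shows "fderiv p x (z x) - matrix (fderiv z x) ** p x - p x ** transpose (matrix (fderiv z x)) = 0"
proof -
  define P where "P i j = p x $ i $ j" for i j
  define dp where "dp l = (\<lambda>x. fderiv p x (axis l 1))" for l
  define dP where "dP l i j = dp l x $ i $ j" for l i j
  define ddP where "ddP m l i j = fderiv (dp l) x (axis m 1) $ i $ j" for m l i j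
  define dr where "dr l = (\<lambda>x. fderiv r x (axis l 1))" for l
  define R where "R l = dr l x" for l
  define dR where "dR m l = fderiv (dr l) x (axis m 1)" for m l
  have dp: "smooth_on S (dp l)" for l unfolding dp_def by (rule smooth_on_fderiv[OF p])
  have dr: "smooth_on S (dr l)" for l unfolding dr_def by (rule smooth_on_fderiv[OF r])
  have dpa: "dp l x $ j $ i = - dp l x $ i $ j" if "x \<in> S" for l i j x
    unfolding dp_def by (rule fderiv_antisym[OF S(1) that smooth_on_differentiable[OF p that] a])
  have Pd: "((\<lambda>x. p x $ i $ j) has_derivative (\<lambda>v. fderiv p x v $ i $ j)) (at x)" for i j
    by (rule has_derivative_nth[OF has_derivative_nth[OF smooth_on_has_fderiv[OF p S(2)]]])
  have dPd: "((\<lambda>x. dp l x $ i $ j) has_derivative (\<lambda>v. fderiv (dp l) x v $ i $ j)) (at x)" for l i j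
    by (rule has_derivative_nth[OF has_derivative_nth[OF smooth_on_has_fderiv[OF dp S(2)]]])
  have drd: "(dr l has_derivative fderiv (dr l) x) (at x)" for l
    by (rule smooth_on_has_fderiv[OF dr S(2)])
  have djac: "(\<Sum>l\<in>UNIV. dP m l i * dP l j k + P l i * ddP m l j k + (dP m l j * dP l k i + P l j * ddP m l k i)
         + (dP m l k * dP l i j + P l k * ddP m l i j)) = 0" for m i j k
  proof -
    \<comment> \<open>The Jacobi identity holds on the whole open set \<open>S\<close>, so
      \<open>g\<close> is zero there and so is its derivative.\<close>
    define g where "g x = (\<Sum>l\<in>UNIV. p x $ l $ i * dp l x $ j $ k + p x $ l $ j * dp l x $ k $ i
      + p x $ l $ k * dp l x $ i $ j)" for x
    have "(g has_derivative (\<lambda>v. \<Sum>l\<in>UNIV. (p x $ l $ i * fderiv (dp l) x v $ j $ k + fderiv p x v $ l $ i * dp l x $ j $ k)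
       + (p x $ l $ j * fderiv (dp l) x v $ k $ i + fderiv p x v $ l $ j * dp l x $ k $ i)
       + (p x $ l $ k * fderiv (dp l) x v $ i $ j + fderiv p x v $ l $ k * dp l x $ i $ j))) (at x)"
      unfolding g_def
      by (rule has_derivative_sum, rule has_derivative_add, rule has_derivative_add)
        (rule has_derivative_mult[OF Pd dPd])+
    moreover have "(g has_derivative (\<lambda>v. 0)) (at x)"
      by (rule has_derivative_transform_within_open[OF has_derivative_const[of 0] S])
        (simp add: g_def dp_def jac)
    ultimately have "(\<Sum>l\<in>UNIV. (p x $ l $ i * fderiv (dp l) x v $ j $ k + fderiv p x v $ l $ i * dp l x $ j $ k)
       + (p x $ l $ j * fderiv (dp l) x v $ k $ i + fderiv p x v $ l $ j * dp l x $ k $ i)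
       + (p x $ l $ k * fderiv (dp l) x v $ i $ j + fderiv p x v $ l $ k * dp l x $ i $ j)) = 0" for v
      using has_derivative_unique by (blast dest: fun_cong)
    from this[of "axis m 1"] show ?thesis
      by (simp add: P_def dP_def ddP_def) (simp add: dp_def add.commute)
  qed
  have zx: "z x $ i = (\<Sum>j\<in>UNIV. dP j i j) + (\<Sum>j\<in>UNIV. P i j * R j)" for i
    by (simp add: z_def local_modular_field_def dP_def dp_def P_def R_def dr_def)
  have z_eq: "z = (\<lambda>x. \<chi> i. (\<Sum>j\<in>UNIV. dp j x $ i $ j) + (\<Sum>j\<in>UNIV. p x $ i $ j * dr j x))"
    by (simp add: z_def local_modular_field_def dp_def dr_def fun_eq_iff)
  have "(z has_derivative (\<lambda>v. \<chi> i. (\<Sum>j\<in>UNIV. fderiv (dp j) x v $ i $ j)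
      + (\<Sum>j\<in>UNIV. p x $ i $ j * fderiv (dr j) x v + fderiv p x v $ i $ j * dr j x))) (at x)"
    unfolding z_eq
    by (rule has_derivative_vecI, unfold vec_lambda_beta,
        rule has_derivative_add[OF has_derivative_sum[OF dPd] has_derivative_sum[OF has_derivative_mult[OF Pd drd]]])
  then have fz: "fderiv z x = (\<lambda>v. \<chi> i. (\<Sum>j\<in>UNIV. fderiv (dp j) x v $ i $ j)
      + (\<Sum>j\<in>UNIV. p x $ i $ j * fderiv (dr j) x v + fderiv p x v $ i $ j * dr j x))"
    by (rule fderiv_eqI)
  have dz: "matrix (fderiv z x) $ i $ k = (\<Sum>j\<in>UNIV. ddP k j i j) + (\<Sum>j\<in>UNIV. dP k i j * R j + P i j * dR k j)" for i k
    unfolding fz matrix_def by (simp add: ddP_def dP_def P_def R_def dR_def) (simp add: dp_def add.commute)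
  have lin: "fderiv p x (z x) $ i $ j = (\<Sum>k\<in>UNIV. z x $ k * dP k i j)" for i j
    using fderiv_expand[OF smooth_on_differentiable[OF p S(2)], of "z x"] by (simp add: dP_def dp_def)
  have main: "(\<Sum>k\<in>UNIV. z x $ k * dP k i j) - (\<Sum>k\<in>UNIV. matrix (fderiv z x) $ i $ k * P k j)
      - (\<Sum>k\<in>UNIV. P i k * matrix (fderiv z x) $ j $ k) = 0" for i j
    unfolding zx dz
  proof (rule modular_field_preserves_bivector[of P dP ddP dR])
    show "P j i = - P i j" for i j unfolding P_def by (rule a[OF S(2)])
    show "dP l j i = - dP l i j" for l i j unfolding dP_def by (rule dpa[OF S(2)])
    show "ddP k l j i = - ddP k l i j" for k l i j
      unfolding ddP_def by (rule fderiv_antisym[OF S smooth_on_differentiable[OF dp S(2)] dpa])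
    show "dR l k = dR k l" for l k
      unfolding dR_def dr_def by (rule second_derivative_symmetric_real[OF S r])
    show "ddP l k i j = ddP k l i j" for k l i j
    proof -
      have *: "fderiv (dp k) x v $ i $ j = fderiv (\<lambda>y. fderiv (\<lambda>x. p x $ i $ j) y (axis k 1)) x v" for k v
      proof -
        have eq: "dp k y $ i $ j = fderiv (\<lambda>x. p x $ i $ j) y (axis k 1)" if "y \<in> S" for y
          unfolding dp_def
          using fderiv_eqI[OF has_derivative_nth[OF has_derivative_nth[OF smooth_on_has_fderiv[OF p that]]], of i j]
          by simp
        have "fderiv (\<lambda>y. dp k y $ i $ j) x = fderiv (\<lambda>y. fderiv (\<lambda>x. p x $ i $ j) y (axis k 1)) x"
          by (rule fderiv_cong_open[OF S eq])
        then show ?thesis unfolding fderiv_eqI[OF dPd] by (rule fun_cong)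
      qed
      show ?thesis unfolding ddP_def *
        by (rule second_derivative_symmetric_real[OF S smooth_on_nth[OF S(1) smooth_on_nth[OF S(1) p]]])
    qed
    show "(\<Sum>l\<in>UNIV. P l i * dP l j k + P l j * dP l k i + P l k * dP l i j) = 0" for i j k
      using jac[OF S(2)] by (simp add: P_def dP_def dp_def)
  qed (rule djac)
  show ?thesis
    using main by (simp add: vec_eq_iff lin matrix_matrix_mult_def P_def Finite_Cartesian_Product.transpose_def)
qed

text \<open>The second derivatives of \<open>f\<close> meet the antisymmetric \<open>p\<close> and
  cancel, so the divergence of the Hamiltonian field is of first order in \<open>f\<close> and can
  be read off as a pairing with a vector.\<close>

lemma trace_hamiltonian:
  fixes p :: "real ^ 'n \<Rightarrow> real ^ 'n ^ 'n::finite" and r f :: "real ^ 'n \<Rightarrow> real"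
  assumes S: "open S" "x \<in> S" and p: "smooth_on S p" and r: "smooth_on S r" and f: "smooth_on S f"
    and a: "\<And>x i j. x \<in> S \<Longrightarrow> p x $ j $ i = - p x $ i $ j"
  defines "df \<equiv> \<lambda>x. \<chi> i. fderiv f x (axis i 1)"
  defines "h \<equiv> \<lambda>x. transpose (p x) *v df x"
  shows "fderiv r x (h x) + trace (matrix (fderiv h x)) = local_modular_field p r x \<bullet> df x"
proof -
  define dp where "dp l = (\<lambda>x. fderiv p x (axis l 1))" for l
  have Pd: "((\<lambda>x. p x $ i $ j) has_derivative (\<lambda>v. fderiv p x v $ i $ j)) (at x)" for i j
    by (rule has_derivative_nth[OF has_derivative_nth[OF smooth_on_has_fderiv[OF p S(2)]]])
  define g where "g i = (\<lambda>x. fderiv f x (axis i 1))" for i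
  have g: "(g i has_derivative fderiv (g i) x) (at x)" for i
    unfolding g_def by (rule smooth_on_has_fderiv[OF smooth_on_fderiv[OF f] S(2)])
  have h_eq: "h = (\<lambda>x. \<chi> j. \<Sum>i\<in>UNIV. p x $ i $ j * g i x)"
    by (simp add: h_def df_def g_def fun_eq_iff vec_eq_iff matrix_vector_mult_def Finite_Cartesian_Product.transpose_def)
  have "(h has_derivative (\<lambda>v. \<chi> j. \<Sum>i\<in>UNIV. p x $ i $ j * fderiv (g i) x v + fderiv p x v $ i $ j * g i x)) (at x)"
    unfolding h_eq by (rule has_derivative_vecI, unfold vec_lambda_beta, rule has_derivative_sum, rule has_derivative_mult[OF Pd g])
  then have fh: "fderiv h x = (\<lambda>v. \<chi> j. \<Sum>i\<in>UNIV. p x $ i $ j * fderiv (g i) x v + fderiv p x v $ i $ j * g i x)"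
    by (rule fderiv_eqI)
  have "trace (matrix (fderiv h x)) = (\<Sum>j\<in>UNIV. \<Sum>i\<in>UNIV. p x $ i $ j * fderiv (g i) x (axis j 1))
     + (\<Sum>j\<in>UNIV. \<Sum>i\<in>UNIV. fderiv p x (axis j 1) $ i $ j * g i x)"
    unfolding fh by (simp add: trace_def matrix_def sum.distrib)
  also have "(\<Sum>j\<in>UNIV. \<Sum>i\<in>UNIV. p x $ i $ j * fderiv (g i) x (axis j 1)) = 0"
  proof (subst sum.swap, rule sum_antisym_sym_zero)
    show "p x $ j $ i = - p x $ i $ j" for i j by (rule a[OF S(2)])
    show "fderiv (g j) x (axis i 1) = fderiv (g i) x (axis j 1)" for i j
      unfolding g_def by (rule second_derivative_symmetric_real[OF S f])
  qed
  also have "(\<Sum>j\<in>UNIV. \<Sum>i\<in>UNIV. fderiv p x (axis j 1) $ i $ j * g i x)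
     = (\<Sum>i\<in>UNIV. (\<Sum>j\<in>UNIV. fderiv p x (axis j 1) $ i $ j) * g i x)"
    by (subst sum.swap) (simp add: sum_distrib_right)
  finally have t: "trace (matrix (fderiv h x)) = (\<Sum>i\<in>UNIV. (\<Sum>j\<in>UNIV. fderiv p x (axis j 1) $ i $ j) * g i x)"
    by simp
  have "fderiv r x (h x) = (\<Sum>j\<in>UNIV. \<Sum>i\<in>UNIV. p x $ i $ j * g i x * fderiv r x (axis j 1))"
    using fderiv_expand[OF smooth_on_differentiable[OF r S(2)], of "h x"] by (simp add: h_eq sum_distrib_right)
  also have "\<dots> = (\<Sum>i\<in>UNIV. (\<Sum>j\<in>UNIV. p x $ i $ j * fderiv r x (axis j 1)) * g i x)"
    by (subst sum.swap) (simp add: sum_distrib_left mult_ac)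
  finally show ?thesis
    by (simp add: t inner_vec_def local_modular_field_def df_def g_def distrib_right sum.distrib)
qed

section \<open>Charts\<close>

lemma matrix_mult_has_derivative:
  fixes f :: "real ^ 'n::finite \<Rightarrow> real ^ 'n"
  assumes "(f has_derivative f') F"
  shows "matrix f' *v v = f' v"
  using matrix_vector_mul(2)[OF has_derivative_linear[OF assms]] by (rule fun_cong)

abbreviation has_chart_deriv ::
  "('m, 'n::finite) chart \<Rightarrow> ('m \<Rightarrow> 'b::real_normed_vector) \<Rightarrow> (real ^ 'n \<Rightarrow> 'b) \<Rightarrow> 'm \<Rightarrow> bool" where
  "has_chart_deriv c F F' p \<equiv> ((\<lambda>x. F (cinv c x)) has_derivative F') (at (coord c p))"

lemma chart_deriv_eqI: "has_chart_deriv c F F' p \<Longrightarrow> chart_deriv c F p = F'"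
  unfolding chart_deriv_def o_def by (simp add: fderiv_eqI)

lemma chart_deriv_fderiv: "chart_deriv c F p = fderiv (\<lambda>x. F (cinv c x)) (coord c p)"
  unfolding chart_deriv_def o_def by simp

lemma coord_cinv: "x \<in> coord c ` dom_of c \<Longrightarrow> coord c (cinv c x) = x"
  by (simp add: cinv_def f_inv_into_f)

lemma cinv_in_dom: "x \<in> coord c ` dom_of c \<Longrightarrow> cinv c x \<in> dom_of c"
  by (simp add: cinv_def inv_into_into)

locale manifold =
  fixes A :: "('m::{t2_space, second_countable_topology}, 'n::finite) chart set"
  assumes atlas: "smooth_atlas A"
begin

lemma chart: "c \<in> A \<Longrightarrow> is_chart c"
  using atlas unfolding smooth_atlas_def by blast

lemma chart_open: "c \<in> A \<Longrightarrow> open (dom_of c)" "c \<in> A \<Longrightarrow> open (coord c ` dom_of c)"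
  using chart unfolding is_chart_def by blast+

lemma ex_chart: "\<exists>c\<in>A. p \<in> dom_of c"
  using atlas unfolding smooth_atlas_def by blast

lemma chart_inj: "c \<in> A \<Longrightarrow> inj_on (coord c) (dom_of c)"
  using chart unfolding is_chart_def homeomorphism_def by (metis inj_on_inverseI)

lemma cinv_coord: "c \<in> A \<Longrightarrow> p \<in> dom_of c \<Longrightarrow> cinv c (coord c p) = p"
  by (simp add: cinv_def chart_inj)

lemma chart_homeomorphism:
  assumes "c \<in> A"
  shows "homeomorphism (dom_of c) (coord c ` dom_of c) (coord c) (cinv c)"
proof -
  obtain g where g: "homeomorphism (dom_of c) (coord c ` dom_of c) (coord c) g"
    using chart[OF assms] unfolding is_chart_def by blast
  show ?thesis
    by (rule homeomorphism_cong[OF g]) (use g cinv_coord[OF assms] in \<open>auto simp: homeomorphism_def\<close>)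
qed

lemma chart_image_open:
  assumes "c \<in> A" "open U"
  shows "open (coord c ` (dom_of c \<inter> U))"
proof -
  have "openin (top_of_set (dom_of c)) (dom_of c \<inter> U)" using assms(2) by (rule openin_open_Int)
  from homeomorphism_imp_open_map[OF chart_homeomorphism[OF assms(1)] this]
  show ?thesis using chart_open(2)[OF assms(1)] by (simp add: openin_open_eq)
qed

lemma transition_smooth:
  "c \<in> A \<Longrightarrow> d \<in> A \<Longrightarrow> smooth_on (coord c ` (dom_of c \<inter> dom_of d)) (\<lambda>x. coord d (cinv c x))"
  using atlas unfolding smooth_atlas_def o_def by blast

lemma smooth_has_chart_deriv:
  "smooth_on (coord c ` dom_of c) (F \<circ> cinv c) \<Longrightarrow> p \<in> dom_of c \<Longrightarrow> has_chart_deriv c F (chart_deriv c F p) p"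
  unfolding o_def chart_deriv_fderiv by (rule smooth_on_has_fderiv) auto

lemma transition_has_deriv:
  assumes "c \<in> A" "d \<in> A" "p \<in> dom_of c" "p \<in> dom_of d"
  shows "has_chart_deriv c (coord d) (chart_deriv c (coord d) p) p"
  unfolding chart_deriv_fderiv by (rule smooth_on_has_fderiv[OF transition_smooth[OF assms(1,2)]]) (use assms in auto)

lemma transition_jac_mult:
  assumes "c \<in> A" "d \<in> A" "p \<in> dom_of c" "p \<in> dom_of d"
  shows "transition_jac c d p *v v = chart_deriv c (coord d) p v"
  unfolding transition_jac_def
  by (rule matrix_mult_has_derivative[OF transition_has_deriv[OF assms]])

text \<open>The chain rule through the transition map. The composite agrees with the expression in
  \<open>c\<close> only on the overlap, which is open and so determines the derivative.\<close>

lemma has_chart_deriv_change: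
  assumes "c \<in> A" "d \<in> A" "p \<in> dom_of c" "p \<in> dom_of d" "has_chart_deriv d F F' p"
  shows "has_chart_deriv c F (\<lambda>v. F' (transition_jac c d p *v v)) p"
proof (rule has_derivative_transform_within_open)
  have e: "cinv c (coord c p) = p" using assms by (simp add: cinv_coord)
  have "((\<lambda>x. F (cinv d x)) has_derivative F') (at (coord d (cinv c (coord c p))))" using assms(5) e by simp
  from has_derivative_compose[OF transition_has_deriv[OF assms(1-4)] this]
  show "((\<lambda>x. F (cinv d (coord d (cinv c x)))) has_derivative (\<lambda>v. F' (transition_jac c d p *v v))) (at (coord c p))"
    by (simp add: transition_jac_mult[OF assms(1-4)])
  show "open (coord c ` (dom_of c \<inter> dom_of d))" by (intro chart_image_open chart_open assms)
  show "coord c p \<in> coord c ` (dom_of c \<inter> dom_of d)" using assms by blast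
  show "F (cinv d (coord d (cinv c x))) = F (cinv c x)" if "x \<in> coord c ` (dom_of c \<inter> dom_of d)" for x
    using that assms by (auto simp: cinv_coord)
qed

text \<open>The change of charts is applied to \<open>coord c\<close>, whose expression in its own
  chart is the identity.\<close>

lemma transition_jac_inverse:
  assumes "c \<in> A" "d \<in> A" "p \<in> dom_of c" "p \<in> dom_of d"
  shows "transition_jac d c p ** transition_jac c d p = mat 1"
proof -
  have "has_chart_deriv c (coord c) (\<lambda>v. v) p"
    by (rule has_derivative_transform_within_open[OF has_derivative_ident chart_open(2)[OF assms(1)]])
      (use assms in \<open>auto simp: cinv_coord\<close>)
  moreover have "has_chart_deriv c (coord c) (\<lambda>v. chart_deriv d (coord c) p (transition_jac c d p *v v)) p"
    by (rule has_chart_deriv_change[OF assms]) (rule transition_has_deriv; fact assms)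
  ultimately have "(\<lambda>v. v) = (\<lambda>v. chart_deriv d (coord c) p (transition_jac c d p *v v))"
    by (rule has_derivative_unique)
  then have "transition_jac d c p *v (transition_jac c d p *v v) = v" for v
    using transition_jac_mult[OF assms(2,1,4,3)] by metis
  then show ?thesis by (simp add: matrix_eq matrix_vector_mul_assoc)
qed

lemma differential_change:
  assumes "c \<in> A" "d \<in> A" "p \<in> dom_of c" "p \<in> dom_of d" "smooth_fun A f"
  shows "differential f c p = transpose (transition_jac c d p) *v differential f d p"
proof -
  have sm: "has_chart_deriv e f (chart_deriv e f p) p" if "e \<in> A" "p \<in> dom_of e" for e
    by (rule smooth_has_chart_deriv) (use that assms(5) in \<open>auto simp: smooth_fun_def\<close>)
  have ex: "chart_deriv d f p w = differential f d p \<bullet> w" for w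
    using fderiv_expand[OF differentiableI[OF sm[OF assms(2,4)]], of w]
    by (simp add: differential_def inner_vec_def chart_deriv_fderiv mult.commute)
  have ch: "chart_deriv c f p v = chart_deriv d f p (transition_jac c d p *v v)" for v
    by (rule fun_cong[OF chart_deriv_eqI[OF has_chart_deriv_change[OF assms(1-4) sm[OF assms(2,4)]]]])
  have "differential f c p $ i = chart_deriv c f p (axis i 1)" for i
    by (simp add: differential_def)
  also have "chart_deriv c f p (axis i 1)
      = (transpose (transition_jac c d p) *v differential f d p) $ i" for i
    unfolding ch ex dot_lmul_matrix[symmetric] transpose_matrix_vector by (simp add: inner_axis)
  finally show ?thesis by (simp add: vec_eq_iff)
qed

lemma chart_deriv_differential:
  assumes "c \<in> A" "p \<in> dom_of c" "smooth_fun A f"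
  shows "chart_deriv c f p v = differential f c p \<bullet> v"
proof -
  have "has_chart_deriv c f (chart_deriv c f p) p"
    by (rule smooth_has_chart_deriv) (use assms in \<open>auto simp: smooth_fun_def\<close>)
  from fderiv_expand[OF differentiableI[OF this], of v] show ?thesis
    by (simp add: differential_def inner_vec_def chart_deriv_fderiv mult.commute)
qed

text \<open>The definition of the modular vector field tests against globally smooth functions only;
  this lemma makes such tests strong enough to determine a vector at each point.\<close>

lemma ex_smooth_fun_differential:
  assumes c: "c \<in> A" and p: "p \<in> dom_of c"
  obtains f where "smooth_fun A f" "differential f c p = u"
proof -
  define y where "y = coord c p"
  have "y \<in> coord c ` dom_of c" using p by (simp add: y_def)
  then obtain r where r: "r > 0" "cball y r \<subseteq> coord c ` dom_of c"
    using chart_open(2)[OF c] open_contains_cball by blast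
  obtain h :: "real ^ 'n \<Rightarrow> real" where h: "smooth_on UNIV h" "\<And>x. x \<notin> ball y r \<Longrightarrow> h x = 0"
    "(h has_derivative (\<lambda>v. u \<bullet> v)) (at y)"
    using bump_with_derivative[OF r(1), of y u] by blast
  \<comment> \<open>A compact set containing the support of \<open>f\<close>. It is closed because
    \<open>M\<close> is Hausdorff, so its complement is an open set on which \<open>f\<close>
    vanishes.\<close>
  define K where "K = cinv c ` cball y r"
  have "continuous_on (cball y r) (cinv c)"
    by (rule continuous_on_subset[OF homeomorphism_cont2[OF chart_homeomorphism[OF c]] r(2)])
  then have "compact K" unfolding K_def by (rule compact_continuous_image) simp
  then have K: "closed K" by (rule compact_imp_closed)
  have Kc: "K \<subseteq> dom_of c"
    unfolding K_def using r(2) by (intro image_subsetI cinv_in_dom) (rule subsetD)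
  define f where "f q = (if q \<in> dom_of c then h (coord c q) else 0)" for q
  have fK: "f q = 0" if "q \<notin> K" for q
  proof (cases "q \<in> dom_of c")
    case True
    have "coord c q \<notin> ball y r"
    proof
      assume "coord c q \<in> ball y r"
      then have "coord c q \<in> cball y r" by auto
      then have "cinv c (coord c q) \<in> K" unfolding K_def by blast
      then show False using that cinv_coord[OF c True] by simp
    qed
    then show ?thesis by (simp add: f_def h(2))
  qed (simp add: f_def)
  have "smooth_on (coord d ` dom_of d) (\<lambda>x. f (cinv d x))" if d: "d \<in> A" for d
  proof (rule smooth_on_local)
    fix x assume "x \<in> coord d ` dom_of d"
    then obtain q where q: "q \<in> dom_of d" "x = coord d q" by blast
    show "\<exists>T. open T \<and> x \<in> T \<and> smooth_on T (\<lambda>x. f (cinv d x))"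
    \<comment> \<open>The domain of \<open>c\<close> and the complement of \<open>K\<close> cover
      the manifold, and \<open>f\<close> is visibly smooth on each.\<close>
    proof (cases "q \<in> dom_of c")
      case True
      have o: "open (coord d ` (dom_of d \<inter> dom_of c))" by (intro chart_image_open chart_open c d)
      have "smooth_on (coord d ` (dom_of d \<inter> dom_of c)) (\<lambda>x. h (coord c (cinv d x)))"
        by (rule smooth_on_compose[OF o open_UNIV _ transition_smooth[OF d c] h(1)]) simp
      then have "smooth_on (coord d ` (dom_of d \<inter> dom_of c)) (\<lambda>x. f (cinv d x))"
        by (rule smooth_on_cong[OF o, rotated]) (auto simp: f_def cinv_coord[OF d])
      then show ?thesis using q True by (intro exI[of _ "coord d ` (dom_of d \<inter> dom_of c)"] conjI o) auto
    next
      case False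
      have o: "open (coord d ` (dom_of d \<inter> - K))" by (intro chart_image_open d) (use K in auto)
      have "smooth_on (coord d ` (dom_of d \<inter> - K)) (\<lambda>x. f (cinv d x))"
        by (rule smooth_on_cong[OF o _ smooth_on_const[of _ 0]]) (auto simp: fK cinv_coord[OF d])
      then show ?thesis using q False Kc by (intro exI[of _ "coord d ` (dom_of d \<inter> - K)"] conjI o) auto
    qed
  qed
  then have "smooth_fun A f" by (simp add: smooth_fun_def o_def)
  moreover have "has_chart_deriv c f (\<lambda>v. u \<bullet> v) p"
    by (rule has_derivative_transform_within_open[OF h(3)[unfolded y_def] chart_open(2)[OF c]])
      (use p c in \<open>auto simp: f_def cinv_coord\<close>)
  then have "differential f c p = u"
    by (simp add: differential_def chart_deriv_eqI vec_eq_iff inner_axis)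
  ultimately show ?thesis using that by blast
qed

end

section \<open>Divergence and modular fields\<close>

context manifold
begin

lemma smooth_fieldD:
  "smooth_field A T \<Longrightarrow> c \<in> A \<Longrightarrow> smooth_on (coord c ` dom_of c) (\<lambda>x. T c (cinv c x))"
  unfolding smooth_field_def o_def by blast

lemma smooth_funD:
  "smooth_fun A f \<Longrightarrow> c \<in> A \<Longrightarrow> smooth_on (coord c ` dom_of c) (\<lambda>x. f (cinv c x))"
  unfolding smooth_fun_def o_def by blast

lemma smooth_field_has_chart_deriv:
  "smooth_field A T \<Longrightarrow> c \<in> A \<Longrightarrow> p \<in> dom_of c \<Longrightarrow> has_chart_deriv c (T c) (chart_deriv c (T c) p) p"
  by (rule smooth_has_chart_deriv) (auto simp: smooth_field_def)

text \<open>The transformation law of the logarithms of the absolute values of the coordinate densities of a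
  volume form.\<close>

definition log_density :: "('m, 'n, real) field \<Rightarrow> bool" where
  "log_density \<phi> \<longleftrightarrow> smooth_field A \<phi> \<and>
     (\<forall>c\<in>A. \<forall>d\<in>A. \<forall>p\<in>dom_of c \<inter> dom_of d. \<phi> c p = \<phi> d p + ln \<bar>det (transition_jac c d p)\<bar>)"

lemma det_transition_jac:
  assumes "c \<in> A" "d \<in> A" "p \<in> dom_of c" "p \<in> dom_of d"
  shows "det (transition_jac c d p) \<noteq> 0"
  using transition_jac_inverse[OF assms] by (metis det_I det_mul mult_zero_right zero_neq_one)

lemma volume_form_det:
  assumes "volume_form A \<Omega>" "c \<in> A" "p \<in> dom_of c"
  shows "\<Omega> c p V = det V * \<Omega> c p (mat 1)" "\<Omega> c p (mat 1) \<noteq> 0"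
proof -
  show *: "\<Omega> c p V = det V * \<Omega> c p (mat 1)" for V
    by (rule alternating_eq_det) (use assms in \<open>unfold volume_form_def, blast\<close>)
  obtain V where "\<Omega> c p V \<noteq> 0" using assms unfolding volume_form_def by blast
  then show "\<Omega> c p (mat 1) \<noteq> 0" using *[of V] by auto
qed

definition log_volume :: "('m, 'n, real ^ 'n ^ 'n \<Rightarrow> real) field \<Rightarrow> ('m, 'n, real) field" where
  "log_volume \<Omega> c p = ln \<bar>\<Omega> c p (mat 1)\<bar>"

lemma log_density_log_volume:
  assumes "volume_form A \<Omega>"
  shows "log_density (log_volume \<Omega>)"
  unfolding log_density_def
proof (intro conjI ballI)
  have "smooth_field A (\<lambda>c p. \<Omega> c p (mat 1))" using assms unfolding volume_form_def by blast
  note s = smooth_fieldD[OF this]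
  show "smooth_field A (log_volume \<Omega>)" unfolding smooth_field_def o_def log_volume_def
  proof
    fix c assume c: "c \<in> A"
    show "smooth_on (coord c ` dom_of c) (\<lambda>x. ln \<bar>\<Omega> c (cinv c x) (mat 1)\<bar>)"
      by (rule smooth_on_ln_abs[OF chart_open(2)[OF c] s[OF c]]) (rule volume_form_det(2)[OF assms c cinv_in_dom])
  qed
  fix c d p assume c: "c \<in> A" and d: "d \<in> A" and "p \<in> dom_of c \<inter> dom_of d"
  then have p: "p \<in> dom_of c" "p \<in> dom_of d" by auto
  \<comment> \<open>A tuple of vectors stores them as rows, so the images of the coordinate vectors,
    the columns of the Jacobian, form its transpose.\<close>
  have m: "(\<chi> i. transition_jac c d p *v (mat 1 :: real ^ 'n ^ 'n) $ i) = transpose (transition_jac c d p)"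
    by (simp add: vec_eq_iff matrix_vector_mult_def mat_def Finite_Cartesian_Product.transpose_def if_distrib cong: if_cong)
  have "\<Omega> c p (mat 1) = \<Omega> d p (\<chi> i. transition_jac c d p *v mat 1 $ i)"
    using assms c d p unfolding volume_form_def by blast
  also have "\<dots> = det (transition_jac c d p) * \<Omega> d p (mat 1)"
    unfolding m volume_form_det(1)[OF assms d p(2), of "transpose _"] by simp
  finally show "log_volume \<Omega> c p = log_volume \<Omega> d p + ln \<bar>det (transition_jac c d p)\<bar>"
    using volume_form_det(2)[OF assms d p(2)] det_transition_jac[OF c d p]
    by (simp add: log_volume_def abs_mult ln_mult)
qed

text \<open>The classical coordinate divergence e^(-phi) \<Sum> d_i (e^phi X_i), written with the
  logarithmic density only.\<close>

definition density_div :: "('m, 'n, real) field \<Rightarrow> ('m, 'n, real ^ 'n) field \<Rightarrow> ('m, 'n, real) field" where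
  "density_div \<phi> X c p = chart_deriv c (\<phi> c) p (X c p) + trace (matrix (chart_deriv c (X c) p))"

text \<open>Differentiating X_d = J X_c adds tr (J^(-1) DJ(X)) to the trace of DX, while the
  derivative of ln |det J| along X, by Jacobi's formula the same number, separates the two density
  terms. They compensate. This makes \<open>divergence\<close> well defined and gives the modular
  field its transformation law.\<close>

lemma density_div_invariant:
  assumes \<phi>: "log_density \<phi>" and X: "vector_field A X"
    and c: "c \<in> A" and d: "d \<in> A" and pc: "p \<in> dom_of c" and pd: "p \<in> dom_of d"
  shows "density_div \<phi> X c p = density_div \<phi> X d p"
proof -
  define S where "S = coord c ` (dom_of c \<inter> dom_of d)"
  define x0 where "x0 = coord c p"
  define \<tau> where "\<tau> = (\<lambda>x. coord d (cinv c x))"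
  define Jx where "Jx = (\<lambda>x. matrix (fderiv \<tau> x))"
  define DJ where "DJ = fderiv Jx x0"
  define J where "J = transition_jac c d p"
  define J' where "J' = transition_jac d c p"
  have S: "open S" "x0 \<in> S"
    unfolding S_def x0_def using pc pd by (intro chart_image_open chart_open c d, blast)
  have \<tau>: "smooth_on S \<tau>" unfolding S_def \<tau>_def by (rule transition_smooth[OF c d])
  have JJ': "J ** J' = mat 1" "J' ** J = mat 1"
    unfolding J_def J'_def by (rule transition_jac_inverse; fact)+
  have Jx: "transition_jac c d q = Jx (coord c q)" for q
    by (simp add: Jx_def transition_jac_def \<tau>_def chart_deriv_fderiv)
  have "smooth_on S Jx"
    unfolding Jx_def matrix_def
    by (rule smooth_on_vecI[OF S(1)], rule smooth_on_vecI[OF S(1)], unfold vec_lambda_beta)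
      (rule smooth_on_nth[OF S(1) smooth_on_fderiv[OF \<tau>]])
  then have dJ: "(Jx has_derivative DJ) (at x0)"
    unfolding DJ_def by (rule smooth_on_has_fderiv[OF _ S(2)])
  \<comment> \<open>Identifies the derivative of the Jacobian with the second derivative of the
    transition map, so that its two arguments can be exchanged.\<close>
  have DJ: "DJ v *v y = fderiv (\<lambda>x. fderiv \<tau> x y) x0 v" for v y
  proof -
    have "((\<lambda>x. Jx x *v y) has_derivative (\<lambda>v. DJ v *v y)) (at x0)"
      using bounded_bilinear.FDERIV[OF bounded_bilinear_matrix_vector_mult dJ has_derivative_const[of y]] by simp
    then have "((\<lambda>x. fderiv \<tau> x y) has_derivative (\<lambda>v. DJ v *v y)) (at x0)"
    proof (rule has_derivative_transform_within_open[OF _ S])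
      show "Jx x *v y = fderiv \<tau> x y" if "x \<in> S" for x
        unfolding Jx_def by (rule matrix_mult_has_derivative[OF smooth_on_has_fderiv[OF \<tau> that]])
    qed
    from fun_cong[OF fderiv_eqI[OF this]] show ?thesis by simp
  qed
  have DJ_sym: "DJ v *v y = DJ y *v v" for v y
    unfolding DJ by (rule second_derivative_symmetric[OF S \<tau>])
  have sX: "smooth_field A X" using X unfolding vector_field_def by blast
  have tX: "X d q = transition_jac c d q *v X c q" if "q \<in> dom_of c" "q \<in> dom_of d" for q
    using X c d that unfolding vector_field_def by blast
  define DXc where "DXc = chart_deriv c (X c) p"
  define DXd where "DXd = chart_deriv d (X d) p"
  have dXc: "has_chart_deriv c (X c) DXc p" unfolding DXc_def by (rule smooth_field_has_chart_deriv[OF sX c pc])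
  have dXd: "has_chart_deriv d (X d) DXd p" unfolding DXd_def by (rule smooth_field_has_chart_deriv[OF sX d pd])
  \<comment> \<open>The components of \<open>X\<close> in \<open>d\<close>, as functions of the
    coordinates of \<open>c\<close>, are differentiated twice over: by the chain rule here and as a
    Jacobian times components in \<open>2\<close>.\<close>
  have 1: "has_chart_deriv c (X d) (\<lambda>v. DXd (J *v v)) p"
    unfolding J_def by (rule has_chart_deriv_change[OF c d pc pd dXd])
  have "((\<lambda>x. Jx x *v X c (cinv c x)) has_derivative (\<lambda>v. Jx x0 *v DXc v + DJ v *v X c (cinv c x0))) (at x0)"
    by (rule bounded_bilinear.FDERIV[OF bounded_bilinear_matrix_vector_mult dJ dXc[folded x0_def]])
  then have 2: "has_chart_deriv c (X d) (\<lambda>v. J *v DXc v + DJ v *v X c p) p"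
    unfolding x0_def[symmetric]
  proof (rule has_derivative_transform_within_open[OF _ S, THEN has_derivative_eq_rhs])
    show "Jx x *v X c (cinv c x) = X d (cinv c x)" if "x \<in> S" for x
      using that c by (auto simp: S_def tX Jx cinv_coord)
    show "(\<lambda>v. Jx x0 *v DXc v + DJ v *v X c (cinv c x0)) = (\<lambda>v. J *v DXc v + DJ v *v X c p)"
      by (simp add: J_def Jx x0_def cinv_coord[OF c pc])
  qed
  \<comment> \<open>Symmetry moves \<open>v\<close> out of the direction of differentiation, so that
    the correction becomes the matrix \<open>DJ (X c p)\<close> applied to \<open>v\<close> and has
    a trace.\<close>
  have "DXd (J *v v) = J *v DXc v + DJ (X c p) *v v" for v
    using fun_cong[OF has_derivative_unique[OF 1 2], of v] DJ_sym[of v "X c p"] by simp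
  then have "matrix DXd ** J = J ** matrix DXc + DJ (X c p)"
    by (simp add: matrix_eq matrix_vector_mult_add_rdistrib matrix_mult_has_derivative[OF dXc] matrix_mult_has_derivative[OF dXd]
        flip: matrix_vector_mul_assoc)
  then have "matrix DXd ** J ** J' = J ** matrix DXc ** J' + DJ (X c p) ** J'"
    by (simp add: matrix_add_rdistrib)
  then have "matrix DXd = J ** matrix DXc ** J' + DJ (X c p) ** J'"
    by (simp add: JJ' flip: matrix_mul_assoc)
  then have "trace (matrix DXd) = trace (J ** matrix DXc ** J') + trace (J' ** DJ (X c p))"
    by (simp add: trace_add trace_mul_sym[of J'])
  also have "trace (J ** matrix DXc ** J') = trace (matrix DXc)"
    by (subst trace_mul_sym) (simp add: matrix_mul_assoc JJ')
  finally have tr: "trace (matrix DXd) = trace (matrix DXc) + trace (J' ** DJ (X c p))" .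
  have s\<phi>: "smooth_field A \<phi>" using \<phi> unfolding log_density_def by blast
  have "J' ** Jx x0 = mat 1" using JJ'(2) by (simp add: J_def Jx x0_def)
  note has_derivative_ln_abs_det[OF dJ this, unfolded x0_def]
  from has_derivative_add[OF has_chart_deriv_change[OF c d pc pd smooth_field_has_chart_deriv[OF s\<phi> d pd]] this]
  have "has_chart_deriv c (\<phi> c) (\<lambda>v. chart_deriv d (\<phi> d) p (transition_jac c d p *v v) + trace (J' ** DJ v)) p"
  proof (rule has_derivative_transform_within_open[OF _ S[unfolded x0_def]])
    show "\<phi> d (cinv c x) + ln \<bar>det (Jx x)\<bar> = \<phi> c (cinv c x)" if x: "x \<in> S" for x
    proof -
      obtain q where q: "q \<in> dom_of c \<inter> dom_of d" "x = coord c q" using x unfolding S_def by blast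
      have "\<phi> c q = \<phi> d q + ln \<bar>det (transition_jac c d q)\<bar>"
        using \<phi> c d q(1) unfolding log_density_def by blast
      then show ?thesis using q c by (simp add: Jx cinv_coord)
    qed
  qed
  then have "chart_deriv c (\<phi> c) p (X c p) = chart_deriv d (\<phi> d) p (X d p) + trace (J' ** DJ (X c p))"
    by (simp add: chart_deriv_eqI tX[OF pc pd])
  then show ?thesis using tr by (simp add: density_div_def DXc_def DXd_def)
qed

text \<open>In a chart a top form is \<open>det\<close> times a density: the derivative of the
  density contributes the logarithmic derivative, and the sum over the slots contributes the
  trace.\<close>

lemma lie_top_form_eq:
  assumes \<Omega>: "volume_form A \<Omega>" and X: "vector_field A X" and c: "c \<in> A" and p: "p \<in> dom_of c"
  shows "lie_top_form X \<Omega> c p V = density_div (log_volume \<Omega>) X c p * \<Omega> c p V"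
proof -
  define w where "w c p = \<Omega> c p (mat 1)" for c p
  have w: "w c p \<noteq> 0" unfolding w_def by (rule volume_form_det(2)[OF \<Omega> c p])
  have sw: "smooth_field A w" unfolding w_def using \<Omega> unfolding volume_form_def by blast
  have dw: "has_chart_deriv c (w c) (chart_deriv c (w c) p) p" by (rule smooth_field_has_chart_deriv[OF sw c p])
  have e: "cinv c (coord c p) = p" by (rule cinv_coord[OF c p])
  have "has_chart_deriv c (log_volume \<Omega> c) (\<lambda>v. chart_deriv c (w c) p v * inverse (w c p)) p"
    using has_derivative_compose[OF dw has_derivative_ln_abs] w by (simp add: e log_volume_def w_def)
  then have l: "chart_deriv c (log_volume \<Omega> c) p v = chart_deriv c (w c) p v * inverse (w c p)" for v
    by (simp add: chart_deriv_eqI)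
  have "has_chart_deriv c (\<lambda>q. \<Omega> c q V) (\<lambda>v. det V * chart_deriv c (w c) p v) p"
  proof (rule has_derivative_transform_within_open[OF has_derivative_mult_right[OF dw] chart_open(2)[OF c]])
    show "det V * w c (cinv c x) = \<Omega> c (cinv c x) V" if "x \<in> coord c ` dom_of c" for x
      unfolding w_def by (rule volume_form_det(1)[OF \<Omega> c cinv_in_dom[OF that], symmetric])
  qed (use p in blast)
  then have 1: "chart_deriv c (\<lambda>q. \<Omega> c q V) p (X c p) = det V * chart_deriv c (w c) p (X c p)"
    by (simp add: chart_deriv_eqI)
  have "smooth_field A X" using X unfolding vector_field_def by blast
  note dX = smooth_field_has_chart_deriv[OF this c p]
  have "alternating_multilinear (\<Omega> c p)" using \<Omega> c p unfolding volume_form_def by blast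
  from alternating_sum_row_eq_trace[OF this, of "matrix (chart_deriv c (X c) p)" V]
  have 2: "(\<Sum>i\<in>UNIV. \<Omega> c p (\<chi> j. if j = i then chart_deriv c (X c) p (V $ i) else V $ j))
      = trace (matrix (chart_deriv c (X c) p)) * \<Omega> c p V"
    unfolding matrix_mult_has_derivative[OF dX] .
  show ?thesis
    unfolding lie_top_form_def density_div_def 1 2 l volume_form_det(1)[OF \<Omega> c p, of V] w_def[symmetric]
    using w by (simp add: field_simps)
qed

text \<open>Existence in the definite description is \<open>lie_top_form_eq\<close> with chart
  invariance; uniqueness holds because a volume form is nonzero on the coordinate frame.\<close>

lemma divergence_eq:
  assumes \<Omega>: "volume_form A \<Omega>" and X: "vector_field A X" and c: "c \<in> A" and p: "p \<in> dom_of c"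
  shows "divergence A \<Omega> X p = density_div (log_volume \<Omega>) X c p"
proof -
  define u where "u p = density_div (log_volume \<Omega>) X (SOME c. c \<in> A \<and> p \<in> dom_of c) p" for p
  have u: "u p = density_div (log_volume \<Omega>) X c p" if "c \<in> A" "p \<in> dom_of c" for c p
  proof -
    define d where "d = (SOME c. c \<in> A \<and> p \<in> dom_of c)"
    have d: "d \<in> A \<and> p \<in> dom_of d"
      unfolding d_def by (rule someI[of "\<lambda>c. c \<in> A \<and> p \<in> dom_of c" c]) (use that in blast)
    then show ?thesis unfolding u_def d_def[symmetric]
      by (intro density_div_invariant[OF log_density_log_volume[OF \<Omega>] X]) (use that in blast)+
  qed
  have "divergence A \<Omega> X = u" unfolding divergence_def
  proof (rule the_equality)
    show "\<forall>c\<in>A. \<forall>p\<in>dom_of c. \<forall>V. lie_top_form X \<Omega> c p V = u p * \<Omega> c p V"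
      by (simp add: lie_top_form_eq[OF \<Omega> X] u)
    fix u' assume u': "\<forall>c\<in>A. \<forall>p\<in>dom_of c. \<forall>V. lie_top_form X \<Omega> c p V = u' p * \<Omega> c p V"
    show "u' = u"
    proof
      fix p obtain c where c: "c \<in> A" "p \<in> dom_of c" using ex_chart by blast
      have "lie_top_form X \<Omega> c p (mat 1) = u' p * \<Omega> c p (mat 1)" using u' c by blast
      then have "u' p * \<Omega> c p (mat 1) = u p * \<Omega> c p (mat 1)"
        by (simp only: lie_top_form_eq[OF \<Omega> X c] u[OF c])
      then show "u' p = u p" using volume_form_det(2)[OF \<Omega> c] by simp
    qed
  qed
  then show ?thesis using u[OF c p] by simp
qed

lemma bivector_antisym:
  assumes "bivector_field A P" "c \<in> A" "p \<in> dom_of c"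
  shows "P c p $ j $ i = - P c p $ i $ j"
proof -
  have "transpose (P c p) = - P c p" using assms unfolding bivector_field_def by blast
  from arg_cong[where f="\<lambda>M. M $ i $ j", OF this] show ?thesis
    by (simp add: Finite_Cartesian_Product.transpose_def)
qed

section \<open>Hamiltonian and modular fields as global vector fields\<close>

lemma hamiltonian_cinv:
  assumes "c \<in> A" "x \<in> coord c ` dom_of c"
  shows "hamiltonian A P f c (cinv c x) = transpose (P c (cinv c x)) *v
     (\<chi> i. fderiv (\<lambda>x. f (cinv c x)) x (axis i 1))"
  using assms by (simp add: hamiltonian_def sharp_def differential_def chart_deriv_fderiv cinv_in_dom coord_cinv)

lemma vector_field_hamiltonian:
  assumes P: "bivector_field A P" and f: "smooth_fun A f"
  shows "vector_field A (hamiltonian A P f)"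
  unfolding vector_field_def
proof (intro conjI ballI allI impI)
  show "smooth_field A (hamiltonian A P f)" unfolding smooth_field_def o_def
  proof
    fix c assume c: "c \<in> A"
    have sP: "smooth_on (coord c ` dom_of c) (\<lambda>x. P c (cinv c x))"
      by (rule smooth_fieldD[OF _ c]) (use P in \<open>simp add: bivector_field_def\<close>)
    note o = chart_open(2)[OF c]
    have "smooth_on (coord c ` dom_of c) (\<lambda>x. transpose (P c (cinv c x)) *v
         (\<chi> i. fderiv (\<lambda>x. f (cinv c x)) x (axis i 1)))"
      by (rule smooth_on_bilinear[OF o bounded_bilinear_matrix_vector_mult
              smooth_on_compose_bounded_linear[OF o bounded_linear_transpose sP]])
        (rule smooth_on_vecI[OF o], unfold vec_lambda_beta, rule smooth_on_fderiv[OF smooth_funD[OF f c]])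
    then show "smooth_on (coord c ` dom_of c) (\<lambda>x. hamiltonian A P f c (cinv c x))"
      by (rule smooth_on_cong[OF o, rotated]) (rule hamiltonian_cinv[OF c, symmetric])
  qed
  fix c d p assume c: "c \<in> A" and d: "d \<in> A" and "p \<in> dom_of c \<inter> dom_of d"
  then have p: "p \<in> dom_of c" "p \<in> dom_of d" by auto
  have "P d p = transition_jac c d p ** P c p ** transpose (transition_jac c d p)"
    using P c d p unfolding bivector_field_def by blast
  then show "hamiltonian A P f d p = transition_jac c d p *v hamiltonian A P f c p"
    using c d p by (simp add: hamiltonian_def sharp_def differential_change[OF c d p f] matrix_transpose_mul
        matrix_vector_mul_assoc matrix_mul_assoc del: transpose_matrix_vector)
qed (auto simp: hamiltonian_def)

text \<open>Taken for an arbitrary logarithmic density, so that corrections by functions apply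
  directly without returning to volume forms. The value \<open>0\<close> off the chart domains is
  what \<open>vector_field\<close> prescribes.\<close>

definition modular_field :: "('m, 'n, real ^ 'n ^ 'n) field \<Rightarrow> ('m, 'n, real) field \<Rightarrow> ('m, 'n, real ^ 'n) field" where
  "modular_field P \<phi> c p = (if c \<in> A \<and> p \<in> dom_of c
     then local_modular_field (\<lambda>x. P c (cinv c x)) (\<lambda>x. \<phi> c (cinv c x)) (coord c p) else 0)"

lemma density_div_hamiltonian:
  assumes P: "bivector_field A P" and \<phi>: "log_density \<phi>" and f: "smooth_fun A f"
    and c: "c \<in> A" and p: "p \<in> dom_of c"
  shows "density_div \<phi> (hamiltonian A P f) c p = modular_field P \<phi> c p \<bullet> differential f c p"
proof -
  note o = chart_open(2)[OF c]
  have x: "coord c p \<in> coord c ` dom_of c" using p by blast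
  have sP: "smooth_on (coord c ` dom_of c) (\<lambda>x. P c (cinv c x))"
    by (rule smooth_fieldD[OF _ c]) (use P in \<open>simp add: bivector_field_def\<close>)
  have s\<phi>: "smooth_on (coord c ` dom_of c) (\<lambda>x. \<phi> c (cinv c x))"
    by (rule smooth_fieldD[OF _ c]) (use \<phi> in \<open>simp add: log_density_def\<close>)
  have "chart_deriv c (hamiltonian A P f c) p
     = fderiv (\<lambda>x. transpose (P c (cinv c x)) *v (\<chi> i. fderiv (\<lambda>x. f (cinv c x)) x (axis i 1))) (coord c p)"
    unfolding chart_deriv_fderiv by (rule fderiv_cong_open[OF o x hamiltonian_cinv[OF c]])
  moreover have "hamiltonian A P f c p = transpose (P c p) *v
     (\<chi> i. fderiv (\<lambda>x. f (cinv c x)) (coord c p) (axis i 1))"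
    using hamiltonian_cinv[OF c x] by (simp add: cinv_coord[OF c p])
  moreover have "differential f c p = (\<chi> i. fderiv (\<lambda>x. f (cinv c x)) (coord c p) (axis i 1))"
    by (simp add: differential_def chart_deriv_fderiv)
  ultimately show ?thesis
    using trace_hamiltonian[OF o x sP s\<phi> smooth_funD[OF f c] bivector_antisym[OF P c cinv_in_dom]] c p
    by (simp add: density_div_def modular_field_def chart_deriv_fderiv[of c "\<phi> c"] cinv_coord)
qed

lemma vector_field_modular_field:
  assumes P: "bivector_field A P" and \<phi>: "log_density \<phi>"
  shows "vector_field A (modular_field P \<phi>)"
  unfolding vector_field_def
proof (intro conjI ballI allI impI)
  show "smooth_field A (modular_field P \<phi>)" unfolding smooth_field_def o_def
  proof
    fix c assume c: "c \<in> A"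
    have sP: "smooth_on (coord c ` dom_of c) (\<lambda>x. P c (cinv c x))"
      by (rule smooth_fieldD[OF _ c]) (use P in \<open>simp add: bivector_field_def\<close>)
    have s\<phi>: "smooth_on (coord c ` dom_of c) (\<lambda>x. \<phi> c (cinv c x))"
      by (rule smooth_fieldD[OF _ c]) (use \<phi> in \<open>simp add: log_density_def\<close>)
    show "smooth_on (coord c ` dom_of c) (\<lambda>x. modular_field P \<phi> c (cinv c x))"
      by (rule smooth_on_cong[OF chart_open(2)[OF c] _ smooth_on_local_modular_field[OF chart_open(2)[OF c] sP s\<phi>]])
        (simp add: modular_field_def c cinv_in_dom coord_cinv)
  qed
  fix c d p assume c: "c \<in> A" and d: "d \<in> A" and "p \<in> dom_of c \<inter> dom_of d"
  then have p: "p \<in> dom_of c" "p \<in> dom_of d" by auto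
  define J where "J = transition_jac c d p"
  \<comment> \<open>Every covector \<open>u\<close> is a differential, and the pairing with it is a
    divergence, already known to be independent of the chart.\<close>
  have "modular_field P \<phi> d p \<bullet> u = (J *v modular_field P \<phi> c p) \<bullet> u" for u
  proof -
    obtain f where f: "smooth_fun A f" "differential f d p = u" by (rule ex_smooth_fun_differential[OF d p(2)])
    have "modular_field P \<phi> d p \<bullet> u = density_div \<phi> (hamiltonian A P f) d p"
      by (simp add: density_div_hamiltonian[OF P \<phi> f(1) d p(2)] f(2))
    also have "\<dots> = density_div \<phi> (hamiltonian A P f) c p"
      by (rule density_div_invariant[OF \<phi> vector_field_hamiltonian[OF P f(1)] d c p(2,1)])
    also have "\<dots> = modular_field P \<phi> c p \<bullet> (transpose J *v u)"
      by (simp add: density_div_hamiltonian[OF P \<phi> f(1) c p(1)] differential_change[OF c d p f(1)] f(2) J_def)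
    also have "\<dots> = (J *v modular_field P \<phi> c p) \<bullet> u"
      by (metis dot_lmul_matrix transpose_matrix_vector transpose_transpose)
    finally show ?thesis .
  qed
  then show "modular_field P \<phi> d p = transition_jac c d p *v modular_field P \<phi> c p"
    unfolding J_def by (metis vector_eq_rdot)
qed (auto simp: modular_field_def)

lemma vf_app_eq:
  assumes Z: "vector_field A Z" and f: "smooth_fun A f" and c: "c \<in> A" and p: "p \<in> dom_of c"
  shows "vf_app A Z f p = Z c p \<bullet> differential f c p"
proof -
  define d where "d = (SOME d. d \<in> A \<and> p \<in> dom_of d)"
  have d: "d \<in> A" "p \<in> dom_of d"
    unfolding d_def using someI[of "\<lambda>d. d \<in> A \<and> p \<in> dom_of d" c] c p by blast+
  have "vf_app A Z f p = differential f d p \<bullet> Z d p"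
    unfolding vf_app_def Let_def d_def[symmetric] by (rule chart_deriv_differential[OF d f])
  also have "\<dots> = (transpose (transition_jac c d p) *v differential f d p) \<bullet> Z c p"
  proof -
    have "Z d p = transition_jac c d p *v Z c p" using Z c d p unfolding vector_field_def by blast
    then show ?thesis by (simp only: dot_lmul_matrix[symmetric] transpose_matrix_vector)
  qed
  finally show ?thesis by (simp add: differential_change[OF c d(1) p d(2) f] inner_commute)
qed

text \<open>For uniqueness, two fields acting equally on smooth functions have equal pairings with
  all covectors on the chart domains, and both are \<open>0\<close> elsewhere.\<close>

lemma modular_vector_field_eq:
  assumes P: "bivector_field A P" and \<Omega>: "volume_form A \<Omega>"
  shows "modular_vector_field A P \<Omega> = modular_field P (log_volume \<Omega>)"
proof -
  note \<phi> = log_density_log_volume[OF \<Omega>]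
  let ?Z = "modular_field P (log_volume \<Omega>)"
  have Z: "vector_field A ?Z" by (rule vector_field_modular_field[OF P \<phi>])
  have app: "vf_app A ?Z f = divergence A \<Omega> (hamiltonian A P f)" if f: "smooth_fun A f" for f
  proof
    fix p obtain c where c: "c \<in> A" "p \<in> dom_of c" using ex_chart by blast
    show "vf_app A ?Z f p = divergence A \<Omega> (hamiltonian A P f) p"
      unfolding vf_app_eq[OF Z f c] divergence_eq[OF \<Omega> vector_field_hamiltonian[OF P f] c]
      by (rule density_div_hamiltonian[OF P \<phi> f c, symmetric])
  qed
  show ?thesis unfolding modular_vector_field_def
  proof (rule the_equality)
    show "vector_field A ?Z \<and> (\<forall>f. smooth_fun A f \<longrightarrow> vf_app A ?Z f = divergence A \<Omega> (hamiltonian A P f))"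
      using Z app by blast
    fix Y assume Y: "vector_field A Y \<and> (\<forall>f. smooth_fun A f \<longrightarrow> vf_app A Y f = divergence A \<Omega> (hamiltonian A P f))"
    show "Y = ?Z"
    proof (intro ext)
      fix c p
      show "Y c p = ?Z c p"
      proof (cases "c \<in> A \<and> p \<in> dom_of c")
        case True
        have "Y c p \<bullet> u = ?Z c p \<bullet> u" for u
        proof -
          obtain f where f: "smooth_fun A f" "differential f c p = u"
            using ex_smooth_fun_differential[of c p u] True by blast
          have vY: "vector_field A Y" and cA: "c \<in> A" and pc: "p \<in> dom_of c" using Y True by blast+
          have "vf_app A Y f p = vf_app A ?Z f p" using Y app f(1) by simp
          then show ?thesis unfolding vf_app_eq[OF vY f(1) cA pc] vf_app_eq[OF Z f(1) cA pc] f(2) .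
        qed
        then show ?thesis using vector_eq_rdot by blast
      next
        case False
        then show ?thesis using Y Z unfolding vector_field_def by metis
      qed
    qed
  qed
qed

end

section \<open>The modular class\<close>

context manifold
begin

lemma bivector_smooth: "bivector_field A P \<Longrightarrow> smooth_field A P"
  unfolding bivector_field_def by blast

lemma poisson_bivector_field: "poisson_bivector A P \<Longrightarrow> bivector_field A P"
  unfolding poisson_bivector_def by blast

lemma poisson_jacobi:
  assumes "poisson_bivector A P" "c \<in> A" "p \<in> dom_of c"
  shows "(\<Sum>l\<in>UNIV. P c p $ l $ i * fderiv (\<lambda>x. P c (cinv c x)) (coord c p) (axis l 1) $ j $ k
        + P c p $ l $ j * fderiv (\<lambda>x. P c (cinv c x)) (coord c p) (axis l 1) $ k $ i
        + P c p $ l $ k * fderiv (\<lambda>x. P c (cinv c x)) (coord c p) (axis l 1) $ i $ j) = 0"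
  using assms unfolding poisson_bivector_def chart_deriv_fderiv by blast

lemma modular_field_poisson:
  assumes P: "poisson_bivector A P" and \<phi>: "log_density \<phi>"
  shows "modular_field P \<phi> \<in> poisson_vector_fields A P"
  unfolding poisson_vector_fields_def
proof (intro CollectI conjI ballI)
  note b = poisson_bivector_field[OF P]
  show "vector_field A (modular_field P \<phi>)" by (rule vector_field_modular_field[OF b \<phi>])
  fix c p assume c: "c \<in> A" and p: "p \<in> dom_of c"
  note o = chart_open(2)[OF c]
  have x: "coord c p \<in> coord c ` dom_of c" using p by blast
  have e: "cinv c (coord c p) = p" by (rule cinv_coord[OF c p])
  let ?z = "local_modular_field (\<lambda>x. P c (cinv c x)) (\<lambda>x. \<phi> c (cinv c x))"
  have sP: "smooth_on (coord c ` dom_of c) (\<lambda>x. P c (cinv c x))"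
    by (rule smooth_fieldD[OF bivector_smooth[OF b] c])
  have s\<phi>: "smooth_on (coord c ` dom_of c) (\<lambda>x. \<phi> c (cinv c x))"
    by (rule smooth_fieldD[OF _ c]) (use \<phi> in \<open>simp add: log_density_def\<close>)
  have z: "modular_field P \<phi> c (cinv c x) = ?z x" if "x \<in> coord c ` dom_of c" for x
    using that c by (simp add: modular_field_def cinv_in_dom coord_cinv)
  have "chart_deriv c (modular_field P \<phi> c) p = fderiv ?z (coord c p)"
    unfolding chart_deriv_fderiv by (rule fderiv_cong_open[OF o x z])
  moreover have "modular_field P \<phi> c p = ?z (coord c p)" using z[OF x] by (simp add: e)
  moreover have "fderiv (\<lambda>x. P c (cinv c x)) (coord c p) (?z (coord c p))
      - matrix (fderiv ?z (coord c p)) ** P c (cinv c (coord c p))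
      - P c (cinv c (coord c p)) ** transpose (matrix (fderiv ?z (coord c p))) = 0"
  proof (rule local_modular_field_poisson[OF o x sP s\<phi>])
    fix x assume x: "x \<in> coord c ` dom_of c"
    show "P c (cinv c x) $ j $ i = - P c (cinv c x) $ i $ j" for i j
      by (rule bivector_antisym[OF b c cinv_in_dom[OF x]])
    show "(\<Sum>l\<in>UNIV. P c (cinv c x) $ l $ i * fderiv (\<lambda>x. P c (cinv c x)) x (axis l 1) $ j $ k
        + P c (cinv c x) $ l $ j * fderiv (\<lambda>x. P c (cinv c x)) x (axis l 1) $ k $ i
        + P c (cinv c x) $ l $ k * fderiv (\<lambda>x. P c (cinv c x)) x (axis l 1) $ i $ j) = 0" for i j k
      using poisson_jacobi[OF P c cinv_in_dom[OF x]] unfolding coord_cinv[OF x] .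
  qed
  ultimately show "lie_bivector (modular_field P \<phi>) P c p = 0"
    by (simp add: lie_bivector_def chart_deriv_fderiv[of c "P c"] e)
qed

section \<open>The cohomology relation\<close>

lemma smooth_fun_add: "smooth_fun A f \<Longrightarrow> smooth_fun A g \<Longrightarrow> smooth_fun A (\<lambda>q. f q + g q)"
  for f g :: "'m \<Rightarrow> real"
  unfolding smooth_fun_def o_def by (intro ballI smooth_on_add chart_open) blast+

lemma smooth_fun_minus: "smooth_fun A f \<Longrightarrow> smooth_fun A (\<lambda>q. - f q)"
  for f :: "'m \<Rightarrow> real"
  unfolding smooth_fun_def o_def by (intro ballI smooth_on_minus chart_open) blast+

lemma smooth_fun_has_chart_deriv:
  "smooth_fun A f \<Longrightarrow> c \<in> A \<Longrightarrow> p \<in> dom_of c \<Longrightarrow> has_chart_deriv c f (chart_deriv c f p) p"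
  by (rule smooth_has_chart_deriv) (auto simp: smooth_fun_def)

lemma hamiltonian_add:
  assumes f: "smooth_fun A f" and g: "smooth_fun A g"
  shows "hamiltonian A P (\<lambda>q. f q + g q) c p = hamiltonian A P f c p + hamiltonian A P g c p"
proof (cases "c \<in> A \<and> p \<in> dom_of c")
  case True
  then have c: "c \<in> A" "p \<in> dom_of c" by auto
  have "differential (\<lambda>q. f q + g q) c p = differential f c p + differential g c p"
    unfolding differential_def
      chart_deriv_eqI[OF has_derivative_add[OF smooth_fun_has_chart_deriv[OF f c] smooth_fun_has_chart_deriv[OF g c]]]
    by (simp add: vec_eq_iff)
  then show ?thesis using c by (simp add: hamiltonian_def matrix_vector_right_distrib)
qed (auto simp: hamiltonian_def)

lemma hamiltonian_minus:
  assumes f: "smooth_fun A f"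
  shows "hamiltonian A P (\<lambda>q. - f q) c p = - hamiltonian A P f c p"
proof (cases "c \<in> A \<and> p \<in> dom_of c")
  case True
  then have c: "c \<in> A" "p \<in> dom_of c" by auto
  have "differential (\<lambda>q. - f q) c p = - differential f c p"
    unfolding differential_def
      chart_deriv_eqI[OF has_derivative_minus[OF smooth_fun_has_chart_deriv[OF f c]]]
    by (simp add: vec_eq_iff)
  then show ?thesis using c
    by (simp add: hamiltonian_def vec_eq_iff matrix_vector_mult_def sum_negf)
qed (auto simp: hamiltonian_def)

lemma smooth_fun_zero: "smooth_fun A (\<lambda>q. 0 :: real)"
  unfolding smooth_fun_def o_def by simp

lemma hamiltonian_zero: "hamiltonian A P (\<lambda>q. 0) c p = 0"
  using hamiltonian_add[OF smooth_fun_zero smooth_fun_zero, of P c p] by simp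

lemma equiv_cohomologous: "equiv (poisson_vector_fields A P) (cohomologous A P)"
proof -
  have "refl_on (poisson_vector_fields A P) (cohomologous A P)"
    unfolding refl_on_def cohomologous_def
    using smooth_fun_zero hamiltonian_zero by auto
  moreover have "sym (cohomologous A P)"
  proof (rule symI)
    fix X Y assume "(X, Y) \<in> cohomologous A P"
    then obtain f where XY: "X \<in> poisson_vector_fields A P" "Y \<in> poisson_vector_fields A P"
      and f: "smooth_fun A f" "\<And>c p. X c p - Y c p = hamiltonian A P f c p"
      unfolding cohomologous_def by blast
    have "Y c p - X c p = hamiltonian A P (\<lambda>q. - f q) c p" for c p
      by (simp add: hamiltonian_minus[OF f(1)] flip: f(2))
    then show "(Y, X) \<in> cohomologous A P"
      using XY smooth_fun_minus[OF f(1)] unfolding cohomologous_def by blast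
  qed
  moreover have "trans (cohomologous A P)"
  proof (rule transI)
    fix X Y Z assume "(X, Y) \<in> cohomologous A P" "(Y, Z) \<in> cohomologous A P"
    then obtain f g where XZ: "X \<in> poisson_vector_fields A P" "Z \<in> poisson_vector_fields A P"
      and f: "smooth_fun A f" "\<And>c p. X c p - Y c p = hamiltonian A P f c p"
      and g: "smooth_fun A g" "\<And>c p. Y c p - Z c p = hamiltonian A P g c p"
      unfolding cohomologous_def by blast
    have "X c p - Z c p = hamiltonian A P (\<lambda>q. f q + g q) c p" for c p
      by (simp add: hamiltonian_add[OF f(1) g(1)] flip: f(2) g(2))
    then show "(X, Z) \<in> cohomologous A P"
      using XZ smooth_fun_add[OF f(1) g(1)] unfolding cohomologous_def by blast
  qed
  ultimately show ?thesis by (auto intro!: equivI simp: cohomologous_def)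
qed

lemma zero_poisson_vector_field: "(\<lambda>c p. 0) \<in> poisson_vector_fields A P" if P: "bivector_field A P"
  unfolding poisson_vector_fields_def
proof (intro CollectI conjI ballI)
  show "vector_field A (\<lambda>c p. 0)"
    by (simp add: vector_field_def smooth_field_def o_def)
  fix c p assume c: "c \<in> A" "p \<in> dom_of c"
  have "chart_deriv c (P c) p 0 = 0"
    by (rule linear_0[OF has_derivative_linear[OF smooth_field_has_chart_deriv[OF bivector_smooth[OF P] c]]])
  moreover have "chart_deriv c (\<lambda>p. 0 :: real ^ 'n) p = (\<lambda>v. 0)"
    by (rule chart_deriv_eqI) (rule has_derivative_const)
  moreover have "matrix (\<lambda>v :: real ^ 'n. 0 :: real ^ 'n) = 0" by (simp add: matrix_def vec_eq_iff)
  ultimately show "lie_bivector (\<lambda>c p. 0) P c p = 0"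
    by (simp add: lie_bivector_def) (simp add: vec_eq_iff matrix_matrix_mult_def Finite_Cartesian_Product.transpose_def)
qed

lemma log_density_add:
  assumes "log_density \<phi>" "smooth_fun A f"
  shows "log_density (\<lambda>c q. \<phi> c q + f q)"
  unfolding log_density_def
proof (intro conjI ballI)
  have "smooth_field A \<phi>" using assms(1) unfolding log_density_def by blast
  then show "smooth_field A (\<lambda>c q. \<phi> c q + f q)"
    using assms(2) unfolding smooth_field_def smooth_fun_def o_def
    by (intro ballI smooth_on_add chart_open) blast+
  show "\<phi> c p + f p = \<phi> d p + f p + ln \<bar>det (transition_jac c d p)\<bar>"
    if "c \<in> A" "d \<in> A" "p \<in> dom_of c \<inter> dom_of d" for c d p
  proof -
    have "\<phi> c p = \<phi> d p + ln \<bar>det (transition_jac c d p)\<bar>"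
      using assms(1) that unfolding log_density_def by blast
    then show ?thesis by simp
  qed
qed

lemma modular_field_nth:
  assumes "c \<in> A" "p \<in> dom_of c"
  shows "modular_field P \<phi> c p $ i = (\<Sum>j\<in>UNIV. chart_deriv c (P c) p (axis j 1) $ i $ j)
     + (\<Sum>j\<in>UNIV. P c p $ i $ j * chart_deriv c (\<phi> c) p (axis j 1))"
  using assms by (simp add: modular_field_def local_modular_field_def chart_deriv_fderiv cinv_coord)

lemma chart_deriv_log_density_add:
  assumes "log_density \<phi>" "smooth_fun A f" "c \<in> A" "p \<in> dom_of c"
  shows "chart_deriv c (\<lambda>q. \<phi> c q + f q) p v = chart_deriv c (\<phi> c) p v + chart_deriv c f p v"
proof -
  have "smooth_field A \<phi>" using assms(1) unfolding log_density_def by blast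
  from chart_deriv_eqI[OF has_derivative_add[OF smooth_field_has_chart_deriv[OF this assms(3,4)]
        smooth_fun_has_chart_deriv[OF assms(2-4)]]]
  show ?thesis by simp
qed

text \<open>The minus sign arises because \<open>sharp\<close> is the transpose of an antisymmetric
  matrix, whereas \<open>modular_field\<close> multiplies by that matrix itself.\<close>

lemma modular_field_add:
  assumes P: "bivector_field A P" and \<phi>: "log_density \<phi>" and f: "smooth_fun A f"
  shows "modular_field P (\<lambda>c q. \<phi> c q + f q) c p = modular_field P \<phi> c p - hamiltonian A P f c p"
proof (cases "c \<in> A \<and> p \<in> dom_of c")
  case True
  then have c: "c \<in> A" "p \<in> dom_of c" by auto
  have "hamiltonian A P f c p $ i = - (\<Sum>j\<in>UNIV. P c p $ i $ j * chart_deriv c f p (axis j 1))" for i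
  proof -
    have "hamiltonian A P f c p $ i = (\<Sum>j\<in>UNIV. P c p $ j $ i * chart_deriv c f p (axis j 1))"
      using c unfolding hamiltonian_def sharp_def differential_def Finite_Cartesian_Product.transpose_def
        matrix_vector_mult_def by simp
    then show ?thesis unfolding sum_negf[symmetric] bivector_antisym[OF P c, of _ i] by simp
  qed
  then show ?thesis
    by (simp add: vec_eq_iff modular_field_nth[OF c] chart_deriv_log_density_add[OF \<phi> f c] distrib_left sum.distrib)
qed (auto simp: modular_field_def hamiltonian_def)

text \<open>Independence of the volume form: two volume forms differ by a nowhere vanishing factor,
  and the logarithm of its absolute value is the Hamiltonian relating the two modular
  fields.\<close>

lemma modular_class_eq:
  assumes P: "poisson_bivector A P" and \<Omega>: "volume_form A \<Omega>"
  shows "modular_class A P = H1_class A P (modular_field P (log_volume \<Omega>))"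
  unfolding modular_class_def
proof (rule the_equality)
  note b = poisson_bivector_field[OF P]
  note in_poisson = modular_field_poisson[OF P log_density_log_volume]
  show "H1_class A P (modular_field P (log_volume \<Omega>)) \<in> H1 A P \<and>
    (\<exists>\<Omega>'. volume_form A \<Omega>' \<and>
      H1_class A P (modular_field P (log_volume \<Omega>)) = H1_class A P (modular_vector_field A P \<Omega>'))"
  proof
    show "H1_class A P (modular_field P (log_volume \<Omega>)) \<in> H1 A P"
      unfolding H1_class_def H1_def by (rule quotientI[OF in_poisson[OF \<Omega>]])
    show "\<exists>\<Omega>'. volume_form A \<Omega>' \<and>
      H1_class A P (modular_field P (log_volume \<Omega>)) = H1_class A P (modular_vector_field A P \<Omega>')"
      using \<Omega> modular_vector_field_eq[OF b \<Omega>] by metis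
  qed
  fix \<gamma> assume "\<gamma> \<in> H1 A P \<and> (\<exists>\<Omega>'. volume_form A \<Omega>' \<and> \<gamma> = H1_class A P (modular_vector_field A P \<Omega>'))"
  then obtain \<Omega>' where \<Omega>': "volume_form A \<Omega>'" and \<gamma>: "\<gamma> = H1_class A P (modular_field P (log_volume \<Omega>'))"
    using modular_vector_field_eq[OF b] by metis
  note \<phi> = log_density_log_volume[OF \<Omega>] and \<phi>' = log_density_log_volume[OF \<Omega>']
  \<comment> \<open>The Jacobian terms in the two transformation laws cancel, so the difference is
    independent of the chart and smooth.\<close>
  define f where "f p = (let c = SOME c. c \<in> A \<and> p \<in> dom_of c in log_volume \<Omega> c p - log_volume \<Omega>' c p)" for p
  have f_eq: "f p = log_volume \<Omega> c p - log_volume \<Omega>' c p" if c: "c \<in> A" "p \<in> dom_of c" for c p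
  proof -
    define d where "d = (SOME c. c \<in> A \<and> p \<in> dom_of c)"
    have d: "d \<in> A \<and> p \<in> dom_of d"
      unfolding d_def by (rule someI[of "\<lambda>c. c \<in> A \<and> p \<in> dom_of c" c]) (use c in blast)
    have "log_volume \<Omega> c p = log_volume \<Omega> d p + ln \<bar>det (transition_jac c d p)\<bar>"
      "log_volume \<Omega>' c p = log_volume \<Omega>' d p + ln \<bar>det (transition_jac c d p)\<bar>"
      using \<phi> \<phi>' c d unfolding log_density_def by blast+
    then show ?thesis by (simp add: f_def Let_def flip: d_def)
  qed
  have f: "smooth_fun A f" unfolding smooth_fun_def o_def
  proof
    fix c assume c: "c \<in> A"
    note o = chart_open(2)[OF c]
    have "smooth_on (coord c ` dom_of c) (\<lambda>x. log_volume \<Omega> c (cinv c x) - log_volume \<Omega>' c (cinv c x))"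
      by (rule smooth_on_diff[OF o smooth_fieldD[OF _ c] smooth_fieldD[OF _ c]])
        (use \<phi> \<phi>' in \<open>simp_all add: log_density_def\<close>)
    then show "smooth_on (coord c ` dom_of c) (\<lambda>x. f (cinv c x))"
      by (rule smooth_on_cong[OF o, rotated]) (rule f_eq[OF c cinv_in_dom, symmetric])
  qed
  have "modular_field P (log_volume \<Omega>) c p = modular_field P (\<lambda>c q. log_volume \<Omega>' c q + f q) c p" for c p
  proof (cases "c \<in> A \<and> p \<in> dom_of c")
    case True
    then have c: "c \<in> A" "p \<in> dom_of c" by auto
    have "chart_deriv c (log_volume \<Omega> c) p = chart_deriv c (\<lambda>q. log_volume \<Omega>' c q + f q) p"
      unfolding chart_deriv_fderiv
      by (rule fderiv_cong_open[OF chart_open(2)[OF c(1)]]) (use c in \<open>auto simp: f_eq cinv_coord\<close>)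
    then show ?thesis by (simp add: vec_eq_iff modular_field_nth[OF c])
  qed (auto simp: modular_field_def)
  then have "modular_field P (log_volume \<Omega>') c p - modular_field P (log_volume \<Omega>) c p = hamiltonian A P f c p" for c p
    by (simp add: modular_field_add[OF b \<phi>' f])
  then have "(modular_field P (log_volume \<Omega>'), modular_field P (log_volume \<Omega>)) \<in> cohomologous A P"
    unfolding cohomologous_def using in_poisson[OF \<Omega>] in_poisson[OF \<Omega>'] f by blast
  then show "\<gamma> = H1_class A P (modular_field P (log_volume \<Omega>))"
    unfolding \<gamma> H1_class_def by (rule equiv_class_eq[OF equiv_cohomologous])
qed

text \<open>Replaces the class by the existence of a function for which a modular field vanishes.
  This criterion can be compared between two Poisson structures, whose cohomologies are unrelated as
  sets.\<close>

lemma modular_class_eq_zero_iff: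
  assumes P: "poisson_bivector A P" and \<Omega>: "volume_form A \<Omega>"
  shows "modular_class A P = H1_zero A P \<longleftrightarrow>
    (\<exists>f. smooth_fun A f \<and> (\<forall>c p. modular_field P (\<lambda>c q. log_volume \<Omega> c q + f q) c p = 0))"
proof -
  note b = poisson_bivector_field[OF P] and \<phi> = log_density_log_volume[OF \<Omega>]
  have "modular_class A P = H1_zero A P \<longleftrightarrow>
      (modular_field P (log_volume \<Omega>), \<lambda>c p. 0) \<in> cohomologous A P"
    unfolding modular_class_eq[OF P \<Omega>] H1_zero_def H1_class_def
    by (rule eq_equiv_class_iff[OF equiv_cohomologous modular_field_poisson[OF P \<phi>] zero_poisson_vector_field[OF b]])
  also have "\<dots> \<longleftrightarrow> (\<exists>f. smooth_fun A f \<and> (\<forall>c p. modular_field P (log_volume \<Omega>) c p - 0 = hamiltonian A P f c p))"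
    unfolding cohomologous_def using modular_field_poisson[OF P \<phi>] zero_poisson_vector_field[OF b] by blast
  also have "\<dots> \<longleftrightarrow> (\<exists>f. smooth_fun A f \<and> (\<forall>c p. modular_field P (\<lambda>c q. log_volume \<Omega> c q + f q) c p = 0))"
  proof (rule ex_cong1, rule conj_cong[OF refl])
    fix f :: "'m \<Rightarrow> real" assume "smooth_fun A f"
    then show "(\<forall>c p. modular_field P (log_volume \<Omega>) c p - 0 = hamiltonian A P f c p) \<longleftrightarrow>
       (\<forall>c p. modular_field P (\<lambda>c q. log_volume \<Omega> c q + f q) c p = 0)"
      by (simp add: modular_field_add[OF b \<phi>])
  qed
  finally show ?thesis .
qed

section \<open>Gauge transformations\<close>

text \<open>Gauge equivalence without \<open>sharp\<close> and \<open>flat\<close>. Both are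
  transposes of antisymmetric matrices: their signs cancel in the product and occur on both sides of
  the formula for \<open>Q\<close>. A one-sided inverse suffices for square matrices.\<close>

definition gauge_by ::
  "('m, 'n, real ^ 'n ^ 'n) field \<Rightarrow> ('m, 'n, real ^ 'n ^ 'n) field \<Rightarrow> ('m, 'n, real ^ 'n ^ 'n) field \<Rightarrow> bool" where
  "gauge_by B P Q \<longleftrightarrow> closed_two_form A B \<and>
     (\<forall>c\<in>A. \<forall>p\<in>dom_of c. \<exists>N. (mat 1 - B c p ** P c p) ** N = mat 1 \<and> Q c p = P c p ** N)"

lemma two_form_antisym:
  assumes "two_form A B" "c \<in> A" "p \<in> dom_of c"
  shows "B c p $ j $ i = - B c p $ i $ j"
proof -
  have "transpose (B c p) = - B c p" using assms unfolding two_form_def by blast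
  from arg_cong[where f="\<lambda>M. M $ i $ j", OF this] show ?thesis
    by (simp add: Finite_Cartesian_Product.transpose_def)
qed

lemma gauge_equivalent_imp_gauge_by:
  assumes P: "bivector_field A P" and Q: "bivector_field A Q" and "gauge_equivalent A P Q"
  shows "\<exists>B. gauge_by B P Q"
proof -
  obtain B where B: "closed_two_form A B" and g: "\<And>c p. c \<in> A \<Longrightarrow> p \<in> dom_of c \<Longrightarrow>
       invertible (mat 1 - flat (B c p) ** sharp (P c p)) \<and>
       sharp (Q c p) = sharp (P c p) ** matrix_inv (mat 1 - flat (B c p) ** sharp (P c p))"
    using assms(3) unfolding gauge_equivalent_def by blast
  have "\<exists>N. (mat 1 - B c p ** P c p) ** N = mat 1 \<and> Q c p = P c p ** N" if c: "c \<in> A" "p \<in> dom_of c" for c p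
  proof -
    have "sharp (P c p) = - P c p" using P c unfolding bivector_field_def sharp_def by blast
    moreover have "sharp (Q c p) = - Q c p" using Q c unfolding bivector_field_def sharp_def by blast
    moreover have "flat (B c p) = - B c p"
      using B c unfolding closed_two_form_def two_form_def flat_def by blast
    ultimately have i: "invertible (mat 1 - B c p ** P c p)"
      and q: "Q c p = P c p ** matrix_inv (mat 1 - B c p ** P c p)"
      using g[OF c] by (simp_all add: matrix_minus_left matrix_minus_right)
    have "(mat 1 - B c p ** P c p) ** matrix_inv (mat 1 - B c p ** P c p) = mat 1"
      using i unfolding invertible_def matrix_inv_def by (rule someI2_ex) simp
    then show ?thesis using q by blast
  qed
  then show ?thesis using B unfolding gauge_by_def by blast
qed

text \<open>From N = 1 + B Q the matrix belonging to the form -B and to \<open>Q\<close> is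
  \<open>N\<close>, and its inverse is 1 - B P; hence P = Q (1 - B P) has the required
  shape.\<close>

lemma gauge_by_sym:
  assumes g: "gauge_by B P Q"
  shows "gauge_by (\<lambda>c p. - B c p) Q P"
  unfolding gauge_by_def
proof (intro conjI ballI)
  have B: "closed_two_form A B" using g unfolding gauge_by_def by blast
  then have tB: "two_form A B" unfolding closed_two_form_def by blast
  then have sB: "smooth_field A B" unfolding two_form_def by blast
  have "two_form A (\<lambda>c p. - B c p)" unfolding two_form_def
  proof (intro conjI ballI)
    show "smooth_field A (\<lambda>c p. - B c p)" unfolding smooth_field_def o_def
      by (intro ballI smooth_on_minus chart_open smooth_fieldD[OF sB])
    show "transpose (- B c p) = - (- B c p)" if "c \<in> A" "p \<in> dom_of c" for c p
      unfolding vec_eq_iff Finite_Cartesian_Product.transpose_def uminus_vec_def vec_lambda_beta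
      by (simp add: two_form_antisym[OF tB that, of _ _] flip: two_form_antisym[OF tB that])
    show "- B c p = transpose (transition_jac c d p) ** - B d p ** transition_jac c d p"
      if "c \<in> A" "d \<in> A" "p \<in> dom_of c \<inter> dom_of d" for c d p
    proof -
      have "B c p = transpose (transition_jac c d p) ** B d p ** transition_jac c d p"
        using tB that unfolding two_form_def by blast
      then show ?thesis by (simp add: matrix_minus_left matrix_minus_right)
    qed
  qed
  moreover have "chart_deriv c (\<lambda>p. - B c p) p v = - chart_deriv c (B c) p v" if "c \<in> A" "p \<in> dom_of c" for c p v
    by (simp add: chart_deriv_eqI[OF has_derivative_minus[OF smooth_field_has_chart_deriv[OF sB that]]])
  moreover have "- chart_deriv c (B c) p (axis i 1) $ j $ k + - chart_deriv c (B c) p (axis j 1) $ k $ i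
      + - chart_deriv c (B c) p (axis k 1) $ i $ j = 0" if "c \<in> A" "p \<in> dom_of c" for c p i j k
  proof -
    have "chart_deriv c (B c) p (axis i 1) $ j $ k + chart_deriv c (B c) p (axis j 1) $ k $ i
      + chart_deriv c (B c) p (axis k 1) $ i $ j = 0"
      using B that unfolding closed_two_form_def by blast
    then show ?thesis by linarith
  qed
  ultimately show "closed_two_form A (\<lambda>c p. - B c p)"
    unfolding closed_two_form_def by simp
  fix c p assume c: "c \<in> A" "p \<in> dom_of c"
  obtain N where N: "(mat 1 - B c p ** P c p) ** N = mat 1" "Q c p = P c p ** N"
    using g c unfolding gauge_by_def by blast
  have N': "N ** (mat 1 - B c p ** P c p) = mat 1" using N(1) matrix_left_right_inverse by blast
  have "N - B c p ** Q c p = mat 1" using N(1) by (simp add: N(2) matrix_sub_rdistrib matrix_mul_assoc)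
  then have "mat 1 - (- B c p) ** Q c p = N" by (simp add: matrix_minus_left algebra_simps)
  moreover have "P c p = Q c p ** (mat 1 - B c p ** P c p)" by (simp add: N(2) N' flip: matrix_mul_assoc)
  ultimately show "\<exists>N. (mat 1 - (- B c p) ** Q c p) ** N = mat 1 \<and> P c p = Q c p ** N" using N' by metis
qed

text \<open>The density is corrected by the square root of the determinant of \<open>Id - B\<^sup>\<flat> \<circ> \<Pi>\<^sup>\<sharp>\<close>; for symplectic
  \<open>\<Pi>\<close> this is the change of the Liouville volume.\<close>

lemma gauge_by_unimodular:
  assumes P: "poisson_bivector A P" and Q: "poisson_bivector A Q" and g: "gauge_by B P Q"
    and \<phi>: "log_density \<phi>" and Z: "\<And>c p. modular_field P \<phi> c p = 0"
  shows "\<exists>f. smooth_fun A f \<and> (\<forall>c p. modular_field Q (\<lambda>c q. \<phi> c q + f q) c p = 0)"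
proof -
  note bP = poisson_bivector_field[OF P] and bQ = poisson_bivector_field[OF Q]
  note sP = bivector_smooth[OF bP] and sQ = bivector_smooth[OF bQ]
  have B: "closed_two_form A B" using g unfolding gauge_by_def by blast
  then have tB: "two_form A B" unfolding closed_two_form_def by blast
  then have sB: "smooth_field A B" unfolding two_form_def by blast
  define M where "M c q = mat 1 - B c q ** P c q" for c q
  have inv: "\<exists>N. M c p ** N = mat 1 \<and> N ** M c p = mat 1 \<and> Q c p = P c p ** N" if "c \<in> A" "p \<in> dom_of c" for c p
    using g that unfolding gauge_by_def M_def by (metis matrix_left_right_inverse)
  have M0: "det (M c p) \<noteq> 0" if "c \<in> A" "p \<in> dom_of c" for c p
    using inv[OF that] by (metis det_I det_mul mult_zero_left zero_neq_one)
  \<comment> \<open>1 - B P is conjugated by the transposed Jacobian under a change of charts, as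
    befits an endomorphism of the cotangent bundle.\<close>
  have dM: "det (M c p) = det (M d p)" if c: "c \<in> A" "p \<in> dom_of c" and d: "d \<in> A" "p \<in> dom_of d" for c d p
  proof -
    define J where "J = transition_jac c d p"
    define T where "T = transpose J"
    have 1: "B c p = T ** B d p ** J" using tB c d unfolding two_form_def T_def J_def by blast
    have 2: "P d p = J ** P c p ** T" using bP c d unfolding bivector_field_def T_def J_def by blast
    have "T ** M d p = M c p ** T"
      by (simp add: M_def 1 2 matrix_sub_ldistrib matrix_sub_rdistrib matrix_mul_assoc)
    then have "det T * det (M d p) = det (M c p) * det T" by (metis det_mul)
    moreover have "det T \<noteq> 0" using det_transition_jac[OF c(1) d(1) c(2) d(2)] by (simp add: T_def J_def)
    ultimately show ?thesis by simp
  qed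
  define f where "f p = ln \<bar>det (M (SOME c. c \<in> A \<and> p \<in> dom_of c) p)\<bar> / 2" for p
  have f_eq: "f p = ln \<bar>det (M c p)\<bar> / 2" if c: "c \<in> A" "p \<in> dom_of c" for c p
  proof -
    define d where "d = (SOME c. c \<in> A \<and> p \<in> dom_of c)"
    have d: "d \<in> A \<and> p \<in> dom_of d"
      unfolding d_def by (rule someI[of "\<lambda>c. c \<in> A \<and> p \<in> dom_of c" c]) (use c in blast)
    then show ?thesis using dM[OF c, of d] by (simp add: f_def flip: d_def)
  qed
  have sM: "smooth_on (coord c ` dom_of c) (\<lambda>x. M c (cinv c x))" if c: "c \<in> A" for c
    unfolding M_def by (rule smooth_on_diff[OF chart_open(2)[OF c] smooth_on_const
        smooth_on_bilinear[OF chart_open(2)[OF c] bounded_bilinear_matrix_mult smooth_fieldD[OF sB c] smooth_fieldD[OF sP c]]])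
  have f: "smooth_fun A f" unfolding smooth_fun_def o_def
  proof
    fix c assume c: "c \<in> A"
    note o = chart_open(2)[OF c]
    have "smooth_on (coord c ` dom_of c) (\<lambda>x. (1/2) * ln \<bar>det (M c (cinv c x))\<bar>)"
      by (rule smooth_on_cmult[OF o smooth_on_ln_abs[OF o smooth_on_det[OF o sM[OF c]]]])
        (rule M0[OF c cinv_in_dom])
    then show "smooth_on (coord c ` dom_of c) (\<lambda>x. f (cinv c x))"
      by (rule smooth_on_cong[OF o, rotated]) (simp add: f_eq[OF c cinv_in_dom])
  qed
  have "modular_field Q (\<lambda>c q. \<phi> c q + f q) c p $ i = 0" if c: "c \<in> A" "p \<in> dom_of c" for c p i
  proof -
    note o = chart_open(2)[OF c(1)]
    have x: "coord c p \<in> coord c ` dom_of c" using c by blast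
    have e: "cinv c (coord c p) = p" by (rule cinv_coord[OF c])
    obtain N where N: "M c p ** N = mat 1" "N ** M c p = mat 1" "Q c p = P c p ** N" using inv[OF c] by blast
    note hP = smooth_field_has_chart_deriv[OF sP c] and hQ = smooth_field_has_chart_deriv[OF sQ c]
      and hB = smooth_field_has_chart_deriv[OF sB c]
    have hM: "has_chart_deriv c (M c) (\<lambda>v. - (chart_deriv c (B c) p v ** P c p + B c p ** chart_deriv c (P c) p v)) p"
      unfolding M_def
      using has_derivative_diff[OF has_derivative_const[of "mat 1"] bounded_bilinear.FDERIV[OF bounded_bilinear_matrix_mult hB hP]]
      by (simp add: e add.commute)
    \<comment> \<open>The inverse \<open>N\<close> is chosen pointwise and carries no smoothness of
      its own. The relation Q M = P is differentiated instead, all of whose entries are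
      smooth.\<close>
    have dQ: "chart_deriv c (Q c) p v ** M c p - Q c p ** (chart_deriv c (B c) p v ** P c p + B c p ** chart_deriv c (P c) p v)
        = chart_deriv c (P c) p v" for v
    proof -
      have "has_chart_deriv c (P c) (\<lambda>v. Q c p ** - (chart_deriv c (B c) p v ** P c p + B c p ** chart_deriv c (P c) p v)
         + chart_deriv c (Q c) p v ** M c p) p"
        using bounded_bilinear.FDERIV[OF bounded_bilinear_matrix_mult hQ hM] unfolding e
      proof (rule has_derivative_transform_within_open[OF _ o x])
        fix x assume "x \<in> coord c ` dom_of c"
        then have q: "cinv c x \<in> dom_of c" by (rule cinv_in_dom)
        obtain N where "N ** M c (cinv c x) = mat 1" "Q c (cinv c x) = P c (cinv c x) ** N" using inv[OF c(1) q] by blast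
        then show "Q c (cinv c x) ** M c (cinv c x) = P c (cinv c x)" by (simp flip: matrix_mul_assoc)
      qed
      from fun_cong[OF chart_deriv_eqI[OF this], of v]
      have "chart_deriv c (P c) p v = - (Q c p ** (chart_deriv c (B c) p v ** P c p + B c p ** chart_deriv c (P c) p v))
         + chart_deriv c (Q c) p v ** M c p"
        unfolding matrix_minus_right .
      moreover have "Z = - Y + X \<Longrightarrow> X - Y = Z" for X Y Z :: "real ^ 'n ^ 'n" by simp
      ultimately show ?thesis by blast
    qed
    have "((\<lambda>x. ln \<bar>det (M c (cinv c x))\<bar>) has_derivative
        (\<lambda>v. trace (N ** - (chart_deriv c (B c) p v ** P c p + B c p ** chart_deriv c (P c) p v)))) (at (coord c p))"
      by (rule has_derivative_ln_abs_det[OF hM]) (simp add: e N(2))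
    from has_derivative_mult_right[OF this, of "1/2"]
    have "has_chart_deriv c f (\<lambda>v. (1/2) * trace (N ** - (chart_deriv c (B c) p v ** P c p + B c p ** chart_deriv c (P c) p v))) p"
      by (rule has_derivative_transform_within_open[OF _ o x]) (simp add: f_eq[OF c(1) cinv_in_dom])
    note df = chart_deriv_eqI[OF this]
    have tr: "trace (- X) = - trace X" for X :: "real ^ 'n ^ 'n" by (simp add: trace_def sum_negf)
    have df: "chart_deriv c f p v = - trace (N ** (chart_deriv c (B c) p v ** P c p + B c p ** chart_deriv c (P c) p v)) / 2" for v
      unfolding df matrix_minus_right tr by simp
    have "(\<Sum>j\<in>UNIV. chart_deriv c (Q c) p (axis j 1) $ i $ j)
        + (\<Sum>j\<in>UNIV. Q c p $ i $ j * (chart_deriv c (\<phi> c) p (axis j 1) + chart_deriv c f p (axis j 1))) = 0"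
    proof (rule gauge_preserves_unimodularity[where P="P c p" and B="B c p" and Q="Q c p" and N=N
          and dP="\<lambda>l. chart_deriv c (P c) p (axis l 1)" and dB="\<lambda>l. chart_deriv c (B c) p (axis l 1)"])
      show "P c p $ j $ i = - P c p $ i $ j" for i j by (rule bivector_antisym[OF bP c])
      show "Q c p $ j $ i = - Q c p $ i $ j" for i j by (rule bivector_antisym[OF bQ c])
      show "B c p $ j $ i = - B c p $ i $ j" for i j by (rule two_form_antisym[OF tB c])
      show "chart_deriv c (P c) p (axis l 1) $ j $ i = - chart_deriv c (P c) p (axis l 1) $ i $ j" for l i j
        unfolding chart_deriv_fderiv
        by (rule fderiv_antisym[OF o x differentiableI[OF hP] bivector_antisym[OF bP c(1) cinv_in_dom]])
      show "chart_deriv c (B c) p (axis l 1) $ j $ i = - chart_deriv c (B c) p (axis l 1) $ i $ j" for l i j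
        unfolding chart_deriv_fderiv
        by (rule fderiv_antisym[OF o x differentiableI[OF hB] two_form_antisym[OF tB c(1) cinv_in_dom]])
      show "(mat 1 - B c p ** P c p) ** N = mat 1" using N(1) by (simp add: M_def)
      show "Q c p = P c p ** N" by (rule N(3))
      show "chart_deriv c (Q c) p (axis l 1) ** (mat 1 - B c p ** P c p)
         - Q c p ** (chart_deriv c (B c) p (axis l 1) ** P c p + B c p ** chart_deriv c (P c) p (axis l 1))
         = chart_deriv c (P c) p (axis l 1)" for l
        using dQ unfolding M_def .
      show "chart_deriv c f p (axis l 1)
         = - trace (N ** (chart_deriv c (B c) p (axis l 1) ** P c p + B c p ** chart_deriv c (P c) p (axis l 1))) / 2" for l
        by (rule df)
      show "(\<Sum>l\<in>UNIV. P c p $ l $ i * chart_deriv c (P c) p (axis l 1) $ j $ k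
          + P c p $ l $ j * chart_deriv c (P c) p (axis l 1) $ k $ i
          + P c p $ l $ k * chart_deriv c (P c) p (axis l 1) $ i $ j) = 0" for i j k
        unfolding chart_deriv_fderiv by (rule poisson_jacobi[OF P c])
      show "chart_deriv c (B c) p (axis i 1) $ j $ k + chart_deriv c (B c) p (axis j 1) $ k $ i
          + chart_deriv c (B c) p (axis k 1) $ i $ j = 0" for i j k
        using B c unfolding closed_two_form_def by blast
      show "(\<Sum>j\<in>UNIV. chart_deriv c (P c) p (axis j 1) $ i $ j)
          + (\<Sum>j\<in>UNIV. P c p $ i $ j * chart_deriv c (\<phi> c) p (axis j 1)) = 0" for i
        using Z[of c p] modular_field_nth[OF c, of P \<phi> i] by simp
    qed
    then show ?thesis by (simp add: modular_field_nth[OF c] chart_deriv_log_density_add[OF \<phi> f c])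
  qed
  then have "modular_field Q (\<lambda>c q. \<phi> c q + f q) c p = 0" for c p
    by (cases "c \<in> A \<and> p \<in> dom_of c") (auto simp: vec_eq_iff modular_field_def)
  then show ?thesis using f by blast
qed

lemma gauge_by_modular_class_zero:
  assumes P: "poisson_bivector A P" and Q: "poisson_bivector A Q" and g: "gauge_by B P Q"
    and \<Omega>: "volume_form A \<Omega>" and "modular_class A P = H1_zero A P"
  shows "modular_class A Q = H1_zero A Q"
proof -
  obtain f where f: "smooth_fun A f" "\<And>c p. modular_field P (\<lambda>c q. log_volume \<Omega> c q + f q) c p = 0"
    using assms(5) modular_class_eq_zero_iff[OF P \<Omega>] by blast
  \<comment> \<open>\<open>f\<close> makes \<open>P\<close> unimodular, and \<open>f'\<close> is the
    gauge correction for the density already changed by \<open>f\<close>; their sum is the witness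
    for \<open>Q\<close>.\<close>
  obtain f' where f': "smooth_fun A f'" "\<And>c p. modular_field Q (\<lambda>c q. log_volume \<Omega> c q + f q + f' q) c p = 0"
    using gauge_by_unimodular[OF P Q g log_density_add[OF log_density_log_volume[OF \<Omega>] f(1)] f(2)] by blast
  show ?thesis unfolding modular_class_eq_zero_iff[OF Q \<Omega>]
    using smooth_fun_add[OF f(1) f'(1)] f'(2) by (intro exI[of _ "\<lambda>q. f q + f' q"]) (simp add: add.assoc)
qed

end

theorem proposition5p1:
  fixes A :: "('m::{t2_space, second_countable_topology}, 'n::finite) chart set"
    and P Q :: "('m, 'n, real ^ 'n ^ 'n) field"
  assumes "smooth_atlas A"
    and "orientable A"
    and "poisson_bivector A P"
    and "poisson_bivector A Q"
    and "gauge_equivalent A P Q"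
  shows "modular_class A P = H1_zero A P \<longleftrightarrow> modular_class A Q = H1_zero A Q"
proof -
  interpret manifold A by unfold_locales (rule assms(1))
  obtain \<Omega> where \<Omega>: "volume_form A \<Omega>" using assms(2) unfolding orientable_def by blast
  obtain B where B: "gauge_by B P Q"
    using gauge_equivalent_imp_gauge_by[OF poisson_bivector_field poisson_bivector_field] assms(3-5) by blast
  show ?thesis
    using gauge_by_modular_class_zero[OF assms(3,4) B \<Omega>]
      gauge_by_modular_class_zero[OF assms(4,3) gauge_by_sym[OF B] \<Omega>] by blast
qed

end
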